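(* Let $T>0$ and let $\rho_0\in\mathcal P_2(\mathbb R^d)$ with $\operatorname{supp}\rho_0=B_R$ for some $R>0$. (1) Fix $\varepsilon>0$, $\sigma\in(0,1)$, and let $V_1\in C^2_c(\mathbb R^d)$ satisfy (V1). Let $\rho^{\varepsilon,\sigma}$ be the weak measure solution with initial datum $\rho_0$, constructed by the JKO scheme, of $\partial_t\rho=(1-\sigma)\nabla\cdot(\rho\nabla V_\varepsilon*\log((1-\sigma)V_\varepsilon*\rho+\sigma\mathcal N_1))$. Then for every $t\in[0,T]$, $\rho^{\varepsilon,\sigma}_t=(X^{\varepsilon,\sigma}_t)_\#\rho_0$, where $t\mapsto X^{\varepsilon,\sigma}_t(x)$ is the solution of $$\frac{d}{dt}X^{\varepsilon,\sigma}_t(x)=-(1-\sigma)\,\omega^{\varepsilon,\sigma}_t(X^{\varepsilon,\sigma}_t(x)),\qquad X_0^{\varepsilon,\sigma}(x)=x,\qquad \omega^{\varepsilon,\sigma}_t:=\nabla V_\varepsilon*\log[(1-\sigma)V_\varepsilon*\rho^{\varepsilon,\sigma}_t+\sigma\mathcal N_1].$$ Moreover $\rho^{\varepsilon,\sigma}$ is compactly supported on $[0,T]$, with $\operatorname{supp}\rho^{\varepsilon,\sigma}_t\subseteq B_{\langle R\rangle e^{C^1_{\varepsilon,\sigma}T}}$ for all $t\in[0,T]$, where $C^1_{\varepsilon,\sigma}$ is a constant such that $|\omega^{\varepsilon,\sigma}_t(x)|\le C^1_{\varepsilon,\sigma}\langle x\rangle$ for all $t,x$, scaling like $C^1_{\varepsilon,\sigma}\simeq\varepsilon^{-1}(|\log\sigma|+d|\log\varepsilon|+1)$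 for $0<\varepsilon,\sigma\ll1$. (2) If $\sigma=0$, $\varepsilon>0$ and $V_1=\mathcal N_1$, then a weak measure solution $\rho^\varepsilon$ with initial datum $\rho_0$, constructed by the JKO scheme, of $\partial_t\rho=\nabla\cdot(\rho\nabla V_\varepsilon*\log(V_\varepsilon*\rho))$ satisfies $\rho^\varepsilon_t=(X^\varepsilon_t)_\#\rho_0$ and $\operatorname{supp}\rho^\varepsilon_t\subseteq B_{R+C_\varepsilon T}$ for all $t\in[0,T]$, where $C_\varepsilon=C/\varepsilon$ with $C=C(V_1)>0$, and $X^\varepsilon_t(x)$ solves $$\frac{d}{dt}X^\varepsilon_t(x)=-\omega^\varepsilon_t(X^\varepsilon_t(x)),\qquad X^\varepsilon_0(x)=x,\qquad \omega^\varepsilon_t:=\nabla V_\varepsilon*\log(V_\varepsilon*\rho^\varepsilon_t).$$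
   Context: $\mathcal P_2(\mathbb R^d)$: Borel probability measures on $\mathbb R^d$ with finite second moment, with the 2-Wasserstein distance $d_W$. $B_R$: closed ball of radius $R$ centred at $0$. $\langle x\rangle:=\sqrt{1+|x|^2}$ (also for scalars). $\mathcal N_1(x)=Z^{-1}\exp(-\langle x\rangle)$, $Z$ normalising $\int\mathcal N_1=1$. $T_\#\mu$ is the push-forward. (V1): $V_1\in C_b(\mathbb R^d)\cap C^1(\mathbb R^d)$, $V_1\ge0$, $\|V_1\|_{L^1}=1$, $V_1(x)=V_1(-x)$. $V_\varepsilon(x):=\varepsilon^{-d}V_1(x/\varepsilon)$. $\mathcal H^\varepsilon_\sigma[\rho]:=\int((1-\sigma)V_\varepsilon*\rho+\sigma\mathcal N_1)\log((1-\sigma)V_\varepsilon*\rho+\sigma\mathcal N_1)\,dx$, for $\sigma\in[0,1)$. Weak measure solution ($\sigma\in[0,1)$): an absolutely continuous curve $\rho:[0,T]\to\mathcal P_2(\mathbb R^d)$ such that for all $\varphi\in C^1_c(\mathbb R^d)$, $t\in[0,T]$, $$\int\varphi\,d\rho_t-\int\varphi\,d\rho_0=-(1-\sigma)\int_0^t\int\nabla\varphi\cdot\nabla V_\varepsilon*[\log((1-\sigma)V_\varepsilon*\rho_s+\sigma\mathcal N_1)]\,d\rho_s\,ds.$$ Constructed by the JKO scheme: for small $\tau>0$ set $\rho_\tau^0:=\rho_0$ and choose $\rho_\tau^{n+1}\in\operatorname{argmin}_{\rho\in\mathcal P_2(\mathbb R^d)}\{\frac1{2\tau}d_W^2(\rho_\tau^n,\rho)+\mathcal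 H^\varepsilon_\sigma[\rho]\}$, $n=0,\dots,N-1$, $N=\lceil T/\tau\rceil$; let $\rho_\tau(0)=\rho_0$, $\rho_\tau(t)=\rho_\tau^n$ for $t\in((n-1)\tau,n\tau]$. The constructed solution is an absolutely continuous curve $[0,T]\to\mathcal P_2(\mathbb R^d)$ that is the narrow limit, uniformly in $t$, of $\rho_{\tau_k}$ along some sequence $\tau_k\to0$; it is a weak measure solution. *)

theory Defs
  imports "HOL-Probability.Probability" "HOL-Library.Landau_Symbols"
begin

definition jap :: "'a::real_normed_vector \<Rightarrow> real" where
  "jap x = sqrt (1 + (norm x)\<^sup>2)"

definition grad :: "('a::euclidean_space \<Rightarrow> real) \<Rightarrow> 'a \<Rightarrow> 'a" where
  "grad f x = (\<Sum>b\<in>Basis. frechet_derivative f (at x) b *\<^sub>R b)"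

definition C1_fun :: "('a::euclidean_space \<Rightarrow> real) \<Rightarrow> bool" where
  "C1_fun f \<longleftrightarrow> (\<forall>x. f differentiable (at x)) \<and> continuous_on UNIV (grad f)"

definition C2_fun :: "('a::euclidean_space \<Rightarrow> real) \<Rightarrow> bool" where
  "C2_fun f \<longleftrightarrow> C1_fun f \<and> (\<forall>b\<in>Basis. C1_fun (\<lambda>x. grad f x \<bullet> b))"

definition Cb_fun :: "('a::topological_space \<Rightarrow> real) \<Rightarrow> bool" where
  "Cb_fun f \<longleftrightarrow> continuous_on UNIV f \<and> bounded (range f)"

definition compactly_supported :: "('a::topological_space \<Rightarrow> real) \<Rightarrow> bool" where
  "compactly_supported f \<longleftrightarrow> compact (closure {x. f x \<noteq> 0})"

definition admissible_kernel :: "('a::euclidean_space \<Rightarrow> real) \<Rightarrow> bool" where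
  "admissible_kernel V \<longleftrightarrow>
     Cb_fun V \<and> C1_fun V \<and> (\<forall>x. 0 \<le> V x) \<and>
     integrable lborel V \<and> (LINT x|lborel. \<bar>V x\<bar>) = 1 \<and> (\<forall>x. V x = V (- x))"

definition rescale :: "('a::euclidean_space \<Rightarrow> real) \<Rightarrow> real \<Rightarrow> 'a \<Rightarrow> real" where
  "rescale V \<epsilon> x = V (x /\<^sub>R \<epsilon>) / \<epsilon> ^ DIM('a)"

definition N1 :: "'a::euclidean_space \<Rightarrow> real" where
  "N1 x = exp (- jap x) / (LINT y|lborel. exp (- jap (y::'a)))"

definition P2 :: "'a::euclidean_space measure set" where
  "P2 = {\<mu>. prob_space \<mu> \<and> sets \<mu> = sets borel \<and> integrable \<mu> (\<lambda>x. (norm x)\<^sup>2)}"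

definition couplings :: "'a::euclidean_space measure \<Rightarrow> 'a measure \<Rightarrow> ('a \<times> 'a) measure set" where
  "couplings \<mu> \<nu> = {\<pi>. sets \<pi> = sets (borel \<Otimes>\<^sub>M borel) \<and>
     distr \<pi> borel fst = \<mu> \<and> distr \<pi> borel snd = \<nu>}"

text \<open>The infimum is finite whenever both arguments lie in \<^const>\<open>P2\<close>
  (use the product coupling), so the conversion to a real number loses nothing there.\<close>

definition dW :: "'a::euclidean_space measure \<Rightarrow> 'a measure \<Rightarrow> real" where
  "dW \<mu> \<nu> = sqrt (enn2real (INF \<pi>\<in>couplings \<mu> \<nu>.
     \<integral>\<^sup>+ z. ennreal ((dist (fst z) (snd z))\<^sup>2) \<partial>\<pi>))"

definition measure_support :: "'a::topological_space measure \<Rightarrow> 'a set" where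
  "measure_support \<mu> = {x. \<forall>U. open U \<and> x \<in> U \<longrightarrow> emeasure \<mu> U > 0}"

text \<open>Absolute continuity of a curve in the metric sense: the distance is controlled by
  the integral of an \<open>L\<^sup>1\<close> function.\<close>

definition AC_curve :: "real \<Rightarrow> (real \<Rightarrow> 'a::euclidean_space measure) \<Rightarrow> bool" where
  "AC_curve T \<rho> \<longleftrightarrow> (\<forall>t\<in>{0..T}. \<rho> t \<in> P2) \<and>
     (\<exists>m. set_integrable lborel {0..T} m \<and>
        (\<forall>s t. 0 \<le> s \<and> s \<le> t \<and> t \<le> T \<longrightarrow> dW (\<rho> s) (\<rho> t) \<le> (LINT r:{s..t}|lborel. m r)))"

text \<open>The regularised density \<open>(1 - \<sigma>) V\<^sub>\<epsilon> * \<mu> + \<sigma> N\<^sub>1\<close>.\<close>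

definition reg_density :: "('a::euclidean_space \<Rightarrow> real) \<Rightarrow> real \<Rightarrow> real \<Rightarrow> 'a measure \<Rightarrow> 'a \<Rightarrow> real" where
  "reg_density V \<epsilon> \<sigma> \<mu> x = (1 - \<sigma>) * (LINT y|\<mu>. rescale V \<epsilon> (x - y)) + \<sigma> * N1 x"

text \<open>For \<open>\<mu>\<close> in \<^const>\<open>P2\<close> and a bounded kernel with finite second moment the density is
  bounded and has finite second moment, so the integrand is integrable and the Bochner
  integral is the true value of the entropy. Note \<^prop>\<open>ln 0 = (0::real)\<close>, which gives the usual
  convention \<open>0 log 0 = 0\<close>.\<close>

definition entropy_fun :: "('a::euclidean_space \<Rightarrow> real) \<Rightarrow> real \<Rightarrow> real \<Rightarrow> 'a measure \<Rightarrow> real" where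
  "entropy_fun V \<epsilon> \<sigma> \<mu> =
     (LINT x|lborel. reg_density V \<epsilon> \<sigma> \<mu> x * ln (reg_density V \<epsilon> \<sigma> \<mu> x))"

text \<open>\<open>\<nabla>V\<^sub>\<epsilon> * log ((1 - \<sigma>) V\<^sub>\<epsilon> * \<mu> + \<sigma> N\<^sub>1)\<close>\<close>

definition omega :: "('a::euclidean_space \<Rightarrow> real) \<Rightarrow> real \<Rightarrow> real \<Rightarrow> 'a measure \<Rightarrow> 'a \<Rightarrow> 'a" where
  "omega V \<epsilon> \<sigma> \<mu> x =
     (LINT y|lborel. ln (reg_density V \<epsilon> \<sigma> \<mu> y) *\<^sub>R grad (rescale V \<epsilon>) (x - y))"

definition weak_measure_solution ::
  "('a::euclidean_space \<Rightarrow> real) \<Rightarrow> real \<Rightarrow> real \<Rightarrow> real \<Rightarrow> (real \<Rightarrow> 'a measure) \<Rightarrow> bool" where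
  "weak_measure_solution V \<epsilon> \<sigma> T \<rho> \<longleftrightarrow> AC_curve T \<rho> \<and>
     (\<forall>\<phi> t. C1_fun \<phi> \<and> compactly_supported \<phi> \<and> t \<in> {0..T} \<longrightarrow>
        (LINT x|\<rho> t. \<phi> x) - (LINT x|\<rho> 0. \<phi> x) =
          - (1 - \<sigma>) * (LINT s:{0..t}|lborel. (LINT x|\<rho> s. grad \<phi> x \<bullet> omega V \<epsilon> \<sigma> (\<rho> s) x)))"

definition jko_scheme ::
  "('a::euclidean_space \<Rightarrow> real) \<Rightarrow> real \<Rightarrow> real \<Rightarrow> real \<Rightarrow> 'a measure \<Rightarrow> real \<Rightarrow> (nat \<Rightarrow> 'a measure) \<Rightarrow> bool"
where
  "jko_scheme V \<epsilon> \<sigma> T \<rho>\<^sub>0 \<tau> r \<longleftrightarrow> r 0 = \<rho>\<^sub>0 \<and>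
     (\<forall>n < nat \<lceil>T / \<tau>\<rceil>.
        is_arg_min (\<lambda>\<mu>. 1 / (2 * \<tau>) * (dW (r n) \<mu>)\<^sup>2 + entropy_fun V \<epsilon> \<sigma> \<mu>) (\<lambda>\<mu>. \<mu> \<in> P2) (r (Suc n)))"

text \<open>For \<open>t \<ge> 0\<close> one has \<open>nat \<lceil>t / \<tau>\<rceil> = n\<close> iff \<open>t \<in> ((n - 1) \<tau>, n \<tau>]\<close> when \<open>n \<ge> 1\<close>,
  and iff \<open>t = 0\<close> when \<open>n = 0\<close>.\<close>

definition jko_interpolant :: "real \<Rightarrow> (nat \<Rightarrow> 'a measure) \<Rightarrow> real \<Rightarrow> 'a measure" where
  "jko_interpolant \<tau> r t = r (nat \<lceil>t / \<tau>\<rceil>)"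

text \<open>Narrow convergence, uniformly in \<open>t\<close>: the integrals of each bounded continuous function
  converge uniformly on \<open>[0,T]\<close>. Since the limit is a continuous curve on a compact interval, this is
  the same as uniform convergence for any metric inducing the narrow topology.\<close>

definition narrow_limit_uniformly ::
  "real \<Rightarrow> (nat \<Rightarrow> real \<Rightarrow> 'a::euclidean_space measure) \<Rightarrow> (real \<Rightarrow> 'a measure) \<Rightarrow> bool" where
  "narrow_limit_uniformly T \<rho>s \<rho> \<longleftrightarrow>
     (\<forall>f. Cb_fun f \<longrightarrow>
        uniform_limit {0..T} (\<lambda>k t. LINT x|\<rho>s k t. f x) (\<lambda>t. LINT x|\<rho> t. f x) sequentially)"

definition jko_solution ::
  "('a::euclidean_space \<Rightarrow> real) \<Rightarrow> real \<Rightarrow> real \<Rightarrow> real \<Rightarrow> 'a measure \<Rightarrow> (real \<Rightarrow> 'a measure) \<Rightarrow> bool" where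
  "jko_solution V \<epsilon> \<sigma> T \<rho>\<^sub>0 \<rho> \<longleftrightarrow>
     weak_measure_solution V \<epsilon> \<sigma> T \<rho> \<and> \<rho> 0 = \<rho>\<^sub>0 \<and>
     (\<exists>\<tau> r. (\<forall>k. \<tau> k > 0) \<and> \<tau> \<longlonglongrightarrow> 0 \<and>
        (\<forall>k. jko_scheme V \<epsilon> \<sigma> T \<rho>\<^sub>0 (\<tau> k) (r k)) \<and>
        narrow_limit_uniformly T (\<lambda>k. jko_interpolant (\<tau> k) (r k)) \<rho>)"

definition solves_ode_from ::
  "(real \<Rightarrow> 'a::euclidean_space \<Rightarrow> 'a) \<Rightarrow> real \<Rightarrow> 'a \<Rightarrow> (real \<Rightarrow> 'a) \<Rightarrow> bool" where
  "solves_ode_from v T x y \<longleftrightarrow> y 0 = x \<and>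
     (\<forall>t\<in>{0..T}. (y has_vector_derivative v t (y t)) (at t within {0..T}))"

definition is_pushforward ::
  "('a::euclidean_space \<Rightarrow> 'a) \<Rightarrow> 'a measure \<Rightarrow> 'a measure \<Rightarrow> bool" where
  "is_pushforward X \<mu> \<nu> \<longleftrightarrow> X \<in> borel_measurable borel \<and> \<nu> = distr \<mu> borel X"

end

(* The velocity field v_t = -(1 - sigma) omega_t of a weak solution is continuous in t, locally Lipschitz in x and of
   linear growth, so both claims reduce to uniqueness for the linear continuity equation with velocity v.
   Uniqueness is proved by duality without differentiating the flow: a Lipschitz test function is pulled back along
   explicit Euler steps and mollified at scale delta. One step of length h costs h (O(delta) + o(1)) as h -> 0, because the commutator of mollification and transport
   only sees the oscillation of v over a ball of radius delta; let h -> 0, then delta -> 0.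

   The bounds on omega use that grad V_eps is integrated against the logarithm of the density. For sigma > 0 that
   logarithm lies between ln (sigma N1) and a constant. For the exponential kernel it is (1/eps)-Lipschitz, and since
   grad V_eps has mean zero this gives |omega| <= C / eps. *)

theory Submission
  imports Defs "HOL-Real_Asymp.Real_Asymp"
begin

section \<open>The Japanese bracket and the exponential profile\<close>

text \<open>The main obstacle is regularity: the weak formulation admits only C1 test functions of
  compact support, while a test function pulled back along Euler steps stays Lipschitz and nothing
  more. Mollifying at every step repairs this at the price of a second-derivative bound
  \<open>H\<close> that depends on \<delta>. The error terms that carry \<open>H\<close> vanish only
  with h, which dictates the order of the two limits.

  A second obstacle is that v is Lipschitz on balls only. The steps therefore use
  \<open>trunc K\<close>, the field read at the projection to a ball. Two facts make the truncation
  invisible: linear growth bounds how fast supports spread when they are pulled back, and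
  trajectories from the bounded initial support stay in a ball fixed in advance.

  All time regularity comes from one inequality: the integrals of a bounded
  \<open>L\<close>-Lipschitz function against two measures differ by at most
  \<open>L * dW\<close>.\<close>

lemma jap_ge_1: "1 \<le> jap x"
  by (simp add: jap_def)

lemma jap_pos: "0 < jap x"
  by (rule less_le_trans[OF zero_less_one jap_ge_1])

lemma jap_square: "(jap x)\<^sup>2 = 1 + (norm x)\<^sup>2"
  by (simp add: jap_def)

lemma norm_le_jap: "norm x \<le> jap x"
  unfolding jap_def by (rule real_le_rsqrt) simp

lemma jap_le: "jap x \<le> 1 + norm x"
  unfolding jap_def by (rule real_le_lsqrt) (auto simp: power2_sum)

lemma jap_minus: "jap (- x) = jap x"
  by (simp add: jap_def)

lemma jap_mono: "norm x \<le> norm y \<Longrightarrow> jap x \<le> jap y"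
  by (simp add: jap_def power_mono)

text \<open>Cauchy-Schwarz for the extended vectors (1, x) and (1, y), whose lengths are
  \<open>jap x\<close> and \<open>jap y\<close>.\<close>

lemma one_plus_inner_le_jap:
  fixes x y :: "'a::real_inner"
  shows "1 + x \<bullet> y \<le> jap x * jap y"
proof -
  have "x \<bullet> y \<le> norm x * norm y"
    by (rule norm_cauchy_schwarz)
  moreover have "1 + norm x * norm y \<le> jap x * jap y"
  proof (rule power2_le_imp_le)
    have "2 * (norm x * norm y) \<le> (norm x)\<^sup>2 + (norm y)\<^sup>2"
      using sum_squares_bound[of "norm x" "norm y"] by (simp add: mult.assoc)
    then show "(1 + norm x * norm y)\<^sup>2 \<le> (jap x * jap y)\<^sup>2"
      unfolding power_mult_distrib jap_square by (simp add: power2_eq_square algebra_simps)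
  qed (simp add: jap_pos less_imp_le)
  ultimately show ?thesis by linarith
qed

text \<open>The remainder equals (\<open>jap x * jap y\<close> - 1 - x.y) / \<open>jap x\<close>.
  Its numerator is nonnegative by the previous lemma and, by the arithmetic-geometric mean
  inequality, at most half of |y - x|^2; dividing by a number that is at least 1 does no
  harm.\<close>

lemma jap_taylor:
  fixes x y :: "'a::real_inner"
  shows "\<bar>jap y - jap x - (x /\<^sub>R jap x) \<bullet> (y - x)\<bar> \<le> (norm (y - x))\<^sup>2 / 2"
proof -
  let ?a = "jap x" and ?b = "jap y"
  have eq: "?b - ?a - (x /\<^sub>R ?a) \<bullet> (y - x) = (?a * ?b - (1 + x \<bullet> y)) / ?a"
    using jap_square[of x] jap_pos[of x]
    by (simp add: field_simps inner_diff_right power2_eq_square dot_square_norm)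
  have "2 * (?a * ?b) \<le> ?a\<^sup>2 + ?b\<^sup>2"
    using sum_squares_bound[of ?a ?b] by (simp add: mult.assoc)
  then have "?a * ?b - (1 + x \<bullet> y) \<le> (norm (y - x))\<^sup>2 / 2"
    unfolding jap_square
    by (simp add: power2_norm_eq_inner inner_diff inner_commute algebra_simps)
  moreover have "0 \<le> ?a * ?b - (1 + x \<bullet> y)"
    using one_plus_inner_le_jap[of x y] by simp
  moreover have "r / ?a \<le> r" if "0 \<le> r" for r
    using that jap_ge_1[of x] by (simp add: divide_le_eq mult_le_cancel_left1)
  ultimately show ?thesis
    unfolding eq using jap_pos[of x]
    by (smt (verit) divide_nonneg_pos)
qed

text \<open>A quadratic Taylor remainder survives integration against a bounded function of compact
  support, so mollified functions are differentiated through this criterion and not by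
  differentiating under an integral sign.\<close>

lemma has_derivative_quadratic_remainder:
  fixes f :: "'a::real_normed_vector \<Rightarrow> real"
  assumes "bounded_linear D" and rem: "\<And>y. \<bar>f y - f x - D (y - x)\<bar> \<le> C * (norm (y - x))\<^sup>2"
  shows "(f has_derivative D) (at x)"
proof (rule has_derivativeI_sandwich[of 1])
  show "norm (f y - f x - D (y - x)) / norm (y - x) \<le> C * norm (y - x)" if "y \<noteq> x" for y
    using rem[of y] that by (simp add: divide_simps power2_eq_square mult.assoc)
  have "((\<lambda>y. C * norm (y - x)) \<longlongrightarrow> C * norm (x - x)) (at x)"
    by (intro tendsto_intros)
  then show "((\<lambda>y. C * norm (y - x)) \<longlongrightarrow> 0) (at x)"
    by simp
qed (use assms in auto)

lemma has_derivative_jap: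
  fixes x :: "'a::real_inner"
  shows "(jap has_derivative (\<lambda>h. (x /\<^sub>R jap x) \<bullet> h)) (at x)"
  using jap_taylor by (intro has_derivative_quadratic_remainder[where C="1/2"] bounded_linear_inner_right) auto

lemma norm_div_jap_le: "norm (x /\<^sub>R jap x) \<le> 1"
  using norm_le_jap[of x] jap_pos[of x] by (simp add: divide_simps)

lemma jap_lipschitz:
  fixes x y :: "'a::real_inner"
  shows "\<bar>jap x - jap y\<bar> \<le> norm (x - y)"
proof -
  have "norm (jap x - jap y) \<le> 1 * norm (x - y)"
  proof (rule differentiable_bound[of UNIV])
    show "(jap has_derivative (\<lambda>h. (z /\<^sub>R jap z) \<bullet> h)) (at z within UNIV)" for z :: 'a
      by (rule has_derivative_jap)
    show "onorm (\<lambda>h. (z /\<^sub>R jap z) \<bullet> h) \<le> 1" for z :: 'a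
    proof (rule onorm_bound)
      show "norm ((z /\<^sub>R jap z) \<bullet> h) \<le> 1 * norm h" for h
        using Cauchy_Schwarz_ineq2[of "z /\<^sub>R jap z" h]
          mult_right_mono[OF norm_div_jap_le[of z] norm_ge_zero[of h]] by simp
    qed simp
  qed auto
  then show ?thesis by simp
qed

lemma continuous_jap [continuous_intros]: "continuous_on S f \<Longrightarrow> continuous_on S (\<lambda>x. jap (f x))"
  unfolding jap_def by (intro continuous_intros)

lemma borel_measurable_jap [measurable]: "jap \<in> borel_measurable borel"
  by (intro borel_measurable_continuous_onI continuous_intros)

lemma lipschitz_div_jap:
  fixes x y :: "'a::real_inner"
  shows "norm (x /\<^sub>R jap x - y /\<^sub>R jap y) \<le> 2 * norm (x - y)"
proof -
  \<comment> \<open>Only the numerator changes in the first summand and only the denominator in the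
    second, so each contributes |x - y| once.\<close>
  have "x /\<^sub>R jap x - y /\<^sub>R jap y
      = (x - y) /\<^sub>R jap x + ((jap y - jap x) / jap x) *\<^sub>R (y /\<^sub>R jap y)"
  proof -
    have "(jap y - jap x) / jap x * (1 / jap y) = 1 / jap x - 1 / jap y"
      using jap_pos[of x] jap_pos[of y] by (simp add: field_simps)
    then show ?thesis
      by (simp add: scaleR_diff_right scaleR_diff_left divide_inverse del: scaleR_scaleR)
         (simp add: scaleR_diff_left[symmetric])
  qed
  also have "norm \<dots> \<le> norm (x - y) / jap x + \<bar>jap y - jap x\<bar> / jap x * norm (y /\<^sub>R jap y)"
    using jap_pos[of x] by (intro norm_triangle_le) (simp add: divide_inverse mult.commute abs_mult)
  also have "\<dots> \<le> norm (x - y) / jap x + norm (x - y) / jap x * 1"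
    using jap_pos[of x] jap_lipschitz[of y x] norm_div_jap_le[of y]
    by (intro add_mono mult_mono divide_right_mono) (auto simp: norm_minus_commute)
  also have "\<dots> \<le> 2 * norm (x - y)"
    using jap_ge_1[of x] mult_right_mono[OF jap_ge_1[of x] norm_ge_zero[of "x - y"]]
    by (simp add: field_simps)
  finally show ?thesis .
qed

text \<open>Domination by a step function: on the shell n \<le> |x| \<le> n + 1 the exponential is
  at most exp (- a n), and the ball of radius n + 1 has a volume polynomial in n, so the sum over n
  converges.\<close>

lemma integrable_exp_norm:
  assumes "0 < a"
  shows "integrable lborel (\<lambda>x::'a::euclidean_space. exp (- a * norm x))"
proof (rule integrableI_bounded)
  define c where "c n = exp (- a * real n) * (unit_ball_vol (DIM('a)) * (real n + 1) ^ DIM('a))" for n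
  have c0: "0 \<le> c n" for n
    unfolding c_def by (intro mult_nonneg_nonneg) auto
  have "summable (\<lambda>n. (real n + 1) ^ DIM('a) * exp (- a * real n))"
  proof (rule summable_comparison_test_bigo)
    show "summable (\<lambda>n. norm (1 / real n ^ 2))"
      using inverse_power_summable[of 2, where ?'a=real] by (simp add: divide_inverse)
    show "(\<lambda>n. (real n + 1) ^ DIM('a) * exp (- a * real n)) \<in> O(\<lambda>n. 1 / real n ^ 2)"
      using assms by real_asymp
  qed
  then have sm: "summable c"
    unfolding c_def by (subst mult.left_commute)
      (auto intro!: summable_mult simp: mult_ac)
  have ind: "ennreal (exp (- a * norm x))
      \<le> (\<Sum>n. ennreal (exp (- a * real n)) * indicator (cball 0 (real n + 1)) x)" for x :: 'a
  proof -
    \<comment> \<open>The single summand with index floor |x| already dominates; all the others are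
      nonnegative.\<close>
    define m where "m = nat \<lfloor>norm x\<rfloor>"
    have "real m \<le> norm x" "norm x \<le> real m + 1"
      using norm_ge_zero[of x] unfolding m_def by linarith+
    then have "ennreal (exp (- a * norm x)) \<le> ennreal (exp (- a * real m)) * indicator (cball 0 (real m + 1)) x"
      using assms by (auto simp: indicator_def)
    also have "\<dots> \<le> (\<Sum>n\<in>{m}. ennreal (exp (- a * real n)) * indicator (cball 0 (real n + 1)) x)"
      by (simp only: sum.insert sum.empty finite.emptyI empty_iff not_False_eq_True add_0_right order_refl)
    also have "\<dots> \<le> (\<Sum>n. ennreal (exp (- a * real n)) * indicator (cball 0 (real n + 1)) x)"
      by (intro sum_le_suminf) auto
    finally show ?thesis .
  qed
  have "(\<integral>\<^sup>+x. ennreal (norm (exp (- a * norm (x::'a)))) \<partial>lborel)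
      \<le> (\<integral>\<^sup>+x. (\<Sum>n. ennreal (exp (- a * real n)) * indicator (cball 0 (real n + 1)) (x::'a)) \<partial>lborel)"
    using ind by (intro nn_integral_mono) simp
  also have "\<dots> = (\<Sum>n. \<integral>\<^sup>+x. ennreal (exp (- a * real n)) * indicator (cball 0 (real n + 1)) (x::'a) \<partial>lborel)"
    by (intro nn_integral_suminf borel_measurable_times_ennreal borel_measurable_indicator) auto
  also have "\<dots> = (\<Sum>n. ennreal (c n))"
    by (simp add: nn_integral_cmult_indicator emeasure_cball ennreal_mult c_def)
  also have "\<dots> < \<infinity>"
    using suminf_ennreal_eq[OF c0 summable_sums[OF sm]] by simp
  finally show "(\<integral>\<^sup>+x. ennreal (norm (exp (- a * norm (x::'a)))) \<partial>lborel) < \<infinity>" .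
qed auto

lemma integrable_exp_jap: "integrable lborel (\<lambda>x::'a::euclidean_space. exp (- jap x))"
proof (rule Bochner_Integration.integrable_bound[OF integrable_exp_norm[of 1]])
  show "AE x::'a in lborel. norm (exp (- jap x)) \<le> norm (exp (- 1 * norm x))"
    using norm_le_jap by auto
qed auto

text \<open>Half of the exponential decay absorbs the factor |x|, through |x| / 2 \<le> exp (|x| /
  2).\<close>

lemma integrable_norm_exp_jap: "integrable lborel (\<lambda>x::'a::euclidean_space. norm x * exp (- jap x))"
proof (rule Bochner_Integration.integrable_bound)
  show "integrable lborel (\<lambda>x::'a. 2 * exp (- (1/2) * norm x))"
    using integrable_mult_right[OF integrable_exp_norm[of "1/2", where 'a='a], of 2] by simp
  have "norm x * exp (- jap x) \<le> 2 * exp (- (1/2) * norm x)" for x :: 'a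
  proof -
    have "norm x / 2 \<le> exp (norm x / 2)"
      using exp_ge_add_one_self[of "norm x / 2"] by linarith
    then have "norm x * exp (- jap x) \<le> (2 * exp (norm x / 2)) * exp (- norm x)"
      using norm_le_jap[of x] by (intro mult_mono) auto
    also have "\<dots> = 2 * exp (- (1/2) * norm x)"
      by (simp add: mult_exp_exp)
    finally show ?thesis .
  qed
  then show "AE x::'a in lborel. norm (norm x * exp (- jap x)) \<le> norm (2 * exp (- (1/2) * norm x))"
    by (intro AE_I2) (simp only: real_norm_def abs_mult abs_norm_cancel abs_exp_cancel abs_numeral)
  show "(\<lambda>x::'a. norm x * exp (- jap x)) \<in> borel_measurable lborel"
    by measurable
qed

text \<open>The normalising constant Z of \<open>N1\<close>. It depends on the space alone, hence
  the type argument.\<close>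

definition Z1 :: "'a::euclidean_space itself \<Rightarrow> real" where
  "Z1 _ = (LINT y|lborel. exp (- jap (y::'a)))"

lemma N1_eq: "N1 (x::'a::euclidean_space) = exp (- jap x) / Z1 TYPE('a)"
  by (simp add: N1_def Z1_def)

lemma Z1_pos: "0 < Z1 TYPE('a::euclidean_space)"
proof -
  have "Z1 TYPE('a) \<noteq> 0"
  proof
    assume "Z1 TYPE('a) = 0"
    then have "AE x::'a in lborel. exp (- jap x) = 0"
      unfolding Z1_def by (subst (asm) integral_nonneg_eq_0_iff_AE) (auto intro: integrable_exp_jap)
    then have "AE x::'a in lborel. False" by simp
    then have "emeasure lborel (UNIV :: 'a set) = 0"
      by (subst (asm) AE_iff_measurable[where N=UNIV]) auto
    then show False by simp
  qed
  moreover have "0 \<le> Z1 TYPE('a)"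
    unfolding Z1_def by simp
  ultimately show ?thesis by simp
qed

lemma N1_pos: "0 < N1 x"
  by (simp add: N1_eq Z1_pos)

lemma N1_le: "N1 (x::'a::euclidean_space) \<le> 1 / Z1 TYPE('a)"
  unfolding N1_eq using jap_pos[of x] Z1_pos[where 'a='a]
  by (intro divide_right_mono) (auto simp: less_imp_le)

lemma N1_lipschitz:
  "\<bar>N1 x - N1 (y::'a::euclidean_space)\<bar> \<le> 1 / Z1 TYPE('a) * norm (x - y)"
proof -
  have *: "exp (- a) - exp (- b) \<le> \<bar>a - b\<bar>" if "0 \<le> a" "0 \<le> b" for a b :: real
  proof (cases "a \<le> b")
    case True
    have "exp (- a) - exp (- b) = exp (- a) * (1 - exp (- (b - a)))"
      by (simp add: right_diff_distrib mult_exp_exp)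
    also have "\<dots> \<le> 1 * (b - a)"
      using exp_ge_add_one_self[of "- (b - a)"] that True by (intro mult_mono) (auto simp del: exp_ge_add_one_self)
    finally show ?thesis using True by simp
  next
    case False
    then have "exp (- a) \<le> exp (- b)" by simp
    then show ?thesis by linarith
  qed
  have "\<bar>exp (- jap x) - exp (- jap y)\<bar> \<le> \<bar>jap x - jap y\<bar>"
    using *[of "jap x" "jap y"] *[of "jap y" "jap x"] jap_pos[of x] jap_pos[of y] by (auto simp: abs_le_iff)
  also have "\<dots> \<le> norm (x - y)"
    by (rule jap_lipschitz)
  finally show ?thesis
    using Z1_pos[where 'a='a] by (simp add: N1_eq diff_divide_distrib[symmetric] abs_divide divide_right_mono)
qed

section \<open>Linear growth vector fields and their flows\<close>

text \<open>The product exp (- c s) u(s) is nonincreasing.\<close>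

lemma gronwall_scalar:
  fixes u u' :: "real \<Rightarrow> real"
  assumes der: "\<And>s. s \<in> {0..T} \<Longrightarrow> (u has_real_derivative u' s) (at s within {0..T})"
    and le: "\<And>s. s \<in> {0..T} \<Longrightarrow> u' s \<le> c * u s"
    and t: "t \<in> {0..T}"
  shows "u t \<le> exp (c * t) * u 0"
proof -
  let ?g = "\<lambda>s. exp (- c * s) * u s"
  have g: "(?g has_real_derivative exp (- c * s) * (u' s - c * u s)) (at s within {0..T})"
    if "s \<in> {0..T}" for s
    using der[OF that] by (auto intro!: derivative_eq_intros simp: algebra_simps)
  have "?g 0 \<ge> ?g t"
  proof (rule DERIV_nonpos_imp_decreasing_open[where f="?g"])
    show "0 \<le> t" using t by simp
    fix s assume s: "0 < s" "s < t"
    then have "(?g has_real_derivative exp (- c * s) * (u' s - c * u s)) (at s)"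
      using g[of s] t by (auto simp: at_within_Icc_at)
    moreover have "exp (- c * s) * (u' s - c * u s) \<le> 0"
      using le[of s] s t by (intro mult_nonneg_nonpos) auto
    ultimately show "\<exists>y. (?g has_real_derivative y) (at s) \<and> y \<le> 0" by blast
  next
    have "continuous_on {0..T} ?g"
      by (rule DERIV_continuous_on[OF g])
    then show "continuous_on {0..t} ?g"
      using t by (auto intro: continuous_on_subset)
  qed
  then have "exp (c * t) * (exp (- c * t) * u t) \<le> exp (c * t) * u 0"
    by (intro mult_left_mono) auto
  then show ?thesis
    by (simp add: mult.assoc[symmetric] mult_exp_exp)
qed

text \<open>The squared distance is differentiable even where the distance vanishes; the scalar
  inequality is applied to it with rate 2 L, and a square root follows.\<close>

lemma gronwall_difference:
  fixes y z :: "real \<Rightarrow> 'a::real_inner"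
  assumes y: "\<And>s. s \<in> {0..T} \<Longrightarrow> (y has_vector_derivative f s) (at s within {0..T})"
    and z: "\<And>s. s \<in> {0..T} \<Longrightarrow> (z has_vector_derivative g s) (at s within {0..T})"
    and le: "\<And>s. s \<in> {0..T} \<Longrightarrow> norm (f s - g s) \<le> L * norm (y s - z s)"
    and t: "t \<in> {0..T}"
  shows "norm (y t - z t) \<le> exp (L * t) * norm (y 0 - z 0)"
proof -
  let ?u = "\<lambda>s. (y s - z s) \<bullet> (y s - z s)"
  have "?u t \<le> exp (2 * L * t) * ?u 0"
  proof (rule gronwall_scalar[OF _ _ t])
    fix s assume s: "s \<in> {0..T}"
    have "((\<lambda>s. y s - z s) has_vector_derivative f s - g s) (at s within {0..T})"
      by (intro has_vector_derivative_diff y z s)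
    from bounded_bilinear.has_vector_derivative[OF bounded_bilinear_inner this this]
    show "(?u has_real_derivative (y s - z s) \<bullet> (f s - g s) + (f s - g s) \<bullet> (y s - z s)) (at s within {0..T})"
      by (simp add: has_real_derivative_iff_has_vector_derivative)
    have "(y s - z s) \<bullet> (f s - g s) \<le> norm (y s - z s) * norm (f s - g s)"
      by (rule norm_cauchy_schwarz)
    also have "\<dots> \<le> norm (y s - z s) * (L * norm (y s - z s))"
      by (intro mult_left_mono le s) auto
    also have "\<dots> = L * ?u s"
      by (simp add: dot_square_norm power2_eq_square)
    finally show "(y s - z s) \<bullet> (f s - g s) + (f s - g s) \<bullet> (y s - z s) \<le> 2 * L * ?u s"
      by (simp add: inner_commute)
  qed
  also have "exp (2 * L * t) = (exp (L * t))\<^sup>2"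
    by (simp add: power2_eq_square mult_exp_exp)
  finally have "(norm (y t - z t))\<^sup>2 \<le> (exp (L * t) * norm (y 0 - z 0))\<^sup>2"
    by (simp add: dot_square_norm power_mult_distrib)
  then show ?thesis
    by (rule power2_le_imp_le) simp
qed

text \<open>The same device with 1 + |y|^2, the square of \<open>jap\<close>, whose rate of growth
  is at most 2 C.\<close>

lemma gronwall_jap:
  fixes y :: "real \<Rightarrow> 'a::real_inner"
  assumes y: "\<And>s. s \<in> {0..T} \<Longrightarrow> (y has_vector_derivative f s) (at s within {0..T})"
    and le: "\<And>s. s \<in> {0..T} \<Longrightarrow> norm (f s) \<le> C * jap (y s)"
    and t: "t \<in> {0..T}"
  shows "jap (y t) \<le> exp (C * t) * jap (y 0)"
proof -
  let ?u = "\<lambda>s. 1 + y s \<bullet> y s"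
  have u: "?u s = (jap (y s))\<^sup>2" for s
    by (simp add: jap_square power2_norm_eq_inner)
  have "?u t \<le> exp (2 * C * t) * ?u 0"
  proof (rule gronwall_scalar[OF _ _ t])
    fix s assume s: "s \<in> {0..T}"
    from bounded_bilinear.has_vector_derivative[OF bounded_bilinear_inner y[OF s] y[OF s]]
    show "(?u has_real_derivative y s \<bullet> f s + f s \<bullet> y s) (at s within {0..T})"
      by (auto simp: has_real_derivative_iff_has_vector_derivative intro!: derivative_eq_intros)
    have "y s \<bullet> f s \<le> norm (y s) * norm (f s)"
      by (rule norm_cauchy_schwarz)
    also have "\<dots> \<le> jap (y s) * (C * jap (y s))"
      by (intro mult_mono le s norm_le_jap) (auto simp: jap_pos less_imp_le)
    also have "\<dots> = C * ?u s"
      by (simp only: u power2_eq_square) simp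
    finally show "y s \<bullet> f s + f s \<bullet> y s \<le> 2 * C * ?u s"
      by (simp add: inner_commute)
  qed
  also have "exp (2 * C * t) = (exp (C * t))\<^sup>2"
    by (simp add: power2_eq_square mult_exp_exp)
  finally have "(jap (y t))\<^sup>2 \<le> (exp (C * t) * jap (y 0))\<^sup>2"
    unfolding u by (simp only: power_mult_distrib)
  then show ?thesis
    by (rule power2_le_imp_le) (simp add: jap_pos less_imp_le)
qed

text \<open>Weighting the unknown by \<open>exp (- 2 L t)\<close> makes the Picard operator a contraction on the whole interval.\<close>

lemma picard_lindelof_global:
  fixes w :: "real \<Rightarrow> 'a::euclidean_space \<Rightarrow> 'a"
  assumes T: "0 \<le> T" and L: "0 < L"
    and lip: "\<And>t x y. t \<in> {0..T} \<Longrightarrow> norm (w t x - w t y) \<le> L * norm (x - y)"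
    and cont: "continuous_on ({0..T} \<times> UNIV) (\<lambda>(t, x). w t x)"
  shows "\<exists>y. solves_ode_from w T x0 y"
proof -
  define b where "b t = exp (2 * L * t)" for t :: real
  \<comment> \<open>Clamping time to [0, T] lets the Picard operator act on the complete space of
    bounded continuous functions on the whole line.\<close>
  define c where "c t = max 0 (min T t)" for t
  have c: "c t \<in> {0..T}" for t using T by (auto simp: c_def)
  have c_id: "c t = t" if "t \<in> {0..T}" for t using that by (auto simp: c_def)
  have b_pos: "0 < b t" for t by (simp add: b_def)
  \<comment> \<open>The unknown g encodes the trajectory y = x0 + b g, and \<open>I g\<close> is the
    integral of the field along it.\<close>
  define I where "I g t = integral {0..t} (\<lambda>s. w s (x0 + b s *\<^sub>R g s))" for g t
  have integrand: "continuous_on {0..T} (\<lambda>s. w s (x0 + b s *\<^sub>R apply_bcontfun g s))"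
    for g :: "real \<Rightarrow>\<^sub>C 'a"
  proof -
    have "continuous_on {0..T} (\<lambda>s. (s, x0 + b s *\<^sub>R apply_bcontfun g s))"
      unfolding b_def by (intro continuous_intros continuous_on_apply_bcontfun)
    from continuous_on_compose2[OF cont this] show ?thesis by (simp add: image_subset_iff)
  qed
  have I_cont: "continuous_on {0..T} (I (apply_bcontfun g))" for g :: "real \<Rightarrow>\<^sub>C 'a"
    unfolding I_def
    by (intro indefinite_integral_continuous_1 integrable_continuous_real integrand)
  define F where "F g t = (1 / b (c t)) *\<^sub>R I (apply_bcontfun g) (c t)" for g t
  have F: "F g \<in> bcontfun" for g
  proof -
    let ?h = "\<lambda>t. (1 / b t) *\<^sub>R I (apply_bcontfun g) t"
    have h: "continuous_on {0..T} ?h"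
      using b_pos by (intro continuous_intros I_cont) (auto simp: b_def intro!: continuous_intros)
    have "continuous_on UNIV (F g)"
      unfolding F_def
      by (rule continuous_on_compose2[OF h]) (use c in \<open>auto simp: c_def intro!: continuous_intros\<close>)
    moreover have "bounded (range (F g))"
      by (rule bounded_subset[OF compact_imp_bounded[OF compact_continuous_image[OF h]]])
         (use c in \<open>auto simp: F_def\<close>)
    ultimately show ?thesis by (simp add: bcontfun_def)
  qed
  define P where "P g = Bcontfun (F g)" for g
  have P: "apply_bcontfun (P g) = F g" for g
    unfolding P_def by (rule Bcontfun_inverse[OF F])
  have contraction: "dist (P g) (P h) \<le> 1/2 * dist g h" for g h
  proof (rule dist_bound)
    fix t
    define d where "d = dist g h"
    let ?u = "\<lambda>g s. w s (x0 + b s *\<^sub>R apply_bcontfun g s)"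
    have sub: "{0..c t} \<subseteq> {0..T}" using c[of t] by auto
    have u_int: "?u g integrable_on {0..c t}" for g
      by (intro integrable_continuous_real continuous_on_subset[OF integrand sub])
    \<comment> \<open>The integral of L exp (2 L s) from 0 is half of the weight minus 1/2: this is
      where the contraction factor 1/2 comes from, whatever the length of the interval.\<close>
    have bint: "((\<lambda>s. L * b s * d) has_integral (d / 2 * b (c t) - d / 2 * b 0)) {0..c t}"
      using c[of t] L
      by (intro fundamental_theorem_of_calculus)
         (auto simp: b_def has_real_derivative_iff_has_vector_derivative[symmetric]
           intro!: derivative_eq_intros)
    have "norm (I (apply_bcontfun g) (c t) - I (apply_bcontfun h) (c t))
        = norm (integral {0..c t} (\<lambda>s. ?u g s - ?u h s))"
      unfolding I_def by (subst Henstock_Kurzweil_Integration.integral_diff[OF u_int u_int]) simp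
    also have "\<dots> \<le> integral {0..c t} (\<lambda>s. L * b s * d)"
    proof (rule integral_norm_bound_integral)
      show "(\<lambda>s. ?u g s - ?u h s) integrable_on {0..c t}"
        by (intro integrable_diff u_int)
      show "(\<lambda>s. L * b s * d) integrable_on {0..c t}"
        using bint by blast
      fix s assume "s \<in> {0..c t}"
      then have "norm (?u g s - ?u h s) \<le> L * norm ((x0 + b s *\<^sub>R apply_bcontfun g s) - (x0 + b s *\<^sub>R apply_bcontfun h s))"
        using sub by (intro lip) auto
      also have "\<dots> = L * (b s * norm (apply_bcontfun g s - apply_bcontfun h s))"
        using b_pos[of s] by (simp add: scaleR_diff_right[symmetric])
      also have "\<dots> \<le> L * (b s * d)"
        using L b_pos[of s] dist_bounded[of g s h]
        by (intro mult_left_mono) (auto simp: d_def dist_norm)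
      finally show "norm (?u g s - ?u h s) \<le> L * b s * d" by (simp add: mult.assoc)
    qed
    also have "\<dots> = d / 2 * (b (c t) - b 0)"
      by (simp only: integral_unique[OF bint] right_diff_distrib)
    also have "\<dots> \<le> d / 2 * b (c t)"
      using b_pos[of 0] by (intro mult_left_mono) (auto simp: d_def)
    finally have "norm (I (apply_bcontfun g) (c t) - I (apply_bcontfun h) (c t)) \<le> d / 2 * b (c t)" .
    then show "dist (apply_bcontfun (P g) t) (apply_bcontfun (P h) t) \<le> 1/2 * dist g h"
      unfolding P F_def dist_norm scaleR_diff_right[symmetric] d_def[symmetric]
      using b_pos[of "c t"] by (simp add: divide_simps dist_norm d_def mult.commute)
  qed
  obtain g where g: "P g = g"
    using banach_fix_type[of "1/2" P] contraction by auto
  let ?y = "\<lambda>t. x0 + I (apply_bcontfun g) t"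
  have y: "x0 + b t *\<^sub>R apply_bcontfun g t = ?y t" if "t \<in> {0..T}" for t
  proof -
    have "apply_bcontfun g t = F g t" using P[of g] g by simp
    then show ?thesis using b_pos[of t] that by (simp add: F_def c_id)
  qed
  have "solves_ode_from w T x0 ?y"
    unfolding solves_ode_from_def
  proof (intro conjI ballI)
    show "x0 + I (apply_bcontfun g) 0 = x0" by (simp add: I_def)
    fix t assume t: "t \<in> {0..T}"
    have "(I (apply_bcontfun g) has_vector_derivative w t (x0 + b t *\<^sub>R apply_bcontfun g t)) (at t within {0..T})"
      unfolding I_def by (rule integral_has_vector_derivative[OF integrand t])
    then show "(?y has_vector_derivative w t (?y t)) (at t within {0..T})"
      unfolding y[OF t] by (auto intro!: derivative_eq_intros)
  qed
  then show ?thesis by blast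
qed

text \<open>Lipschitz constants are asked for on balls only, since for a density bounded below by a
  decaying profile the available constants of its logarithm grow with the radius. Linear growth, in
  exchange, confines each trajectory to a ball known in advance.\<close>

locale linear_growth_field =
  fixes v :: "real \<Rightarrow> 'a::euclidean_space \<Rightarrow> 'a" and T C :: real
  assumes T_nonneg: "0 \<le> T"
    and cont_time: "\<And>x. continuous_on {0..T} (\<lambda>t. v t x)"
    and local_lipschitz: "\<And>K. \<exists>L\<ge>0. \<forall>t\<in>{0..T}. \<forall>x\<in>cball 0 K. \<forall>y\<in>cball 0 K.
      norm (v t x - v t y) \<le> L * norm (x - y)"
    and growth: "\<And>t x. t \<in> {0..T} \<Longrightarrow> norm (v t x) \<le> C * jap x"
begin

section \<open>Truncation of the field, existence and uniqueness of trajectories\<close>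

lemma C_nonneg: "0 \<le> C"
proof -
  have "norm (v 0 0) \<le> C * jap (0::'a)"
    by (rule growth) (simp add: T_nonneg)
  then have "0 \<le> C * jap (0::'a)"
    using norm_ge_zero[of "v 0 0"] by linarith
  then show ?thesis by (simp add: jap_def)
qed

text \<open>Continuity in t at one fixed point x suffices, because the Lipschitz constant in space
  is uniform in t and controls the move from x to a nearby y.\<close>

lemma joint_continuous: "continuous_on ({0..T} \<times> cball 0 K) (\<lambda>(t, x). v t x)"
  unfolding continuous_on_def
proof clarify
  fix t and x :: 'a assume tx: "t \<in> {0..T}" "x \<in> cball 0 K"
  obtain L where L: "0 \<le> L" "\<And>t x y. t \<in> {0..T} \<Longrightarrow> x \<in> cball 0 K \<Longrightarrow> y \<in> cball 0 K \<Longrightarrow>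
      norm (v t x - v t y) \<le> L * norm (x - y)"
    using local_lipschitz[of K] by blast
  let ?F = "at (t, x) within {0..T} \<times> cball 0 K"
  let ?h = "\<lambda>p. L * norm (snd p - x) + norm (v (fst p) x - v t x)"
  have "continuous_on ({0..T} \<times> cball 0 K) ?h"
    by (intro continuous_intros continuous_on_compose2[OF cont_time[of x]]) auto
  then have "(?h \<longlongrightarrow> ?h (t, x)) ?F"
    using tx unfolding continuous_on_def by blast
  then have h: "(?h \<longlongrightarrow> 0) ?F" by simp
  have "((\<lambda>p. (case p of (t, x) \<Rightarrow> v t x) - v t x) \<longlongrightarrow> 0) ?F"
  proof (rule Lim_null_comparison[OF _ h])
    have "norm (v s y - v t x) \<le> L * norm (y - x) + norm (v s x - v t x)"
      if "s \<in> {0..T}" "y \<in> cball 0 K" for s y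
      using norm_triangle_ineq[of "v s y - v s x" "v s x - v t x"] L(2)[of s y x] tx that by simp
    then show "\<forall>\<^sub>F p in ?F. norm ((case p of (t, x) \<Rightarrow> v t x) - v t x) \<le> ?h p"
      by (auto simp: eventually_at_filter intro!: always_eventually)
  qed
  then show "((\<lambda>(t, x). v t x) \<longlongrightarrow> v t x) ?F"
    by (simp add: LIM_zero_iff)
qed

text \<open>The projection is 1-Lipschitz and does not increase the norm. Composing with it, unlike
  multiplying by a cutoff, keeps both the Lipschitz constant on the ball and the growth constant,
  and gives a field that is bounded and Lipschitz on the whole space.\<close>

definition trunc :: "real \<Rightarrow> real \<Rightarrow> 'a \<Rightarrow> 'a" where
  "trunc K t x = v t (closest_point (cball 0 K) x)"

lemma trunc_eq: "x \<in> cball 0 K \<Longrightarrow> trunc K t x = v t x"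
  by (simp add: trunc_def closest_point_self)

lemma closest_point_cball:
  assumes "0 \<le> K"
  shows "closest_point (cball 0 K) (x::'a) \<in> cball 0 K"
    and "norm (closest_point (cball 0 K) x - closest_point (cball 0 K) y) \<le> norm (x - y)"
    and "norm (closest_point (cball 0 K) x) \<le> norm x"
proof -
  show "closest_point (cball 0 K) x \<in> cball 0 K"
    using assms by (intro closest_point_in_set) auto
  show lip: "norm (closest_point (cball 0 K) x - closest_point (cball 0 K) y) \<le> norm (x - y)" for x y :: 'a
    using closest_point_lipschitz[of "cball 0 K" x y] assms by (auto simp: dist_norm)
  show "norm (closest_point (cball 0 K) x) \<le> norm x"
    using lip[of x 0] assms by (simp add: closest_point_self)
qed

lemma trunc_growth:
  assumes "0 \<le> K" "t \<in> {0..T}"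
  shows "norm (trunc K t x) \<le> C * jap x"
proof -
  have "norm (trunc K t x) \<le> C * jap (closest_point (cball 0 K) x)"
    unfolding trunc_def by (rule growth[OF assms(2)])
  also have "\<dots> \<le> C * jap x"
    by (intro mult_left_mono jap_mono closest_point_cball(3) assms C_nonneg)
  finally show ?thesis .
qed

lemma trunc_bounded:
  assumes "0 \<le> K" "t \<in> {0..T}"
  shows "norm (trunc K t x) \<le> C * (1 + K)"
proof -
  have "norm (trunc K t x) \<le> C * jap (closest_point (cball 0 K) x)"
    unfolding trunc_def by (rule growth[OF assms(2)])
  also have "\<dots> \<le> C * (1 + K)"
    using closest_point_cball(1)[OF assms(1), of x]
    by (intro mult_left_mono C_nonneg order.trans[OF jap_le]) auto
  finally show ?thesis .
qed

lemma trunc_lipschitz: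
  assumes "0 \<le> K"
  shows "\<exists>L>0. \<forall>t\<in>{0..T}. \<forall>x y. norm (trunc K t x - trunc K t y) \<le> L * norm (x - y)"
proof -
  obtain L where L: "0 \<le> L" "\<And>t x y. t \<in> {0..T} \<Longrightarrow> x \<in> cball 0 K \<Longrightarrow> y \<in> cball 0 K \<Longrightarrow>
      norm (v t x - v t y) \<le> L * norm (x - y)"
    using local_lipschitz[of K] by blast
  have "norm (trunc K t x - trunc K t y) \<le> (L + 1) * norm (x - y)" if "t \<in> {0..T}" for t x y
  proof -
    have "norm (trunc K t x - trunc K t y)
        \<le> L * norm (closest_point (cball 0 K) x - closest_point (cball 0 K) y)"
      unfolding trunc_def by (intro L(2) that closest_point_cball(1) assms)
    also have "\<dots> \<le> (L + 1) * norm (x - y)"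
      using L(1) by (intro mult_mono closest_point_cball(2) assms) auto
    finally show ?thesis .
  qed
  then show ?thesis using L(1) by (intro exI[of _ "L + 1"]) auto
qed

lemma trunc_continuous:
  assumes "0 \<le> K"
  shows "continuous_on ({0..T} \<times> UNIV) (\<lambda>(t, x). trunc K t x)"
proof -
  have "continuous_on ({0..T} \<times> UNIV) (\<lambda>p. (fst p, closest_point (cball 0 K) (snd p :: 'a)))"
    using assms
    by (intro continuous_intros continuous_on_compose2[OF continuous_on_closest_point[of "cball 0 K" UNIV]]) auto
  from continuous_on_compose2[OF joint_continuous[of K] this] show ?thesis
    using closest_point_cball(1)[OF assms] by (force simp: trunc_def case_prod_beta)
qed

text \<open>The modulus is uniform over the whole space because \<open>trunc\<close> only reads v on
  a compact cylinder.\<close>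

lemma trunc_uniformly_continuous:
  assumes "0 \<le> K" "0 < e"
  shows "\<exists>d>0. \<forall>s\<in>{0..T}. \<forall>t\<in>{0..T}. \<bar>s - t\<bar> \<le> d \<longrightarrow> (\<forall>x. norm (trunc K s x - trunc K t x) \<le> e)"
proof -
  have "uniformly_continuous_on ({0..T} \<times> cball 0 K) (\<lambda>(t, x). v t x)"
    by (intro compact_uniformly_continuous joint_continuous compact_Times) auto
  then obtain d where d: "0 < d"
    "\<And>p q. p \<in> {0..T} \<times> cball 0 K \<Longrightarrow> q \<in> {0..T} \<times> cball 0 K \<Longrightarrow> dist q p < d \<Longrightarrow>
       dist (case q of (t, x) \<Rightarrow> v t x) (case p of (t, x) \<Rightarrow> v t x) < e"
    using assms(2) unfolding uniformly_continuous_on_def by metis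
  have "norm (trunc K s x - trunc K t x) \<le> e" if "s \<in> {0..T}" "t \<in> {0..T}" "\<bar>s - t\<bar> \<le> d / 2" for s t x
    using d(2)[of "(t, closest_point (cball 0 K) x)" "(s, closest_point (cball 0 K) x)"]
      closest_point_cball(1)[OF assms(1), of x] that d(1)
    by (auto simp: trunc_def dist_norm dist_prod_def)
  then show ?thesis using d(1) by (intro exI[of _ "d / 2"]) auto
qed

lemma solution_growth:
  assumes "solves_ode_from v T x y" "t \<in> {0..T}"
  shows "jap (y t) \<le> exp (C * T) * jap x"
proof -
  have "jap (y t) \<le> exp (C * t) * jap (y 0)"
    using assms growth by (intro gronwall_jap[where T=T and f="\<lambda>t. v t (y t)"])
      (auto simp: solves_ode_from_def)
  also have "\<dots> \<le> exp (C * T) * jap (y 0)"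
    using assms(2) C_nonneg by (intro mult_right_mono) (auto simp: jap_pos less_imp_le mult_left_mono)
  finally show ?thesis using assms(1) by (simp add: solves_ode_from_def)
qed

lemma solution_bounded:
  assumes "solves_ode_from v T x y" "t \<in> {0..T}" "norm x \<le> r"
  shows "norm (y t) \<le> exp (C * T) * (1 + r)"
proof -
  have "norm (y t) \<le> exp (C * T) * jap x"
    using solution_growth[OF assms(1,2)] norm_le_jap order.trans by blast
  also have "\<dots> \<le> exp (C * T) * (1 + r)"
    using jap_le[of x] assms(3) by (intro mult_left_mono) auto
  finally show ?thesis .
qed

text \<open>The truncation radius is the a priori bound of Gronwall's lemma, which holds for the
  truncated field with the same \<open>C\<close>; so the truncated solution never leaves the ball on
  which the two fields agree.\<close>

lemma solution_exists: "\<exists>y. solves_ode_from v T x y"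
proof -
  define K where "K = exp (C * T) * jap x"
  have K: "0 \<le> K" by (simp add: K_def jap_pos less_imp_le)
  obtain L where L: "0 < L"
    "\<And>t x y. t \<in> {0..T} \<Longrightarrow> norm (trunc K t x - trunc K t y) \<le> L * norm (x - y)"
    using trunc_lipschitz[OF K] by blast
  obtain y where y: "solves_ode_from (trunc K) T x y"
    using picard_lindelof_global[OF T_nonneg L trunc_continuous[OF K]] by blast
  have "y t \<in> cball 0 K" if t: "t \<in> {0..T}" for t
  proof -
    have "jap (y t) \<le> exp (C * t) * jap (y 0)"
      using y trunc_growth[OF K] t by (intro gronwall_jap[where T=T and f="\<lambda>t. trunc K t (y t)"])
        (auto simp: solves_ode_from_def)
    also have "\<dots> \<le> K"
      using y t C_nonneg unfolding K_def
      by (intro mult_mono) (auto simp: jap_pos less_imp_le mult_left_mono solves_ode_from_def)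
    finally show ?thesis using norm_le_jap[of "y t"] by simp
  qed
  then have "solves_ode_from v T x y"
    using y by (auto simp: solves_ode_from_def trunc_eq)
  then show ?thesis by blast
qed

text \<open>All solutions that start in the ball of radius \<open>r\<close> stay in one larger ball,
  so a single Lipschitz constant serves them all. The case x = x' is uniqueness.\<close>

lemma solution_dependence:
  "\<exists>L. \<forall>x x' y y' t. norm x \<le> r \<and> norm x' \<le> r \<and> solves_ode_from v T x y \<and> solves_ode_from v T x' y' \<and> t \<in> {0..T}
      \<longrightarrow> norm (y t - y' t) \<le> exp (L * t) * norm (x - x')"
proof -
  define K where "K = exp (C * T) * (1 + r)"
  obtain L where L: "0 \<le> L" "\<And>t x y. t \<in> {0..T} \<Longrightarrow> x \<in> cball 0 K \<Longrightarrow> y \<in> cball 0 K \<Longrightarrow>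
      norm (v t x - v t y) \<le> L * norm (x - y)"
    using local_lipschitz[of K] by blast
  have "norm (y t - y' t) \<le> exp (L * t) * norm (x - x')"
    if r: "norm x \<le> r" "norm x' \<le> r"
      and y: "solves_ode_from v T x y" "solves_ode_from v T x' y'" and t: "t \<in> {0..T}" for x x' y y' t
  proof -
    have "norm (y t - y' t) \<le> exp (L * t) * norm (y 0 - y' 0)"
    proof (rule gronwall_difference[OF _ _ _ t])
      fix s assume s: "s \<in> {0..T}"
      show "(y has_vector_derivative v s (y s)) (at s within {0..T})"
        "(y' has_vector_derivative v s (y' s)) (at s within {0..T})"
        using y s by (auto simp: solves_ode_from_def)
      show "norm (v s (y s) - v s (y' s)) \<le> L * norm (y s - y' s)"
        using solution_bounded[OF y(1) s r(1)] solution_bounded[OF y(2) s r(2)]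
        by (intro L(2) s) (auto simp: K_def)
    qed
    then show ?thesis using y by (simp add: solves_ode_from_def)
  qed
  then show ?thesis by blast
qed

text \<open>The choice is made for the whole trajectory and not time by time, so t |->
  \<open>flow t x\<close> is one solution. Its values are determined for t in [0, T] only.\<close>

definition flow :: "real \<Rightarrow> 'a \<Rightarrow> 'a" where
  "flow t x = (SOME y. solves_ode_from v T x y) t"

lemma flow_solves: "solves_ode_from v T x (\<lambda>t. flow t x)"
  unfolding flow_def using someI_ex[OF solution_exists] by simp

lemma flow_unique:
  assumes "solves_ode_from v T x y" "t \<in> {0..T}"
  shows "y t = flow t x"
  using solution_dependence[of "norm x"] flow_solves[of x] assms by fastforce

lemma flow_continuous:
  assumes t: "t \<in> {0..T}"
  shows "continuous_on UNIV (flow t)"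
  unfolding continuous_on_eq_continuous_at[OF open_UNIV]
proof
  fix x
  obtain L where L: "norm (flow t y - flow t x) \<le> exp (L * t) * norm (y - x)"
    if "norm y \<le> norm x + 1" for y
    using solution_dependence[of "norm x + 1"] flow_solves t by (metis add_increasing2 order_refl zero_le_one)
  have "((\<lambda>y. exp (L * t) * norm (y - x)) \<longlongrightarrow> exp (L * t) * norm (x - x)) (at x)"
    by (intro tendsto_intros)
  then have lim: "((\<lambda>y. exp (L * t) * norm (y - x)) \<longlongrightarrow> 0) (at x)"
    by simp
  have "((\<lambda>y. flow t y - flow t x) \<longlongrightarrow> 0) (at x)"
  proof (rule Lim_null_comparison[OF _ lim])
    show "\<forall>\<^sub>F y in at x. norm (flow t y - flow t x) \<le> exp (L * t) * norm (y - x)"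
      unfolding eventually_at
    proof (intro exI[of _ 1] conjI ballI impI)
      fix y assume "y \<noteq> x \<and> dist y x < 1"
      then have "norm y \<le> norm x + 1"
        using norm_triangle_sub[of y x] by (simp add: dist_norm)
      then show "norm (flow t y - flow t x) \<le> exp (L * t) * norm (y - x)" by (rule L)
    qed simp
  qed
  then show "isCont (flow t) x"
    by (simp add: isCont_def LIM_zero_iff)
qed

end

section \<open>Integrals of Lipschitz functions and the Wasserstein distance\<close>

lemma P2_prob: "\<mu> \<in> P2 \<Longrightarrow> prob_space \<mu>" and P2_sets: "\<mu> \<in> P2 \<Longrightarrow> sets \<mu> = sets borel"
  by (simp_all add: P2_def)

lemma P2_integrable_bounded:
  fixes f :: "'a::euclidean_space \<Rightarrow> 'b::{banach, second_countable_topology}"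
  assumes "\<mu> \<in> P2" "f \<in> borel_measurable borel" "\<And>x. norm (f x) \<le> B"
  shows "integrable \<mu> f"
proof -
  interpret prob_space \<mu> by (rule P2_prob[OF assms(1)])
  show ?thesis
    using assms(2,3) P2_sets[OF assms(1)]
    by (intro integrable_const_bound[where B=B]) (auto cong: measurable_cong_sets)
qed

lemma P2_norm_integral_le:
  fixes f :: "'a::euclidean_space \<Rightarrow> 'b::{banach, second_countable_topology}"
  assumes "\<mu> \<in> P2" "f \<in> borel_measurable borel" "\<And>x. norm (f x) \<le> B"
  shows "norm (LINT x|\<mu>. f x) \<le> B"
proof -
  interpret prob_space \<mu> by (rule P2_prob[OF assms(1)])
  have "norm (LINT x|\<mu>. f x) \<le> (LINT x|\<mu>. norm (f x))"
    by (rule integral_norm_bound)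
  also have "\<dots> \<le> B"
    using assms by (intro integral_le_const integrable_norm P2_integrable_bounded) auto
  finally show ?thesis .
qed

lemma pair_measure_in_couplings:
  assumes "\<mu> \<in> P2" "\<nu> \<in> P2"
  shows "\<mu> \<Otimes>\<^sub>M \<nu> \<in> couplings \<mu> \<nu>"
proof -
  interpret \<mu>: prob_space \<mu> by (rule P2_prob[OF assms(1)])
  interpret \<nu>: prob_space \<nu> by (rule P2_prob[OF assms(2)])
  interpret pair_prob_space \<mu> \<nu> ..
  have s: "sets (\<mu> \<Otimes>\<^sub>M \<nu>) = sets (borel \<Otimes>\<^sub>M borel)"
    by (intro sets_pair_measure_cong P2_sets assms)
  have "distr (\<mu> \<Otimes>\<^sub>M \<nu>) borel fst = distr (\<mu> \<Otimes>\<^sub>M \<nu>) \<mu> fst"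
    by (intro distr_cong) (auto simp: P2_sets assms)
  also have "\<dots> = \<mu>"
    by (rule \<nu>.distr_pair_fst)
  finally have 1: "distr (\<mu> \<Otimes>\<^sub>M \<nu>) borel fst = \<mu>" .
  have "distr (\<mu> \<Otimes>\<^sub>M \<nu>) borel snd = distr (\<mu> \<Otimes>\<^sub>M \<nu>) \<nu> snd"
    by (intro distr_cong) (auto simp: P2_sets assms)
  also have "\<dots> = distr (distr (\<nu> \<Otimes>\<^sub>M \<mu>) (\<mu> \<Otimes>\<^sub>M \<nu>) (\<lambda>(x, y). (y, x))) \<nu> snd"
    by (subst distr_pair_swap) simp
  also have "\<dots> = distr (\<nu> \<Otimes>\<^sub>M \<mu>) \<nu> fst"
    by (subst distr_distr) (auto simp: comp_def case_prod_beta intro!: distr_cong)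
  also have "\<dots> = \<nu>"
    by (rule \<mu>.distr_pair_fst)
  finally show ?thesis
    using s 1 by (simp add: couplings_def)
qed

text \<open>In \<open>dW\<close> the cost passes through \<open>enn2real\<close>, which sends
  infinity to 0; finiteness must be known before a lower bound on the cost can become one on
  \<open>dW\<close>. The product coupling provides it, by (a + b)^2 \<le> 2 a^2 + 2 b^2.\<close>

lemma transport_cost_finite:
  fixes \<mu> \<nu> :: "'a::euclidean_space measure"
  assumes "\<mu> \<in> P2" "\<nu> \<in> P2"
  shows "(INF \<pi>\<in>couplings \<mu> \<nu>. \<integral>\<^sup>+ z. ennreal ((dist (fst z) (snd z))\<^sup>2) \<partial>\<pi>) < \<infinity>"
proof -
  interpret \<mu>: prob_space \<mu> by (rule P2_prob[OF assms(1)])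
  interpret \<nu>: prob_space \<nu> by (rule P2_prob[OF assms(2)])
  interpret pair_prob_space \<mu> \<nu> ..
  let ?p = "\<mu> \<Otimes>\<^sub>M \<nu>"
  have c: "?p \<in> couplings \<mu> \<nu>" by (rule pair_measure_in_couplings[OF assms])
  have [measurable_cong]: "sets \<mu> = sets borel" "sets \<nu> = sets borel"
    using assms by (auto simp: P2_sets)
  have d1: "distr ?p borel fst = \<mu>" and d2: "distr ?p borel snd = \<nu>"
    using c by (auto simp: couplings_def)
  have m: "fst \<in> ?p \<rightarrow>\<^sub>M borel" "snd \<in> ?p \<rightarrow>\<^sub>M borel"
    by measurable
  have i1: "integrable (distr ?p borel fst) (\<lambda>x. (norm x)\<^sup>2)"
    unfolding d1 using assms by (simp add: P2_def)
  have i2: "integrable (distr ?p borel snd) (\<lambda>x. (norm x)\<^sup>2)"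
    unfolding d2 using assms by (simp add: P2_def)
  note i = integrable_distr[OF m(1) i1] integrable_distr[OF m(2) i2]
  have "(\<integral>\<^sup>+ z. ennreal ((dist (fst z) (snd z))\<^sup>2) \<partial>?p)
      \<le> (\<integral>\<^sup>+ z. ennreal (2 * (norm (fst z))\<^sup>2 + 2 * (norm (snd z))\<^sup>2) \<partial>?p)"
  proof (intro nn_integral_mono ennreal_leI)
    fix z :: "'a \<times> 'a"
    have "dist (fst z) (snd z) \<le> norm (fst z) + norm (snd z)"
      by (simp add: dist_norm norm_triangle_ineq4)
    then have "(dist (fst z) (snd z))\<^sup>2 \<le> (norm (fst z) + norm (snd z))\<^sup>2"
      by (intro power_mono) auto
    also have "\<dots> \<le> 2 * (norm (fst z))\<^sup>2 + 2 * (norm (snd z))\<^sup>2"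
      using sum_squares_bound[of "norm (fst z)" "norm (snd z)"] by (simp add: power2_sum)
    finally show "(dist (fst z) (snd z))\<^sup>2 \<le> 2 * (norm (fst z))\<^sup>2 + 2 * (norm (snd z))\<^sup>2" .
  qed
  also have "\<dots> = ennreal (LINT z|?p. 2 * (norm (fst z))\<^sup>2 + 2 * (norm (snd z))\<^sup>2)"
    by (intro nn_integral_eq_integral Bochner_Integration.integrable_add integrable_mult_right i) auto
  also have "\<dots> < \<infinity>" by simp
  finally show ?thesis
    using c by (auto intro: le_less_trans[OF INF_lower])
qed

text \<open>Under a coupling the difference of integrals is the expectation of f(x) - f(y). Its
  square is at most the expectation of the square, since a variance is nonnegative.\<close>

lemma lipschitz_integral_diff_le_coupling:
  fixes f :: "'a::euclidean_space \<Rightarrow> real"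
  assumes \<pi>: "\<pi> \<in> couplings \<mu> \<nu>" and P2: "\<mu> \<in> P2" "\<nu> \<in> P2"
    and lip: "\<And>x y. \<bar>f x - f y\<bar> \<le> L * norm (x - y)" and bd: "\<And>x. \<bar>f x\<bar> \<le> B"
    and f: "f \<in> borel_measurable borel"
  shows "ennreal (((LINT x|\<mu>. f x) - (LINT x|\<nu>. f x))\<^sup>2)
    \<le> ennreal (L\<^sup>2) * (\<integral>\<^sup>+ z. ennreal ((dist (fst z) (snd z))\<^sup>2) \<partial>\<pi>)"
proof -
  have s [measurable_cong]: "sets \<pi> = sets (borel \<Otimes>\<^sub>M borel)"
    and d: "distr \<pi> borel fst = \<mu>" "distr \<pi> borel snd = \<nu>"
    using \<pi> by (auto simp: couplings_def)
  note [measurable] = f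
  have fst [measurable]: "fst \<in> \<pi> \<rightarrow>\<^sub>M borel" and snd [measurable]: "snd \<in> \<pi> \<rightarrow>\<^sub>M borel"
    by (simp_all cong: measurable_cong_sets add: measurable_fst measurable_snd s)
  interpret prob_space \<pi>
    by (rule prob_space_distrD[OF fst]) (simp add: d P2_prob P2)
  define g where "g z = f (fst z) - f (snd z)" for z
  have g [measurable]: "g \<in> borel_measurable \<pi>"
    unfolding g_def by measurable
  have gb: "\<bar>g z\<bar> \<le> 2 * B" for z
    unfolding g_def using bd[of "fst z"] bd[of "snd z"] by linarith
  have gi: "integrable \<pi> g"
    by (rule integrable_const_bound[where B="2 * B"]) (use gb in auto)
  have g2i: "integrable \<pi> (\<lambda>z. (g z)\<^sup>2)"
  proof (rule integrable_const_bound[where B="(2 * B)\<^sup>2"])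
    show "AE z in \<pi>. norm ((g z)\<^sup>2) \<le> (2 * B)\<^sup>2"
      using power_mono[OF gb abs_ge_zero, where n=2] by simp
  qed measurable
  have fi: "integrable \<pi> (\<lambda>z. f (fst z))" "integrable \<pi> (\<lambda>z. f (snd z))"
    by (rule integrable_const_bound[where B=B]; use bd in auto)+
  have "(LINT x|\<mu>. f x) - (LINT x|\<nu>. f x) = expectation g"
    unfolding d[symmetric] g_def by (simp add: integral_distr fi)
  moreover have "(expectation g)\<^sup>2 \<le> expectation (\<lambda>z. (g z)\<^sup>2)"
    using variance_eq[OF gi g2i] variance_positive[of g] by simp
  ultimately have "ennreal (((LINT x|\<mu>. f x) - (LINT x|\<nu>. f x))\<^sup>2) \<le> (\<integral>\<^sup>+z. ennreal ((g z)\<^sup>2) \<partial>\<pi>)"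
    by (simp add: nn_integral_eq_integral[OF g2i] ennreal_leI)
  also have "\<dots> \<le> (\<integral>\<^sup>+z. ennreal (L\<^sup>2) * ennreal ((dist (fst z) (snd z))\<^sup>2) \<partial>\<pi>)"
  proof (rule nn_integral_mono)
    fix z
    have "\<bar>g z\<bar>\<^sup>2 \<le> (L * dist (fst z) (snd z))\<^sup>2"
      unfolding g_def dist_norm by (rule power_mono[OF lip]) simp
    then show "ennreal ((g z)\<^sup>2) \<le> ennreal (L\<^sup>2) * ennreal ((dist (fst z) (snd z))\<^sup>2)"
      by (simp add: ennreal_mult[symmetric] power_mult_distrib ennreal_leI)
  qed
  also have "\<dots> = ennreal (L\<^sup>2) * (\<integral>\<^sup>+z. ennreal ((dist (fst z) (snd z))\<^sup>2) \<partial>\<pi>)"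
    by (rule nn_integral_cmult) measurable
  finally show ?thesis .
qed

text \<open>The easy half of Kantorovich-Rubinstein duality combined with W_1 \<le> W_2: the bound
  holds for each coupling, hence for the infimum.\<close>

lemma lipschitz_integral_diff_le_dW:
  fixes f :: "'a::euclidean_space \<Rightarrow> real"
  assumes P2: "\<mu> \<in> P2" "\<nu> \<in> P2" and "0 \<le> L"
    and lip: "\<And>x y. \<bar>f x - f y\<bar> \<le> L * norm (x - y)" and bd: "\<And>x. \<bar>f x\<bar> \<le> B"
    and f: "f \<in> borel_measurable borel"
  shows "\<bar>(LINT x|\<mu>. f x) - (LINT x|\<nu>. f x)\<bar> \<le> L * dW \<mu> \<nu>"
proof -
  define W where "W = (INF \<pi>\<in>couplings \<mu> \<nu>. \<integral>\<^sup>+ z. ennreal ((dist (fst z) (snd z))\<^sup>2) \<partial>\<pi>)"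
  define D where "D = \<bar>(LINT x|\<mu>. f x) - (LINT x|\<nu>. f x)\<bar>"
  show ?thesis
  \<comment> \<open>The main case divides by \<open>L\<close>; for \<open>L = 0\<close> the function
    is constant.\<close>
  proof (cases "L = 0")
    case True
    then have f0: "f = (\<lambda>x. f 0)"
      using lip[of _ 0] by (auto simp: fun_eq_iff)
    have "(LINT x|\<mu>'. f x) = f 0" if "\<mu>' \<in> P2" for \<mu>'
      by (subst f0) (simp add: prob_space.prob_space[OF P2_prob[OF that]])
    then have "(LINT x|\<mu>. f x) = f 0" "(LINT x|\<nu>. f x) = f 0"
      using P2 by blast+
    then show ?thesis using True by simp
  next
    case False
    with \<open>0 \<le> L\<close> have L: "0 < L" by simp
    have "ennreal ((D / L)\<^sup>2) \<le> W"
      unfolding W_def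
    proof (rule INF_greatest)
      fix \<pi> assume \<pi>: "\<pi> \<in> couplings \<mu> \<nu>"
      let ?c = "\<integral>\<^sup>+ z. ennreal ((dist (fst z) (snd z))\<^sup>2) \<partial>\<pi>"
      have "ennreal (D\<^sup>2) \<le> ennreal (L\<^sup>2) * ?c"
        using lipschitz_integral_diff_le_coupling[OF \<pi> P2 lip bd f] by (simp add: D_def)
      then have "ennreal (inverse (L\<^sup>2)) * ennreal (D\<^sup>2) \<le> ennreal (inverse (L\<^sup>2)) * (ennreal (L\<^sup>2) * ?c)"
        by (rule mult_left_mono) simp
      also have "\<dots> = ?c"
        using L by (simp add: mult.assoc[symmetric] ennreal_mult[symmetric])
      finally show "ennreal ((D / L)\<^sup>2) \<le> ?c"
        using L by (simp add: ennreal_mult[symmetric] power_mult_distrib power_inverse divide_inverse mult.commute)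
    qed
    moreover have "W < \<infinity>"
      unfolding W_def by (rule transport_cost_finite[OF P2])
    ultimately have "(D / L)\<^sup>2 \<le> enn2real W"
      by (metis enn2real_ennreal enn2real_mono infinity_ennreal_def zero_le_power2)
    then have "D / L \<le> sqrt (enn2real W)"
      by (rule real_le_rsqrt)
    then show ?thesis
      using L by (simp add: dW_def W_def D_def divide_simps mult.commute)
  qed
qed

text \<open>The primitive of the integrable bound is uniformly continuous on the compact interval.
  Only ordered pairs occur, as in \<open>AC_curve\<close>; later uses exchange the roles of the two
  measures where symmetry of \<open>dW\<close> might be expected.\<close>

lemma AC_curve_modulus:
  assumes "AC_curve T \<rho>" "0 < e"
  shows "\<exists>d>0. \<forall>s\<in>{0..T}. \<forall>t\<in>{0..T}. s \<le> t \<and> t - s \<le> d \<longrightarrow> dW (\<rho> s) (\<rho> t) \<le> e"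
proof -
  obtain m where m: "set_integrable lborel {0..T} m"
    and le: "\<And>s t. 0 \<le> s \<Longrightarrow> s \<le> t \<Longrightarrow> t \<le> T \<Longrightarrow> dW (\<rho> s) (\<rho> t) \<le> (LINT r:{s..t}|lborel. m r)"
    using assms(1) by (auto simp: AC_curve_def)
  define J where "J t = integral {0..t} m" for t
  have mi: "m integrable_on {a..b}" if "{a..b} \<subseteq> {0..T}" for a b
    using set_borel_integral_eq_integral(1)[OF set_integrable_subset[OF m _ that]] by simp
  have "uniformly_continuous_on {0..T} J"
    unfolding J_def by (intro compact_uniformly_continuous indefinite_integral_continuous_1 mi) auto
  then obtain d where d: "0 < d"
    "\<And>s t. s \<in> {0..T} \<Longrightarrow> t \<in> {0..T} \<Longrightarrow> dist t s < d \<Longrightarrow> dist (J t) (J s) < e"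
    using assms(2) unfolding uniformly_continuous_on_def by metis
  have "dW (\<rho> s) (\<rho> t) \<le> e" if st: "s \<in> {0..T}" "t \<in> {0..T}" "s \<le> t" "t - s \<le> d / 2" for s t
  proof -
    have sub: "{s..t} \<subseteq> {0..T}" "{0..t} \<subseteq> {0..T}" using st by auto
    have "J s + integral {s..t} m = J t"
      unfolding J_def
      by (rule Henstock_Kurzweil_Integration.integral_combine) (use st sub in \<open>auto intro: mi\<close>)
    then have "(LINT r:{s..t}|lborel. m r) = J t - J s"
      using set_borel_integral_eq_integral(2)[OF set_integrable_subset[OF m _ sub(1)]] by simp
    then have "dW (\<rho> s) (\<rho> t) \<le> J t - J s"
      using le[of s t] st by simp
    also have "\<dots> \<le> e"
      using d(2)[of s t] d(1) st by (auto simp: dist_real_def abs_if split: if_splits)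
    finally show ?thesis .
  qed
  then show ?thesis using d(1) by (intro exI[of _ "d / 2"]) auto
qed

lemma AC_curve_P2: "AC_curve T \<rho> \<Longrightarrow> t \<in> {0..T} \<Longrightarrow> \<rho> t \<in> P2"
  by (simp add: AC_curve_def)

lemma AC_curve_integral_continuous:
  fixes f :: "'a::euclidean_space \<Rightarrow> real"
  assumes ac: "AC_curve T \<rho>"
    and lip: "\<And>x y. \<bar>f x - f y\<bar> \<le> L * norm (x - y)" and bd: "\<And>x. \<bar>f x\<bar> \<le> B"
    and f: "f \<in> borel_measurable borel"
  shows "continuous_on {0..T} (\<lambda>t. LINT x|\<rho> t. f x)"
proof (rule continuous_onI)
  fix t e :: real assume t: "t \<in> {0..T}" and e: "0 < e"
  \<comment> \<open>The summand 1 makes the constant positive, so that it may be divided by.\<close>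
  define L' where "L' = \<bar>L\<bar> + 1"
  have L': "0 < L'" by (simp add: L'_def)
  have lip': "\<bar>f x - f y\<bar> \<le> L' * norm (x - y)" for x y
    by (rule order.trans[OF lip mult_right_mono]) (auto simp: L'_def)
  obtain d where d: "0 < d" "\<And>s t. s \<in> {0..T} \<Longrightarrow> t \<in> {0..T} \<Longrightarrow> s \<le> t \<Longrightarrow> t - s \<le> d \<Longrightarrow>
      dW (\<rho> s) (\<rho> t) \<le> e / L'"
    using AC_curve_modulus[OF ac, of "e / L'"] e L' by (metis divide_pos_pos)
  have *: "\<bar>(LINT x|\<rho> s. f x) - (LINT x|\<rho> t. f x)\<bar> \<le> e"
    if "s \<in> {0..T}" "t \<in> {0..T}" "s \<le> t" "t - s \<le> d" for s t
  proof -
    have "\<bar>(LINT x|\<rho> s. f x) - (LINT x|\<rho> t. f x)\<bar> \<le> L' * dW (\<rho> s) (\<rho> t)"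
      using L' that by (intro lipschitz_integral_diff_le_dW[where B=B] AC_curve_P2[OF ac] lip' bd f) auto
    also have "\<dots> \<le> L' * (e / L')"
      using L' d(2) that by (intro mult_left_mono) auto
    finally show ?thesis using L' by simp
  qed
  have "dist (LINT x|\<rho> s. f x) (LINT x|\<rho> t. f x) \<le> e" if "s \<in> {0..T}" "dist s t < d" for s
    using *[of s t] *[of t s] t that by (cases "s \<le> t") (auto simp: dist_real_def abs_minus_commute)
  then show "\<exists>d>0. \<forall>s\<in>{0..T}. dist s t < d \<longrightarrow> dist (LINT x|\<rho> s. f x) (LINT x|\<rho> t. f x) \<le> e"
    using d(1) by blast
qed

section \<open>Mollification\<close>

lemma grad_eqI:
  assumes "(f has_derivative (\<lambda>h. g \<bullet> h)) (at x)"
  shows "grad f x = g"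
proof -
  have "frechet_derivative f (at x) = (\<lambda>h. g \<bullet> h)"
    using frechet_derivative_at[OF assms] by simp
  then show ?thesis
    by (simp add: grad_def euclidean_representation)
qed

lemma has_derivative_grad:
  assumes "f differentiable (at x)"
  shows "(f has_derivative (\<lambda>h. grad f x \<bullet> h)) (at x)"
proof -
  let ?D = "frechet_derivative f (at x)"
  have D: "(f has_derivative ?D) (at x)"
    using assms by (simp add: frechet_derivative_works)
  then interpret linear ?D
    by (rule has_derivative_linear)
  have "?D h = grad f x \<bullet> h" for h
  proof -
    have "?D h = ?D (\<Sum>b\<in>Basis. (h \<bullet> b) *\<^sub>R b)"
      by (simp add: euclidean_representation)
    also have "\<dots> = (\<Sum>b\<in>Basis. (h \<bullet> b) * ?D b)"
      by (simp add: sum scale)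
    also have "\<dots> = grad f x \<bullet> h"
      by (simp add: grad_def inner_sum_left inner_commute[of h] mult.commute)
    finally show ?thesis .
  qed
  then have "?D = (\<lambda>h. grad f x \<bullet> h)" by blast
  with D show ?thesis by simp
qed

lemma grad_bounded_imp_lipschitz:
  fixes f :: "'a::euclidean_space \<Rightarrow> real"
  assumes diff: "\<And>x. f differentiable (at x)" and bd: "\<And>x. norm (grad f x) \<le> L"
  shows "\<bar>f x - f y\<bar> \<le> L * norm (x - y)"
proof -
  have "norm (f x - f y) \<le> L * norm (x - y)"
  proof (rule differentiable_bound[of UNIV])
    show "(f has_derivative (\<lambda>h. grad f z \<bullet> h)) (at z within UNIV)" for z
      using has_derivative_grad[OF diff] by simp
    show "onorm (\<lambda>h. grad f z \<bullet> h) \<le> L" for z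
    proof (rule onorm_bound)
      show "0 \<le> L" using bd[of z] norm_ge_zero order.trans by blast
      show "norm (grad f z \<bullet> h) \<le> L * norm h" for h
        using Cauchy_Schwarz_ineq2[of "grad f z" h] mult_right_mono[OF bd[of z] norm_ge_zero[of h]] by simp
    qed
  qed auto
  then show ?thesis by simp
qed

text \<open>Differentiating in the direction of the gradient itself gives |grad f|^2 \<le> L |grad
  f|.\<close>

lemma lipschitz_imp_grad_bounded:
  fixes f :: "'a::euclidean_space \<Rightarrow> real"
  assumes diff: "f differentiable (at x)" and lip: "\<And>x y. \<bar>f x - f y\<bar> \<le> L * norm (x - y)"
  shows "norm (grad f x) \<le> L"
proof -
  let ?g = "grad f x"
  have "((\<lambda>t. x + t *\<^sub>R ?g) has_derivative (\<lambda>t. t *\<^sub>R ?g)) (at 0)"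
    by (auto intro!: derivative_eq_intros)
  moreover have "(f has_derivative (\<lambda>h. ?g \<bullet> h)) (at (x + 0 *\<^sub>R ?g))"
    using has_derivative_grad[OF diff] by simp
  ultimately have "((\<lambda>t. f (x + t *\<^sub>R ?g)) has_derivative (\<lambda>t. ?g \<bullet> (t *\<^sub>R ?g))) (at 0)"
    by (rule has_derivative_compose)
  then have "((\<lambda>t. f (x + t *\<^sub>R ?g)) has_real_derivative ?g \<bullet> ?g) (at 0)"
    by (simp add: has_field_derivative_def mult.commute[of _ "?g \<bullet> ?g"])
  then have lim: "((\<lambda>t. (f (x + t *\<^sub>R ?g) - f x) / t) \<longlongrightarrow> ?g \<bullet> ?g) (at 0)"
    by (simp add: DERIV_def)
  have "?g \<bullet> ?g \<le> L * norm ?g"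
  proof (rule tendsto_upperbound[OF lim])
    have "(f (x + t *\<^sub>R ?g) - f x) / t \<le> L * norm ?g" for t
    proof (cases "t = 0")
      case True
      then show ?thesis using lip[of "x + ?g" x] by simp
    next
      case False
      have "\<bar>(f (x + t *\<^sub>R ?g) - f x) / t\<bar> \<le> (L * norm (t *\<^sub>R ?g)) / \<bar>t\<bar>"
        using divide_right_mono[OF lip[of "x + t *\<^sub>R ?g" x] abs_ge_zero[of t]] by (simp only: abs_divide add_diff_cancel_left')
      also have "\<dots> = L * norm ?g" using False by simp
      finally show ?thesis by linarith
    qed
    then show "\<forall>\<^sub>F t in at 0. (f (x + t *\<^sub>R ?g) - f x) / t \<le> L * norm ?g" by simp
  qed simp
  then have "norm ?g * norm ?g \<le> L * norm ?g"
    by (simp add: dot_square_norm power2_eq_square)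
  moreover have "0 \<le> L"
  proof -
    obtain b :: 'a where b: "b \<in> Basis" using nonempty_Basis by blast
    show ?thesis using lip[of b 0] b by simp
  qed
  ultimately show ?thesis
    by (cases "norm ?g = 0") auto
qed

lemma grad_eq_0_outside:
  fixes f :: "'a::euclidean_space \<Rightarrow> real"
  assumes f: "\<And>y. S < norm y \<longrightarrow> f y = 0" and x: "S < norm x"
  shows "grad f x = 0"
proof -
  have "open {y::'a. S < norm y}"
    by (intro open_Collect_less continuous_intros)
  moreover have "0 = f y" if "y \<in> {y. S < norm y}" for y
    using f that by simp
  ultimately have "(f has_derivative (\<lambda>h. 0)) (at x)"
    using x by (intro has_derivative_transform_within_open[OF has_derivative_const[of 0]]) blast+
  then show ?thesis by (intro grad_eqI) simp
qed

lemma integrable_continuous_supported: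
  fixes f :: "'a::euclidean_space \<Rightarrow> 'b::{banach, second_countable_topology}"
  assumes cont: "continuous_on UNIV f" and supp: "\<And>x. S < norm x \<longrightarrow> f x = 0"
  shows "integrable lborel f"
proof -
  have "integrable lborel (\<lambda>y. indicator (cball 0 S) y *\<^sub>R f y)"
    by (intro borel_integrable_compact continuous_on_subset[OF cont]) auto
  also have "(\<lambda>y. indicator (cball 0 S) y *\<^sub>R f y) = f"
  proof
    show "indicator (cball 0 S) y *\<^sub>R f y = f y" for y
      using supp[of y] by (cases "S < norm y") auto
  qed
  finally show ?thesis .
qed

lemma lborel_integral_affine:
  fixes f :: "'a::euclidean_space \<Rightarrow> 'b::{banach, second_countable_topology}"
  assumes c: "c \<noteq> 0" and f [measurable]: "f \<in> borel_measurable borel"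
  shows "(LINT x|lborel. f x) = \<bar>c\<bar> ^ DIM('a) *\<^sub>R (LINT x|lborel. f (t + c *\<^sub>R x))"
    and "integrable lborel f \<longleftrightarrow> integrable lborel (\<lambda>x. f (t + c *\<^sub>R x))"
proof -
  have l: "lborel = density (distr lborel borel (\<lambda>x::'a. t + c *\<^sub>R x)) (\<lambda>_. ennreal (\<bar>c\<bar> ^ DIM('a)))"
    by (rule lborel_affine[OF c])
  show "(LINT x|lborel. f x) = \<bar>c\<bar> ^ DIM('a) *\<^sub>R (LINT x|lborel. f (t + c *\<^sub>R x))"
    by (subst l, subst integral_density) (auto simp: integral_distr)
  let ?g = "\<lambda>x. f (t + c *\<^sub>R x)" and ?d = "\<bar>c\<bar> ^ DIM('a)"
  have "integrable lborel f \<longleftrightarrow> integrable lborel (\<lambda>x. ?d *\<^sub>R ?g x)"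
    by (subst l, subst integrable_density) (auto simp: integrable_distr_eq)
  also have "\<dots> \<longleftrightarrow> integrable lborel ?g"
  proof
    assume "integrable lborel (\<lambda>x. ?d *\<^sub>R ?g x)"
    then have "integrable lborel (\<lambda>x. inverse ?d *\<^sub>R ?d *\<^sub>R ?g x)"
      by (rule integrable_scaleR_right)
    then show "integrable lborel ?g" using c by simp
  qed simp
  finally show "integrable lborel f \<longleftrightarrow> integrable lborel ?g" .
qed

lemma lborel_integral_reflect:
  fixes f :: "'a::euclidean_space \<Rightarrow> 'b::{banach, second_countable_topology}"
  assumes "f \<in> borel_measurable borel"
  shows "(LINT y|lborel. f (x - y)) = (LINT y|lborel. f y)"
  using lborel_integral_affine(1)[OF _ assms, of "-1" x] by simp

text \<open>\<open>G\<close> is the gradient of \<eta>. A kernel with Lipschitz gradient suffices,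
  as the test functions need only be C1; the two inequalities with the constant \<open>C\<close> are
  the quantitative form in which this regularity is used.\<close>

locale mollifier =
  fixes \<eta> :: "'a::euclidean_space \<Rightarrow> real" and G :: "'a \<Rightarrow> 'a" and C \<delta> :: real
  assumes nonneg: "\<And>z. 0 \<le> \<eta> z" and supp: "\<And>z. \<delta> < norm z \<Longrightarrow> \<eta> z = 0"
    and int: "integrable lborel \<eta>" and int_1: "(LINT z|lborel. \<eta> z) = 1"
    and taylor: "\<And>x y. \<bar>\<eta> y - \<eta> x - G x \<bullet> (y - x)\<bar> \<le> C * (norm (y - x))\<^sup>2"
    and G_lipschitz: "\<And>x y. norm (G x - G y) \<le> C * norm (x - y)"
begin

definition smooth :: "('a \<Rightarrow> real) \<Rightarrow> 'a \<Rightarrow> real" where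
  "smooth f x = (LINT z|lborel. \<eta> z * f (x - z))"

text \<open>Here the shift sits on the kernel, so that the derivative falls on \<eta> and none is
  taken of f.\<close>

definition smooth_grad :: "('a \<Rightarrow> real) \<Rightarrow> 'a \<Rightarrow> 'a" where
  "smooth_grad f x = (LINT y|lborel. f y *\<^sub>R G (x - y))"

lemma C_nonneg: "0 \<le> C"
proof -
  obtain b :: 'a where b: "b \<in> Basis" using nonempty_Basis by blast
  have "norm (G b - G 0) \<le> C" using G_lipschitz[of b 0] b by simp
  then show ?thesis using norm_ge_zero order.trans by blast
qed

lemma G_continuous: "continuous_on UNIV G"
  using C_nonneg by (intro lipschitz_on_continuous_on[where L=C] lipschitz_onI)
    (auto simp: dist_norm G_lipschitz)

lemma \<eta>_continuous: "continuous_on UNIV \<eta>"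
proof -
  have "(\<eta> has_derivative (\<lambda>h. G x \<bullet> h)) (at x)" for x
    by (intro has_derivative_quadratic_remainder[where C=C] bounded_linear_inner_right taylor)
  then show ?thesis
    by (intro continuous_at_imp_continuous_on ballI has_derivative_continuous)
qed

lemma weight_integrable:
  assumes f: "f \<in> borel_measurable borel" and bd: "\<And>x. \<bar>f x\<bar> \<le> B"
  shows "integrable lborel (\<lambda>z. \<eta> z * f (x - z))"
proof (rule Bochner_Integration.integrable_bound)
  show "integrable lborel (\<lambda>z. \<eta> z * B)" by (intro integrable_mult_left int)
  note [measurable] = f borel_measurable_continuous_onI[OF \<eta>_continuous]
  show "(\<lambda>z. \<eta> z * f (x - z)) \<in> borel_measurable lborel" by measurable
  show "AE z in lborel. norm (\<eta> z * f (x - z)) \<le> norm (\<eta> z * B)"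
  proof (rule AE_I2)
    fix z
    have "\<bar>f (x - z)\<bar> \<le> \<bar>B\<bar>" using bd[of "x - z"] by linarith
    then show "norm (\<eta> z * f (x - z)) \<le> norm (\<eta> z * B)"
      by (simp add: abs_mult mult_left_mono)
  qed
qed

text \<open>\<eta> is a probability density on the ball of radius \<delta>, so only the values of g
  there count.\<close>

lemma average_le:
  assumes g: "integrable lborel (\<lambda>z. \<eta> z * g z)" and bd: "\<And>z. norm z \<le> \<delta> \<Longrightarrow> \<bar>g z\<bar> \<le> B"
  shows "\<bar>LINT z|lborel. \<eta> z * g z\<bar> \<le> B"
proof -
  have le: "norm (\<eta> z * g z) \<le> \<eta> z * B" for z
  proof (cases "norm z \<le> \<delta>")
    case True
    then show ?thesis using bd[of z] nonneg[of z] by (simp add: abs_mult mult_left_mono)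
  next
    case False
    then show ?thesis using supp[of z] by simp
  qed
  have "norm (LINT z|lborel. \<eta> z * g z) \<le> (LINT z|lborel. norm (\<eta> z * g z))"
    by (rule integral_norm_bound)
  also have "\<dots> \<le> (LINT z|lborel. \<eta> z * B)"
    by (intro integral_mono integrable_norm g integrable_mult_left int le)
  finally show ?thesis by (simp add: int_1)
qed

text \<open>Two functions and two base points are allowed at once, because three estimates follow
  from it: the Lipschitz bound (same function), the distance to f itself (a constant as the second
  function), and the commutator with an Euler step.\<close>

lemma smooth_diff_le:
  assumes f: "f \<in> borel_measurable borel" "\<And>x. \<bar>f x\<bar> \<le> B"
    and g: "g \<in> borel_measurable borel" "\<And>x. \<bar>g x\<bar> \<le> B'"
    and le: "\<And>z. norm z \<le> \<delta> \<Longrightarrow> \<bar>f (x - z) - g (y - z)\<bar> \<le> D"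
  shows "\<bar>smooth f x - smooth g y\<bar> \<le> D"
proof -
  note i = weight_integrable[OF f, of x] weight_integrable[OF g, of y]
  have "smooth f x - smooth g y = (LINT z|lborel. \<eta> z * (f (x - z) - g (y - z)))"
    unfolding smooth_def by (simp add: Bochner_Integration.integral_diff[OF i, symmetric] right_diff_distrib)
  moreover have "integrable lborel (\<lambda>z. \<eta> z * (f (x - z) - g (y - z)))"
    using Bochner_Integration.integrable_diff[OF i] by (simp add: right_diff_distrib)
  ultimately show ?thesis
    using average_le[of "\<lambda>z. f (x - z) - g (y - z)"] le by simp
qed

lemma smooth_minus_self:
  assumes f: "f \<in> borel_measurable borel" "\<And>x. \<bar>f x\<bar> \<le> B"
    and le: "\<And>z. norm z \<le> \<delta> \<Longrightarrow> \<bar>f (x - z) - f x\<bar> \<le> D"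
  shows "\<bar>smooth f x - f x\<bar> \<le> D"
proof -
  have "smooth (\<lambda>_. f x) x = f x"
    by (simp add: smooth_def int_1)
  then show ?thesis
    using smooth_diff_le[of f B "\<lambda>_. f x" "\<bar>f x\<bar>" x x D] assms by simp
qed

lemma smooth_abs_le:
  assumes f: "f \<in> borel_measurable borel" "\<And>x. \<bar>f x\<bar> \<le> B"
  shows "\<bar>smooth f x\<bar> \<le> B"
  using average_le[OF weight_integrable[OF f]] f(2) by (simp add: smooth_def)

lemma smooth_support:
  assumes "\<And>x. S < norm x \<longrightarrow> f x = 0" "S + \<delta> < norm x"
  shows "smooth f x = 0"
proof -
  have "\<eta> z * f (x - z) = 0" for z
  proof (cases "norm z \<le> \<delta>")
    case True
    then have "S < norm (x - z)"
      using assms(2) norm_triangle_ineq2[of x z] by linarith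
    then show ?thesis using assms(1)[of "x - z"] by simp
  qed (use supp in auto)
  then show ?thesis by (simp only: smooth_def integral_zero)
qed

lemma smooth_lipschitz:
  assumes f: "f \<in> borel_measurable borel" "\<And>x. \<bar>f x\<bar> \<le> B"
    and lip: "\<And>x y. \<bar>f x - f y\<bar> \<le> L * norm (x - y)"
  shows "\<bar>smooth f x - smooth f y\<bar> \<le> L * norm (x - y)"
proof (rule smooth_diff_le[OF f f])
  show "\<bar>f (x - z) - f (y - z)\<bar> \<le> L * norm (x - y)" for z
    using lip[of "x - z" "y - z"] by simp
qed

text \<open>A crude second-derivative bound for a mollified function of size \<open>B\<close>
  supported in \<open>A\<close>. Through \<open>C\<close> it depends on the scale \<delta>, but it
  does not involve any Lipschitz constant of the function.\<close>

definition hessian_bound :: "real \<Rightarrow> 'a set \<Rightarrow> real" where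
  "hessian_bound B A = B * C * measure lborel A"

lemma supported_integrable:
  fixes g :: "'a \<Rightarrow> 'b::euclidean_space"
  assumes "continuous_on UNIV f" "\<And>x. S < norm x \<longrightarrow> f x = 0" "continuous_on UNIV g"
  shows "integrable lborel (\<lambda>y. f y *\<^sub>R g y)"
  using assms by (intro integrable_continuous_supported[where S=S] continuous_intros) auto

lemma supported_integral_le:
  fixes g :: "'a \<Rightarrow> 'b::euclidean_space"
  assumes "continuous_on UNIV f" "\<And>x. S < norm x \<longrightarrow> f x = 0" "continuous_on UNIV g"
    and fB: "\<And>x. \<bar>f x\<bar> \<le> B" and gD: "\<And>x. norm (g x) \<le> C * D"
  shows "norm (LINT y|lborel. f y *\<^sub>R g y) \<le> hessian_bound B (cball 0 S) * D"
proof -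
  have "norm (LINT y|lborel. f y *\<^sub>R g y) \<le> (LINT y|lborel. norm (f y *\<^sub>R g y))"
    by (rule integral_norm_bound)
  also have "\<dots> \<le> (LINT y|lborel. indicator (cball 0 S) (y::'a) * (B * (C * D)))"
  proof (rule integral_mono)
    show "integrable lborel (\<lambda>y. norm (f y *\<^sub>R g y))"
      by (intro integrable_norm supported_integrable[where S=S] assms)
    show "integrable lborel (\<lambda>y::'a. indicator (cball 0 S) y * (B * (C * D)))"
      by (intro integrable_mult_left integrable_real_indicator) (auto simp: emeasure_lborel_cball_finite[unfolded infinity_ennreal_def])
    have "norm (f y *\<^sub>R g y) \<le> B * (C * D)" for y
      unfolding norm_scaleR using fB[of y] gD[of y] order.trans[OF abs_ge_zero fB[of y]]
      by (intro mult_mono) auto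
    then show "norm (f y *\<^sub>R g y) \<le> indicator (cball 0 S) y * (B * (C * D))" for y
      using assms(2)[of y] by (auto simp: indicator_def not_le)
  qed
  also have "\<dots> = hessian_bound B (cball 0 S) * D"
    by (simp add: hessian_bound_def mult_ac)
  finally show ?thesis .
qed

context
  fixes f :: "'a \<Rightarrow> real" and B S :: real
  assumes f_cont: "continuous_on UNIV f" and f_bd: "\<And>x. \<bar>f x\<bar> \<le> B"
    and f_supp: "\<And>x. S < norm x \<longrightarrow> f x = 0"
begin

lemma smooth_eq: "smooth f x = (LINT y|lborel. f y * \<eta> (x - y))"
proof -
  note [measurable] = borel_measurable_continuous_onI[OF f_cont] borel_measurable_continuous_onI[OF \<eta>_continuous]
  have "(\<lambda>y. f y * \<eta> (x - y)) \<in> borel_measurable borel" by measurable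
  from lborel_integral_reflect[OF this, of x] show ?thesis
    by (simp add: smooth_def mult.commute)
qed

text \<open>Mollification is linear in the kernel, so the Taylor inequality of \<eta> at x - z can
  be integrated against f(z).\<close>

lemma smooth_taylor:
  "\<bar>smooth f y - smooth f x - smooth_grad f x \<bullet> (y - x)\<bar> \<le> hessian_bound B (cball 0 S) * (norm (y - x))\<^sup>2"
proof -
  have c: "continuous_on UNIV (\<lambda>z. \<eta> (x - z))" for x
    by (intro continuous_on_compose2[OF \<eta>_continuous] continuous_intros) auto
  have cG: "continuous_on UNIV (\<lambda>z. G (x - z))"
    by (intro continuous_on_compose2[OF G_continuous] continuous_intros) auto
  have i: "integrable lborel (\<lambda>z. f z *\<^sub>R \<eta> (x - z))" for x
    by (rule supported_integrable[OF f_cont f_supp c])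
  have iG: "integrable lborel (\<lambda>z. f z *\<^sub>R G (x - z))"
    by (rule supported_integrable[OF f_cont f_supp cG])
  have "smooth_grad f x \<bullet> (y - x) = (LINT z|lborel. f z *\<^sub>R G (x - z) \<bullet> (y - x))"
    unfolding smooth_grad_def by (rule integral_inner_left[symmetric]) (use iG in auto)
  then have "smooth f y - smooth f x - smooth_grad f x \<bullet> (y - x)
      = (LINT z|lborel. f z *\<^sub>R (\<eta> (y - z) - \<eta> (x - z) - G (x - z) \<bullet> (y - x)))"
    using i[of x] i[of y] integrable_inner_left[OF iG, of "y - x"]
    by (simp add: smooth_eq right_diff_distrib)
  also have "norm \<dots> \<le> hessian_bound B (cball 0 S) * (norm (y - x))\<^sup>2"
  proof (rule supported_integral_le[OF f_cont f_supp _ f_bd])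
    show "continuous_on UNIV (\<lambda>z. \<eta> (y - z) - \<eta> (x - z) - G (x - z) \<bullet> (y - x))"
      by (intro continuous_intros c cG)
    show "norm (\<eta> (y - z) - \<eta> (x - z) - G (x - z) \<bullet> (y - x)) \<le> C * (norm (y - x))\<^sup>2" for z
      using taylor[of "y - z" "x - z"] by simp
  qed
  finally show ?thesis by simp
qed

lemma smooth_has_derivative: "(smooth f has_derivative (\<lambda>h. smooth_grad f x \<bullet> h)) (at x)"
  by (intro has_derivative_quadratic_remainder[OF _ smooth_taylor] bounded_linear_inner_right)

lemma grad_smooth: "grad (smooth f) x = smooth_grad f x"
  by (rule grad_eqI[OF smooth_has_derivative])

lemma smooth_grad_lipschitz: "norm (smooth_grad f x - smooth_grad f y) \<le> hessian_bound B (cball 0 S) * norm (x - y)"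
proof -
  have c: "continuous_on UNIV (\<lambda>z. G (x - z))" for x
    by (intro continuous_on_compose2[OF G_continuous] continuous_intros) auto
  have "smooth_grad f x - smooth_grad f y = (LINT z|lborel. f z *\<^sub>R (G (x - z) - G (y - z)))"
    unfolding smooth_grad_def
    by (subst Bochner_Integration.integral_diff[symmetric])
       (auto intro!: supported_integrable[OF f_cont f_supp c] simp: scaleR_diff_right)
  also have "norm \<dots> \<le> hessian_bound B (cball 0 S) * norm (x - y)"
  proof (rule supported_integral_le[OF f_cont f_supp _ f_bd])
    show "norm (G (x - z) - G (y - z)) \<le> C * norm (x - y)" for z
      using G_lipschitz[of "x - z" "y - z"] by simp
  qed (auto intro!: continuous_intros c)
  finally show ?thesis .
qed

lemma smooth_C1: "C1_fun (smooth f)"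
proof -
  have "0 \<le> hessian_bound B (cball 0 S)"
    using C_nonneg order.trans[OF abs_ge_zero f_bd] by (simp add: hessian_bound_def)
  then have "continuous_on UNIV (smooth_grad f)"
    by (intro lipschitz_on_continuous_on[OF lipschitz_onI[of _ _ "hessian_bound B (cball 0 S)"]])
      (auto simp: dist_norm smooth_grad_lipschitz)
  moreover have "grad (smooth f) = smooth_grad f"
    using grad_smooth by auto
  ultimately show ?thesis
    using smooth_has_derivative by (auto simp: C1_fun_def differentiable_def)
qed

lemma smooth_compactly_supported: "compactly_supported (smooth f)"
proof -
  have "{x. smooth f x \<noteq> 0} \<subseteq> cball 0 (S + \<delta>)"
    using smooth_support[of S f] f_supp by (auto simp: not_less[symmetric])
  then have "bounded {x. smooth f x \<noteq> 0}"
    by (rule bounded_subset[OF bounded_cball])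
  then show ?thesis
    by (simp add: compactly_supported_def compact_eq_bounded_closed bounded_closure)
qed

lemma smooth_grad_support:
  assumes "S + \<delta> < norm x"
  shows "smooth_grad f x = 0"
  unfolding grad_smooth[symmetric]
  by (rule grad_eq_0_outside[OF _ assms]) (use smooth_support[OF f_supp] in blast)

text \<open>In contrast to the Hessian bound this one is independent of \<delta>: mollification
  preserves the Lipschitz constant of f, and the gradient is bounded by it.\<close>

lemma smooth_grad_le:
  assumes lip: "\<And>x y. \<bar>f x - f y\<bar> \<le> L * norm (x - y)"
  shows "norm (smooth_grad f x) \<le> L"
  unfolding grad_smooth[symmetric]
proof (rule lipschitz_imp_grad_bounded)
  show "smooth f differentiable (at x)"
    using smooth_has_derivative by (auto simp: differentiable_def)
  show "\<bar>smooth f x - smooth f y\<bar> \<le> L * norm (x - y)" for x y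
    by (rule smooth_lipschitz[OF borel_measurable_continuous_onI[OF f_cont] f_bd lip])
qed

end

end

text \<open>The bump is the normalised square of the positive part of a - \<open>jap z\<close>:
  squaring a positive part makes it differentiable with Lipschitz gradient, and \<open>jap\<close>
  has both properties already.\<close>

lemma mollifier_exists:
  assumes "0 < \<delta>"
  shows "\<exists>(\<eta> :: 'a::euclidean_space \<Rightarrow> real) G C. mollifier \<eta> G C \<delta>"
proof -
  \<comment> \<open>With this value a - \<open>jap z\<close> changes sign exactly on the sphere of
    radius \<delta>.\<close>
  define a where "a = sqrt (1 + \<delta>\<^sup>2)"
  define s where "s z = max 0 (a - jap z)" for z :: 'a
  define q where "q z = (s z)\<^sup>2" for z
  define G where "G z = (- 2 * s z) *\<^sub>R (z /\<^sub>R jap z)" for z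
  \<comment> \<open>The Lipschitz bound of \<open>G\<close> produces 4 a + 2; the Taylor remainder
    is already covered by 1 + a.\<close>
  define C where "C = 2 + 4 * a"
  have a1: "1 < a" using assms by (simp add: a_def)
  have s_nonneg: "0 \<le> s z" and s_le: "s z \<le> a" for z
    using jap_pos[of z] a1 by (auto simp: s_def)
  have s_lip: "\<bar>s x - s y\<bar> \<le> norm (x - y)" for x y
    using jap_lipschitz[of x y] unfolding s_def by linarith
  have s_cont: "continuous_on UNIV s"
    unfolding s_def by (intro continuous_intros)
  have supp: "q z = 0" if "\<delta> < norm z" for z
  proof -
    have "a \<le> jap z"
      unfolding a_def jap_def using that assms by (intro real_sqrt_le_mono add_left_mono power_mono) auto
    then show ?thesis by (simp add: q_def s_def)
  qed
  have taylor: "\<bar>q y - q x - G x \<bullet> (y - x)\<bar> \<le> C * (norm (y - x))\<^sup>2" for x y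
  proof -
    let ?r = "jap y - jap x - (x /\<^sub>R jap x) \<bullet> (y - x)"
    have "\<bar>q y - q x - 2 * s x * (jap x - jap y)\<bar> \<le> (jap x - jap y)\<^sup>2"
    proof -
      \<comment> \<open>The squared positive part has a quadratic Taylor remainder with constant 1;
        the four sign patterns are checked separately.\<close>
      have *: "\<bar>(max 0 v)\<^sup>2 - (max 0 u)\<^sup>2 - 2 * max 0 u * (v - u)\<bar> \<le> (v - u)\<^sup>2" for u v :: real
      proof -
        consider "0 \<le> u" "0 \<le> v" | "0 \<le> u" "v < 0" | "u < 0" "0 \<le> v" | "u < 0" "v < 0" by linarith
        then show ?thesis
        proof cases
          case 1
          have "v\<^sup>2 - u\<^sup>2 - 2 * u * (v - u) = (v - u)\<^sup>2"
            by (simp add: power2_eq_square algebra_simps)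
          then show ?thesis using 1 by simp
        next
          case 2
          then have "0 \<le> u * (u - 2 * v)" by simp
          moreover have "u * v \<le> 0" using 2 by (simp add: mult_nonneg_nonpos)
          ultimately show ?thesis using 2 by (simp add: power2_eq_square algebra_simps abs_if)
        next
          case 3
          then have "v\<^sup>2 \<le> (v - u)\<^sup>2" by (intro power_mono) auto
          then show ?thesis using 3 by simp
        qed auto
      qed
      show ?thesis
        using *[of "a - jap y" "a - jap x"] by (simp add: q_def s_def)
    qed
    also have "\<dots> \<le> (norm (y - x))\<^sup>2"
      using power_mono[OF jap_lipschitz[of x y] abs_ge_zero, where n=2] by (simp add: norm_minus_commute)
    finally have 1: "\<bar>q y - q x - 2 * s x * (jap x - jap y)\<bar> \<le> (norm (y - x))\<^sup>2" .
    have "\<bar>2 * s x * ?r\<bar> \<le> 2 * a * ((norm (y - x))\<^sup>2 / 2)"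
      unfolding abs_mult using jap_taylor[of y x] s_le[of x] s_nonneg[of x] by (intro mult_mono) auto
    moreover have "q y - q x - G x \<bullet> (y - x) = (q y - q x - 2 * s x * (jap x - jap y)) - 2 * s x * ?r"
      by (simp add: G_def algebra_simps)
    ultimately have "\<bar>q y - q x - G x \<bullet> (y - x)\<bar> \<le> (1 + a) * (norm (y - x))\<^sup>2"
      using 1 by (simp add: algebra_simps)
    also have "\<dots> \<le> C * (norm (y - x))\<^sup>2"
      using a1 by (intro mult_right_mono) (auto simp: C_def)
    finally show ?thesis .
  qed
  have G_lip: "norm (G x - G y) \<le> C * norm (x - y)" for x y
  proof -
    have "G x - G y = (- 2 * s x) *\<^sub>R (x /\<^sub>R jap x - y /\<^sub>R jap y) - (2 * (s x - s y)) *\<^sub>R (y /\<^sub>R jap y)"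
      by (simp add: G_def algebra_simps)
    also have "norm \<dots> \<le> 2 * s x * norm (x /\<^sub>R jap x - y /\<^sub>R jap y) + 2 * \<bar>s x - s y\<bar> * norm (y /\<^sub>R jap y)"
    proof -
      have "norm ((- 2 * c) *\<^sub>R u - (2 * d) *\<^sub>R w) \<le> 2 * c * norm u + 2 * \<bar>d\<bar> * norm w"
        if "0 \<le> c" for c d and u w :: 'a
        using that norm_triangle_ineq4[of "(- 2 * c) *\<^sub>R u" "(2 * d) *\<^sub>R w"] by (simp add: abs_mult)
      then show ?thesis using s_nonneg[of x] .
    qed
    also have "\<dots> \<le> 2 * a * (2 * norm (x - y)) + 2 * norm (x - y) * 1"
      using s_le[of x] s_nonneg[of x] lipschitz_div_jap[of x y] s_lip[of x y] norm_div_jap_le[of y]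
      by (intro add_mono mult_mono) auto
    also have "\<dots> = C * norm (x - y)" by (simp add: C_def algebra_simps)
    finally show ?thesis .
  qed
  have q_cont: "continuous_on UNIV q"
    unfolding q_def by (intro continuous_intros s_cont)
  have q_int: "integrable lborel q"
    by (rule integrable_continuous_supported[OF q_cont]) (use supp in blast)
  define I where "I = (LINT z|lborel. q z)"
  have "I \<noteq> 0"
  proof
    assume "I = 0"
    then have ae: "AE z in lborel. q z = 0"
      unfolding I_def by (subst (asm) integral_nonneg_eq_0_iff_AE[OF q_int]) (auto simp: q_def)
    have nz: "q z \<noteq> 0" if "z \<in> ball 0 \<delta>" for z
    proof -
      have "jap z < a"
        using that assms unfolding a_def jap_def
        by (intro real_sqrt_less_mono add_strict_left_mono power_strict_mono) auto
      then show ?thesis by (simp add: q_def s_def)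
    qed
    have "AE z::'a in lborel. z \<notin> ball 0 \<delta>"
      by (rule eventually_mono[OF ae]) (use nz in blast)
    then have "emeasure lborel (ball (0::'a) \<delta>) = 0"
      by (subst (asm) AE_iff_measurable[where N="ball 0 \<delta>"]) auto
    then have "measure lborel (ball (0::'a) \<delta>) = 0"
      by (simp add: measure_def)
    then show False
      using content_ball_pos[of \<delta> "0::'a"] assms by simp
  qed
  moreover have "0 \<le> I" unfolding I_def q_def by simp
  ultimately have I: "0 < I" by simp
  have "mollifier (\<lambda>z. q z / I) (\<lambda>z. G z /\<^sub>R I) (C / I) \<delta>"
  proof
    fix x y
    show "\<bar>q y / I - q x / I - (G x /\<^sub>R I) \<bullet> (y - x)\<bar> \<le> C / I * (norm (y - x))\<^sup>2"
    proof -
      have "q y / I - q x / I - (G x /\<^sub>R I) \<bullet> (y - x) = (q y - q x - G x \<bullet> (y - x)) / I"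
        by (simp add: divide_inverse algebra_simps)
      then show ?thesis
        using divide_right_mono[OF taylor[of y x], of I] I by (simp add: abs_divide)
    qed
    show "norm (G x /\<^sub>R I - G y /\<^sub>R I) \<le> C / I * norm (x - y)"
      using divide_right_mono[OF G_lip[of x y], of I] I
      by (simp add: scaleR_diff_right[symmetric] divide_inverse mult.commute)
    show "0 \<le> q x / I" using I by (simp add: q_def)
    show "integrable lborel (\<lambda>z. q z / I)" using q_int by (rule integrable_divide)
    show "(LINT z|lborel. q z / I) = 1" using I by (simp add: I_def[symmetric])
  qed (simp add: supp)
  then show ?thesis by blast
qed

section \<open>Euler schemes\<close>

lemma lipschitz_imp_borel:
  fixes f :: "'a::euclidean_space \<Rightarrow> real"
  assumes "\<And>x y. \<bar>f x - f y\<bar> \<le> L * norm (x - y)"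
  shows "continuous_on UNIV f" "f \<in> borel_measurable borel"
proof -
  have "\<bar>f x - f y\<bar> \<le> \<bar>L\<bar> * norm (x - y)" for x y
    by (rule order.trans[OF assms mult_right_mono]) auto
  then show "continuous_on UNIV f"
    by (intro lipschitz_on_continuous_on[where L="\<bar>L\<bar>"] lipschitz_onI) (auto simp: dist_norm)
  then show "f \<in> borel_measurable borel"
    by (rule borel_measurable_continuous_onI)
qed

text \<open>Indicators of open boxes are pointwise limits of the minimum of 1 and n times the
  distance to the complement. These functions are Lipschitz, bounded by 1 and vanish off the box,
  and boxes form a generator stable under intersection.\<close>

lemma borel_prob_eqI_lipschitz:
  fixes \<mu> \<nu> :: "'a::euclidean_space measure"
  assumes \<mu>: "prob_space \<mu>" "sets \<mu> = sets borel" and \<nu>: "prob_space \<nu>" "sets \<nu> = sets borel"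
    and eq: "\<And>f L S. (\<And>x y. \<bar>f x - f y\<bar> \<le> L * norm (x - y)) \<Longrightarrow> (\<And>x. \<bar>f x\<bar> \<le> 1) \<Longrightarrow>
      (\<And>x. S < norm x \<Longrightarrow> f x = 0) \<Longrightarrow> (LINT x|\<mu>. f x) = (LINT x|\<nu>. f x)"
  shows "\<mu> = \<nu>"
proof -
  interpret \<mu>: prob_space \<mu> by (rule \<mu>(1))
  interpret \<nu>: prob_space \<nu> by (rule \<nu>(1))
  have box_eq: "measure \<mu> (box a b) = measure \<nu> (box a b)" for a b
  proof -
    define F where "F = - box a b"
    have F: "closed F" "F \<noteq> {}"
    proof -
      show "closed F" by (simp add: F_def closed_def open_box)
      show "F \<noteq> {}"
      proof
        assume "F = {}"
        then have "box a b = UNIV" unfolding F_def by blast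
        then show False using bounded_box[of a b] not_bounded_UNIV by metis
      qed
    qed
    define f where "f n x = min 1 (real n * infdist x F)" for n x
    have f_lip: "\<bar>f n x - f n y\<bar> \<le> real n * norm (x - y)" for n x y
    proof -
      have "\<bar>f n x - f n y\<bar> \<le> \<bar>real n * infdist x F - real n * infdist y F\<bar>"
        unfolding f_def by linarith
      also have "\<dots> = real n * \<bar>infdist x F - infdist y F\<bar>"
        by (simp add: right_diff_distrib[symmetric] abs_mult)
      also have "\<dots> \<le> real n * norm (x - y)"
        using infdist_triangle_abs[of x F y] by (intro mult_left_mono) (auto simp: dist_norm)
      finally show ?thesis .
    qed
    have f_bd: "\<bar>f n x\<bar> \<le> 1" for n x
      using infdist_nonneg[of x F] by (auto simp: f_def)
    have f_lim: "(\<lambda>n. f n x) \<longlonglongrightarrow> indicator (box a b) x" for x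
    proof (cases "x \<in> F")
      case True
      then show ?thesis by (simp add: f_def F_def)
    next
      case False
      then have pos: "0 < infdist x F"
        using infdist_pos_not_in_closed[OF F] by blast
      obtain N where N: "1 / infdist x F \<le> real N" using real_arch_simple by blast
      have "f n x = 1" if "N \<le> n" for n
      proof -
        have "1 / infdist x F \<le> real n" using N that by linarith
        then show ?thesis using pos by (simp add: f_def divide_le_eq)
      qed
      then have "(\<lambda>n. f n x) \<longlonglongrightarrow> 1"
        by (intro tendsto_eventually) (auto simp: eventually_sequentially)
      then show ?thesis using False by (simp add: F_def)
    qed
    obtain S where S: "\<And>x. x \<in> box a b \<Longrightarrow> norm x \<le> S"
      using bounded_box[of a b] unfolding bounded_iff by blast
    have f_supp: "f n x = 0" if "S < norm x" for n x
      using S[of x] that by (force simp: f_def F_def)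
    have lim: "(\<lambda>n. LINT x|M. f n x) \<longlonglongrightarrow> measure M (box a b)"
      if M: "prob_space M" "sets M = sets borel" for M
    proof -
      interpret prob_space M by (rule M(1))
      have "(\<lambda>n. LINT x|M. f n x) \<longlonglongrightarrow> (LINT x|M. indicator (box a b) x)"
      proof (rule integral_dominated_convergence[where w="\<lambda>_. 1"])
        show "f n \<in> borel_measurable M" for n
          using lipschitz_imp_borel(2)[OF f_lip] M(2) by (simp cong: measurable_cong_sets)
        show "indicat_real (box a b) \<in> borel_measurable M"
          using M(2) by simp
      qed (use f_lim f_bd in auto)
      then show ?thesis using M(2) sets_eq_imp_space_eq[OF M(2)] by simp
    qed
    have "(LINT x|\<mu>. f n x) = (LINT x|\<nu>. f n x)" for n
      by (rule eq[OF f_lip f_bd f_supp])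
    then show ?thesis
      using LIMSEQ_unique[OF lim[OF \<mu>] ] lim[OF \<nu>] by simp
  qed
  let ?E = "range (\<lambda>(a, b). box a b :: 'a set)"
  show ?thesis
  proof (rule measure_eqI_generator_eq)
    show "Int_stable ?E"
      by (auto simp: Int_stable_def box_Int_box)
    show "?E \<subseteq> Pow UNIV" "sets \<mu> = sigma_sets UNIV ?E" "sets \<nu> = sigma_sets UNIV ?E"
      using \<mu>(2) \<nu>(2) by (simp_all add: borel_eq_box)
    let ?A = "\<lambda>n::nat. box (- (real n *\<^sub>R One)) (real n *\<^sub>R One) :: 'a set"
    show "range ?A \<subseteq> ?E" "(\<Union>i. ?A i) = UNIV"
      unfolding UN_box_eq_UNIV by auto
    show "emeasure \<mu> (?A i) \<noteq> \<infinity>" for i by simp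
    show "emeasure \<mu> X = emeasure \<nu> X" if "X \<in> ?E" for X
      using that box_eq by (auto simp: \<mu>.emeasure_eq_measure \<nu>.emeasure_eq_measure)
  qed
qed

lemma norm_diff_le_of_derivative_bound:
  fixes y :: "real \<Rightarrow> 'a::real_normed_vector"
  assumes "a \<le> b" and der: "\<And>s. s \<in> {a..b} \<Longrightarrow> (y has_vector_derivative y' s) (at s within {a..b})"
    and le: "\<And>s. s \<in> {a..b} \<Longrightarrow> norm (y' s) \<le> B"
  shows "norm (y b - y a) \<le> B * (b - a)"
proof -
  have "norm (y b - y a) \<le> B * norm (b - a)"
  proof (rule differentiable_bound[of "{a..b}"])
    show "(y has_derivative (\<lambda>h. h *\<^sub>R y' s)) (at s within {a..b})" if "s \<in> {a..b}" for s
      using der[OF that] by (simp add: has_vector_derivative_def)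
    show "onorm (\<lambda>h. h *\<^sub>R y' s) \<le> B" if "s \<in> {a..b}" for s
      using le[OF that] order.trans[OF norm_ge_zero le[OF that]]
      by (intro onorm_bound) (auto simp: mult.commute[of B] intro: mult_left_mono)
  qed (use assms(1) in auto)
  then show ?thesis using assms(1) by simp
qed

text \<open>With u = h C this keeps (1 - h C)^n above exp (- 2 C t) when n h = t, so the room needed
  for the pulled-back supports is the same for all small h.\<close>

lemma exp_le_one_minus:
  fixes u :: real
  assumes "0 \<le> u" "u \<le> 1/2"
  shows "exp (- 2 * u) \<le> 1 - u"
proof -
  have "1 \<le> (1 - u) * (1 + 2 * u)"
    using mult_nonneg_nonneg[of u "1 - 2 * u"] assms by (simp add: algebra_simps)
  also have "\<dots> \<le> (1 - u) * exp (2 * u)"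
    using assms exp_ge_add_one_self[of "2 * u"] by (intro mult_left_mono) auto
  finally have "1 * exp (- 2 * u) \<le> (1 - u) * exp (2 * u) * exp (- 2 * u)"
    by (intro mult_right_mono) auto
  then show ?thesis by (simp add: mult.assoc mult_exp_exp)
qed

section \<open>Stability and convergence of explicit Euler steps\<close>

context linear_growth_field
begin

definition step :: "real \<Rightarrow> real \<Rightarrow> real \<Rightarrow> 'a \<Rightarrow> 'a" where
  "step K h t x = x + h *\<^sub>R trunc K t x"

text \<open>The scheme runs forward from time 0, hence f composed with \<open>euler K h k\<close>
  pulls f back through the last step first; the induction in \<open>multi_step\<close> has to let
  the test function vary.\<close>

primrec euler :: "real \<Rightarrow> real \<Rightarrow> nat \<Rightarrow> 'a \<Rightarrow> 'a" where
  "euler K h 0 x = x"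
| "euler K h (Suc m) x = step K h (real m * h) (euler K h m x)"

lemma step_lipschitz:
  assumes "0 \<le> h" and L: "norm (trunc K t x - trunc K t y) \<le> L * norm (x - y)"
  shows "norm (step K h t x - step K h t y) \<le> (1 + h * L) * norm (x - y)"
proof -
  have "step K h t x - step K h t y = (x - y) + h *\<^sub>R (trunc K t x - trunc K t y)"
    by (simp add: step_def algebra_simps)
  also have "norm \<dots> \<le> norm (x - y) + h * norm (trunc K t x - trunc K t y)"
    using assms(1) by (intro order.trans[OF norm_triangle_ineq]) auto
  also have "\<dots> \<le> norm (x - y) + h * (L * norm (x - y))"
    using assms by (intro add_left_mono mult_left_mono) auto
  finally show ?thesis by (simp add: algebra_simps)
qed

lemma euler_lipschitz:
  assumes h: "0 \<le> h" "real m * h \<le> T" and "0 \<le> L"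
    and L: "\<And>t x y. t \<in> {0..T} \<Longrightarrow> norm (trunc K t x - trunc K t y) \<le> L * norm (x - y)"
  shows "norm (euler K h m x - euler K h m y) \<le> (1 + h * L) ^ m * norm (x - y)"
  using h(2)
proof (induction m)
  case (Suc m)
  then have m: "real m * h \<in> {0..T}" using h(1) by (auto simp: algebra_simps)
  have "norm (euler K h (Suc m) x - euler K h (Suc m) y) \<le> (1 + h * L) * norm (euler K h m x - euler K h m y)"
    unfolding euler.simps by (rule step_lipschitz[OF h(1) L[OF m]])
  also have "\<dots> \<le> (1 + h * L) * ((1 + h * L) ^ m * norm (x - y))"
    using Suc.IH m h(1) \<open>0 \<le> L\<close> by (intro mult_left_mono) auto
  finally show ?case by (simp add: mult_ac)
qed simp

text \<open>A step moves x by at most h C (1 + |x|), so far away points remain far away. Read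
  backwards, this bounds the support of a test function composed with the step.\<close>

lemma step_expansion:
  assumes "0 \<le> h" "0 \<le> K" "t \<in> {0..T}"
  shows "(1 - h * C) * (1 + norm x) \<le> 1 + norm (step K h t x)"
proof -
  have "norm (trunc K t x) \<le> C * (1 + norm x)"
    using trunc_growth[OF assms(2,3), of x] mult_left_mono[OF jap_le[of x] C_nonneg] by linarith
  then have "h * norm (trunc K t x) \<le> h * (C * (1 + norm x))"
    by (intro mult_left_mono assms)
  moreover have "norm x \<le> norm (step K h t x) + h * norm (trunc K t x)"
    using norm_triangle_ineq4[of "step K h t x" "h *\<^sub>R trunc K t x"] assms(1) by (simp add: step_def)
  ultimately show ?thesis by (simp add: algebra_simps)
qed

text \<open>The local error has two sources: freezing the time in the field, which costs
  \<open>a\<close>, and freezing the position, where the trajectory travels at most C (1 + K) h and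
  the Lipschitz constant converts this into a change of velocity.\<close>

lemma solution_consistency:
  assumes y: "solves_ode_from v T x y" and in_K: "\<And>s. s \<in> {0..T} \<Longrightarrow> y s \<in> cball 0 K"
    and K: "0 \<le> K" and L: "0 \<le> L" "\<And>t x y. t \<in> {0..T} \<Longrightarrow> norm (trunc K t x - trunc K t y) \<le> L * norm (x - y)"
    and t: "0 \<le> t" "0 \<le> h" "t + h \<le> T"
    and a: "\<And>s x. s \<in> {t..t+h} \<Longrightarrow> norm (trunc K s x - trunc K t x) \<le> a"
  shows "norm (y (t + h) - step K h t (y t)) \<le> (a + L * (C * (1 + K) * h)) * h"
proof -
  have sub: "{t..s} \<subseteq> {0..T}" if "s \<le> t + h" for s using t that by auto
  have der: "(y has_vector_derivative trunc K s (y s)) (at s within A)" if "s \<in> A" "A \<subseteq> {0..T}" for s A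
  proof -
    have "(y has_vector_derivative v s (y s)) (at s within {0..T})"
      using y that by (auto simp: solves_ode_from_def)
    then have "(y has_vector_derivative v s (y s)) (at s within A)"
      by (rule has_vector_derivative_within_subset) (rule that(2))
    moreover have "trunc K s (y s) = v s (y s)"
      by (rule trunc_eq[OF in_K]) (use that in blast)
    ultimately show ?thesis by simp
  qed
  have near: "norm (y s - y t) \<le> C * (1 + K) * h" if s: "s \<in> {t..t+h}" for s
  proof -
    have "norm (y s - y t) \<le> C * (1 + K) * (s - t)"
      using s t trunc_bounded[OF K] sub[of s]
      by (intro norm_diff_le_of_derivative_bound[where y'="\<lambda>s. trunc K s (y s)"] der) auto
    also have "\<dots> \<le> C * (1 + K) * h"
      using s C_nonneg K by (intro mult_left_mono) auto
    finally show ?thesis .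
  qed
  \<comment> \<open>After subtracting the motion with frozen velocity, the derivative is exactly the
    deviation of the velocity.\<close>
  let ?z = "\<lambda>s. y s - (s - t) *\<^sub>R trunc K t (y t)"
  have "norm (?z (t + h) - ?z t) \<le> (a + L * (C * (1 + K) * h)) * (t + h - t)"
  proof (rule norm_diff_le_of_derivative_bound)
    fix s assume s: "s \<in> {t..t+h}"
    show "(?z has_vector_derivative trunc K s (y s) - trunc K t (y t)) (at s within {t..t+h})"
      using der[OF s sub[OF order_refl]] by (auto intro!: derivative_eq_intros)
    have "norm (trunc K s (y s) - trunc K t (y t))
        \<le> norm (trunc K s (y s) - trunc K t (y s)) + norm (trunc K t (y s) - trunc K t (y t))"
      using norm_triangle_ineq[of "trunc K s (y s) - trunc K t (y s)" "trunc K t (y s) - trunc K t (y t)"] by simp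
    also have "\<dots> \<le> a + L * norm (y s - y t)"
      using t by (intro add_mono a[OF s] L(2)) auto
    also have "\<dots> \<le> a + L * (C * (1 + K) * h)"
      by (intro add_left_mono mult_left_mono near s L)
    finally show "norm (trunc K s (y s) - trunc K t (y t)) \<le> a + L * (C * (1 + K) * h)" .
  qed (use t in auto)
  then show ?thesis by (simp add: step_def algebra_simps)
qed

text \<open>Each step adds a local error and amplifies the earlier ones by 1 + h L; replacing every
  amplification by the largest one leaves the number of steps as a factor.\<close>

lemma euler_error:
  assumes y: "solves_ode_from v T x y" and in_K: "\<And>s. s \<in> {0..T} \<Longrightarrow> y s \<in> cball 0 K"
    and K: "0 \<le> K" and L: "0 \<le> L" "\<And>t x y. t \<in> {0..T} \<Longrightarrow> norm (trunc K t x - trunc K t y) \<le> L * norm (x - y)"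
    and h: "0 \<le> h" "real m * h \<le> T"
    and a: "\<And>s t x. s \<in> {0..T} \<Longrightarrow> t \<in> {0..T} \<Longrightarrow> \<bar>s - t\<bar> \<le> h \<Longrightarrow> norm (trunc K s x - trunc K t x) \<le> a"
  shows "norm (euler K h m x - y (real m * h)) \<le> real m * h * (a + L * (C * (1 + K) * h)) * (1 + h * L) ^ m"
  using h(2)
proof (induction m)
  case 0
  then show ?case using y by (simp add: solves_ode_from_def)
next
  case (Suc m)
  let ?t = "real m * h" and ?e = "a + L * (C * (1 + K) * h)" and ?q = "1 + h * L"
  have m: "?t \<in> {0..T}" "?t + h \<le> T" using h(1) Suc.prems by (auto simp: algebra_simps)
  have a': "norm (trunc K s x - trunc K ?t x) \<le> a" if "s \<in> {?t..?t + h}" for s x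
  proof (rule a[OF _ m(1)])
    have "0 \<le> ?t" "?t \<le> s" "s \<le> ?t + h" using m(1) that by simp_all
    then have "0 \<le> s" "s \<le> T" "\<bar>s - ?t\<bar> \<le> h" using m(2) by linarith+
    then show "s \<in> {0..T}" "\<bar>s - ?t\<bar> \<le> h" by simp_all
  qed
  have q: "1 \<le> ?q" using h(1) L(1) by simp
  have "0 \<le> a" using a[of 0 0] T_nonneg h(1) norm_ge_zero order.trans by (metis abs_zero atLeastAtMost_iff diff_self order_refl)
  then have e: "0 \<le> ?e" using L(1) C_nonneg K h(1) by simp
  have "norm (euler K h (Suc m) x - y (real (Suc m) * h))
      \<le> norm (step K h ?t (euler K h m x) - step K h ?t (y ?t)) + norm (y (?t + h) - step K h ?t (y ?t))"
    using norm_triangle_ineq4[of "step K h ?t (euler K h m x) - step K h ?t (y ?t)" "y (?t + h) - step K h ?t (y ?t)"]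
    by (simp add: algebra_simps)
  also have "\<dots> \<le> ?q * norm (euler K h m x - y ?t) + ?e * h"
    using m h(1) by (intro add_mono step_lipschitz solution_consistency[OF y in_K K L] a' L(2)[OF m(1)]) auto
  also have "\<dots> \<le> ?q * (real m * h * ?e * ?q ^ m) + ?e * h * ?q ^ Suc m"
  proof (intro add_mono mult_left_mono)
    show "?e * h \<le> ?e * h * ?q ^ Suc m"
      using mult_left_mono[OF one_le_power[OF q, of "Suc m"], of "?e * h"] e h(1) by simp
  qed (use Suc.IH m q in auto)
  also have "\<dots> = real (Suc m) * h * ?e * ?q ^ Suc m"
    by (simp add: algebra_simps)
  finally show ?case .
qed

end

section \<open>Weak solutions of the continuity equation\<close>

locale transport = linear_growth_field v T C
  for v :: "real \<Rightarrow> 'a::euclidean_space \<Rightarrow> 'a" and T C :: real +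
  fixes \<rho> :: "real \<Rightarrow> 'a measure" and R :: real
  assumes ac: "AC_curve T \<rho>"
    and weak: "\<And>\<phi> t. C1_fun \<phi> \<Longrightarrow> compactly_supported \<phi> \<Longrightarrow> t \<in> {0..T} \<Longrightarrow>
      (LINT x|\<rho> t. \<phi> x) - (LINT x|\<rho> 0. \<phi> x) = (LINT s:{0..t}|lborel. (LINT x|\<rho> s. grad \<phi> x \<bullet> v s x))"
    and initial_bounded: "AE x in \<rho> 0. norm x \<le> R"

text \<open>\<open>S\<close> and \<open>\<Lambda>\<close> bound the support and the Lipschitz
  constant of every test function met along the scheme. The condition
  \<open>S + \<delta> \<le> K\<close> places the mollified functions where the truncated field is
  v.\<close>

locale mollified_transport = transport v T C \<rho> R + m: mollifier \<eta> G D \<delta>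
  for v :: "real \<Rightarrow> 'a::euclidean_space \<Rightarrow> 'a" and T C \<rho> R
    and \<eta> :: "'a \<Rightarrow> real" and G D \<delta> +
  fixes K L S \<Lambda> H :: real
  assumes K_nonneg: "0 \<le> K" and supp_K: "S + \<delta> \<le> K"
    and L_nonneg: "0 \<le> L"
    and trunc_lip: "\<And>t x y. t \<in> {0..T} \<Longrightarrow> norm (trunc K t x - trunc K t y) \<le> L * norm (x - y)"
    and \<Lambda>_nonneg: "0 \<le> \<Lambda>"
    and H_eq: "H = m.hessian_bound 1 (cball (0::'a) S)"
begin

abbreviation "M \<equiv> C * (1 + K)"

lemma M_nonneg: "0 \<le> M"
  using C_nonneg K_nonneg by simp

lemma H_nonneg: "0 \<le> H"
  using m.C_nonneg by (simp add: H_eq m.hessian_bound_def)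

lemma P2_\<rho>: "t \<in> {0..T} \<Longrightarrow> \<rho> t \<in> P2"
  using ac by (rule AC_curve_P2)

lemma trunc_cont: "t \<in> {0..T} \<Longrightarrow> continuous_on UNIV (trunc K t)"
  using L_nonneg by (intro lipschitz_on_continuous_on[where L=L] lipschitz_onI) (auto simp: dist_norm trunc_lip)

definition admissible :: "real \<Rightarrow> real \<Rightarrow> ('a \<Rightarrow> real) \<Rightarrow> bool" where
  "admissible \<Lambda>' S' f \<longleftrightarrow> (\<forall>x y. \<bar>f x - f y\<bar> \<le> \<Lambda>' * norm (x - y)) \<and> (\<forall>x. \<bar>f x\<bar> \<le> 1) \<and> (\<forall>x. S' < norm x \<longrightarrow> f x = 0)"

lemma admissible_mono: "admissible \<Lambda>' S' f \<Longrightarrow> \<Lambda>' \<le> \<Lambda>'' \<Longrightarrow> S' \<le> S'' \<Longrightarrow> admissible \<Lambda>'' S'' f"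
  unfolding admissible_def by (meson le_less_trans mult_right_mono norm_ge_zero order.trans)

text \<open>Error per unit time, where \<open>a\<close> and \<open>b\<close> bound the variation of
  the field and of the measure during a step. In order: variation of the field in time, motion of
  the measure, Taylor remainder, commutator. Only the last term is left as h tends to 0 with
  \<delta> fixed.\<close>

definition err :: "real \<Rightarrow> real \<Rightarrow> real \<Rightarrow> real" where
  "err h a b = \<Lambda> * a + (H * M + \<Lambda> * L) * b + H * h * M\<^sup>2 + \<Lambda> * L * \<delta>"

lemma err_nonneg: "0 \<le> h \<Longrightarrow> 0 \<le> a \<Longrightarrow> 0 \<le> b \<Longrightarrow> 0 \<le> \<delta> \<Longrightarrow> 0 \<le> err h a b"
  using \<Lambda>_nonneg L_nonneg H_nonneg M_nonneg by (simp add: err_def)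

context
  fixes f assumes f: "admissible \<Lambda> S f"
begin

lemma f_lip: "\<bar>f x - f y\<bar> \<le> \<Lambda> * norm (x - y)" and f_bd: "\<bar>f x\<bar> \<le> 1" and f_supp: "S < norm x \<longrightarrow> f x = 0"
  using f by (auto simp: admissible_def)

lemma f_cont: "continuous_on UNIV f" and f_borel: "f \<in> borel_measurable borel"
  by (rule lipschitz_imp_borel[OF f_lip])+

lemmas smooth_grad_le = m.smooth_grad_le[OF f_cont f_bd f_supp f_lip]
lemmas smooth_grad_lipschitz = m.smooth_grad_lipschitz[OF f_cont f_bd f_supp, folded H_eq]
lemmas smooth_taylor = m.smooth_taylor[OF f_cont f_bd f_supp, folded H_eq]

definition flux :: "real \<Rightarrow> real" where
  "flux s = (LINT x|\<rho> s. grad (m.smooth f) x \<bullet> v s x)"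

text \<open>Outside the ball of radius \<open>K\<close> the gradient vanishes, which is what makes
  the truncation exact in the weak formulation.\<close>

lemma grad_smooth_inner: "grad (m.smooth f) x \<bullet> v s x = m.smooth_grad f x \<bullet> trunc K s x"
proof (cases "norm x \<le> K")
  case True
  then show ?thesis
    by (simp add: m.grad_smooth[OF f_cont f_bd f_supp] trunc_eq)
next
  case False
  then have "m.smooth_grad f x = 0"
    using m.smooth_grad_support[OF f_cont f_bd f_supp, of x] supp_K by simp
  then show ?thesis by (simp add: m.grad_smooth[OF f_cont f_bd f_supp])
qed

lemma flux_eq: "flux s = (LINT x|\<rho> s. m.smooth_grad f x \<bullet> trunc K s x)"
  by (simp add: flux_def grad_smooth_inner)

lemma smooth_grad_cont: "continuous_on UNIV (m.smooth_grad f)"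
  using H_nonneg by (intro lipschitz_on_continuous_on[where L=H] lipschitz_onI)
    (auto simp: dist_norm smooth_grad_lipschitz)

lemma integrand_cont: "t \<in> {0..T} \<Longrightarrow> continuous_on UNIV (\<lambda>x. m.smooth_grad f x \<bullet> trunc K t x)"
  by (intro continuous_intros smooth_grad_cont trunc_cont)

lemma integrand_le: "t \<in> {0..T} \<Longrightarrow> \<bar>m.smooth_grad f x \<bullet> trunc K t x\<bar> \<le> \<Lambda> * M"
  using Cauchy_Schwarz_ineq2[of "m.smooth_grad f x" "trunc K t x"]
    mult_mono[OF smooth_grad_le[of x] trunc_bounded[OF K_nonneg, of t x]] \<Lambda>_nonneg by auto

text \<open>Needed to compare integrals against the measures at two times through \<open>dW\<close>.
  The bound \<open>H\<close> enters here, because the gradient itself is differenced.\<close>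

lemma integrand_lipschitz:
  assumes t: "t \<in> {0..T}"
  shows "\<bar>m.smooth_grad f x \<bullet> trunc K t x - m.smooth_grad f y \<bullet> trunc K t y\<bar> \<le> (H * M + \<Lambda> * L) * norm (x - y)"
proof -
  let ?g = "m.smooth_grad f" and ?w = "trunc K t"
  have eq: "?g x \<bullet> ?w x - ?g y \<bullet> ?w y = (?g x - ?g y) \<bullet> ?w x + ?g y \<bullet> (?w x - ?w y)"
    by (simp add: inner_diff)
  have "\<bar>(?g x - ?g y) \<bullet> ?w x\<bar> \<le> norm (?g x - ?g y) * norm (?w x)"
    by (rule Cauchy_Schwarz_ineq2)
  also have "\<dots> \<le> (H * norm (x - y)) * M"
    by (rule mult_mono[OF smooth_grad_lipschitz trunc_bounded[OF K_nonneg t]]) (simp_all add: H_nonneg)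
  finally have 1: "\<bar>(?g x - ?g y) \<bullet> ?w x\<bar> \<le> (H * norm (x - y)) * M" .
  have "\<bar>?g y \<bullet> (?w x - ?w y)\<bar> \<le> norm (?g y) * norm (?w x - ?w y)"
    by (rule Cauchy_Schwarz_ineq2)
  also have "\<dots> \<le> \<Lambda> * (L * norm (x - y))"
    by (rule mult_mono[OF smooth_grad_le trunc_lip[OF t]]) (simp_all add: \<Lambda>_nonneg)
  finally have 2: "\<bar>?g y \<bullet> (?w x - ?w y)\<bar> \<le> \<Lambda> * (L * norm (x - y))" .
  have "(H * M + \<Lambda> * L) * norm (x - y) = (H * norm (x - y)) * M + \<Lambda> * (L * norm (x - y))"
    by (simp add: distrib_right)
  then show ?thesis
    using 1 2 abs_triangle_ineq[of "(?g x - ?g y) \<bullet> ?w x" "?g y \<bullet> (?w x - ?w y)"]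
    unfolding eq by linarith
qed

text \<open>First the field varies at a fixed measure, then the measure varies with a fixed
  integrand. The disjunction accepts the distance in either order.\<close>

lemma flux_diff:
  assumes st: "s \<in> {0..T}" "t \<in> {0..T}"
    and a: "\<And>x. norm (trunc K s x - trunc K t x) \<le> a" and b: "dW (\<rho> s) (\<rho> t) \<le> b \<or> dW (\<rho> t) (\<rho> s) \<le> b"
  shows "\<bar>flux s - flux t\<bar> \<le> \<Lambda> * a + (H * M + \<Lambda> * L) * b"
proof -
  let ?g = "\<lambda>t x. m.smooth_grad f x \<bullet> trunc K t x"
  have i: "integrable (\<rho> s) (?g r)" if "r \<in> {0..T}" for r
    using integrand_le[OF that] that
    by (intro P2_integrable_bounded[OF P2_\<rho>[OF st(1)] borel_measurable_continuous_onI[OF integrand_cont]]) auto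
  have "flux s - flux t = (LINT x|\<rho> s. ?g s x - ?g t x) + ((LINT x|\<rho> s. ?g t x) - (LINT x|\<rho> t. ?g t x))"
    using i[OF st(1)] i[OF st(2)] by (simp add: flux_eq)
  moreover have "\<bar>LINT x|\<rho> s. ?g s x - ?g t x\<bar> \<le> \<Lambda> * a"
    unfolding real_norm_def[symmetric]
  proof (rule P2_norm_integral_le[OF P2_\<rho>[OF st(1)]])
    show "(\<lambda>x. ?g s x - ?g t x) \<in> borel_measurable borel"
      by (intro borel_measurable_continuous_onI continuous_intros integrand_cont st)
    fix x
    have "\<bar>m.smooth_grad f x \<bullet> (trunc K s x - trunc K t x)\<bar> \<le> \<Lambda> * a"
      using Cauchy_Schwarz_ineq2[of "m.smooth_grad f x" "trunc K s x - trunc K t x"]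
        mult_mono[OF smooth_grad_le[of x] a[of x]] \<Lambda>_nonneg by simp
    then show "norm (?g s x - ?g t x) \<le> \<Lambda> * a"
      by (simp add: inner_diff_right)
  qed
  moreover have "\<bar>(LINT x|\<rho> s. ?g t x) - (LINT x|\<rho> t. ?g t x)\<bar> \<le> (H * M + \<Lambda> * L) * b"
  proof -
    have c: "0 \<le> H * M + \<Lambda> * L"
      using H_nonneg M_nonneg \<Lambda>_nonneg L_nonneg by simp
    note d = lipschitz_integral_diff_le_dW[OF _ _ c integrand_lipschitz[OF st(2)] integrand_le[OF st(2)]
        borel_measurable_continuous_onI[OF integrand_cont[OF st(2)]]]
    have "\<bar>(LINT x|\<rho> s. ?g t x) - (LINT x|\<rho> t. ?g t x)\<bar> \<le> (H * M + \<Lambda> * L) * dW (\<rho> s) (\<rho> t)"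
      by (rule d[OF P2_\<rho>[OF st(1)] P2_\<rho>[OF st(2)]])
    moreover have "\<bar>(LINT x|\<rho> s. ?g t x) - (LINT x|\<rho> t. ?g t x)\<bar> \<le> (H * M + \<Lambda> * L) * dW (\<rho> t) (\<rho> s)"
      by (subst abs_minus_commute) (rule d[OF P2_\<rho>[OF st(2)] P2_\<rho>[OF st(1)]])
    ultimately show ?thesis
      using b mult_left_mono[OF _ c, of "dW (\<rho> s) (\<rho> t)" b] mult_left_mono[OF _ c, of "dW (\<rho> t) (\<rho> s)" b]
      by linarith
  qed
  ultimately show ?thesis by linarith
qed

lemma flux_continuous: "continuous_on {0..T} flux"
proof (rule continuous_onI)
  fix t e :: real assume t: "t \<in> {0..T}" and e: "0 < e"
  define A where "A = \<Lambda> + (H * M + \<Lambda> * L) + 1"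
  have c: "0 \<le> H * M + \<Lambda> * L"
    using H_nonneg M_nonneg \<Lambda>_nonneg L_nonneg by simp
  then have A: "0 < A" using \<Lambda>_nonneg by (simp add: A_def)
  define a where "a = e / A"
  have a: "0 < a" using A e by (simp add: a_def)
  obtain d1 where d1: "0 < d1" "\<And>s t x. s \<in> {0..T} \<Longrightarrow> t \<in> {0..T} \<Longrightarrow> \<bar>s - t\<bar> \<le> d1 \<Longrightarrow>
      norm (trunc K s x - trunc K t x) \<le> a"
    using trunc_uniformly_continuous[OF K_nonneg a] by blast
  obtain d2 where d2: "0 < d2" "\<And>s t. s \<in> {0..T} \<Longrightarrow> t \<in> {0..T} \<Longrightarrow> s \<le> t \<Longrightarrow> t - s \<le> d2 \<Longrightarrow> dW (\<rho> s) (\<rho> t) \<le> a"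
    using AC_curve_modulus[OF ac a] by blast
  have "dist (flux s) (flux t) \<le> e" if s: "s \<in> {0..T}" "dist s t < min d1 d2" for s
  proof -
    have "\<bar>flux s - flux t\<bar> \<le> \<Lambda> * a + (H * M + \<Lambda> * L) * a"
    proof (rule flux_diff[OF s(1) t d1(2)[OF s(1) t]])
      show "\<bar>s - t\<bar> \<le> d1" using s(2) by (simp add: dist_real_def)
      show "dW (\<rho> s) (\<rho> t) \<le> a \<or> dW (\<rho> t) (\<rho> s) \<le> a"
        using s t d2(2)[of s t] d2(2)[of t s] by (cases "s \<le> t") (auto simp: dist_real_def)
    qed
    also have "\<dots> \<le> A * a" using a by (simp add: A_def algebra_simps)
    also have "\<dots> = e" using A by (simp add: a_def)
    finally show ?thesis by (simp add: dist_real_def)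
  qed
  then show "\<exists>d>0. \<forall>s\<in>{0..T}. dist s t < d \<longrightarrow> dist (flux s) (flux t) \<le> e"
    using d1(1) d2(1) by (intro exI[of _ "min d1 d2"]) auto
qed

lemma weak_increment:
  assumes t: "0 \<le> t" "0 \<le> h" "t + h \<le> T"
  shows "(LINT x|\<rho> (t + h). m.smooth f x) - (LINT x|\<rho> t. m.smooth f x) = integral {t..t + h} flux"
proof -
  have w: "(LINT x|\<rho> s. m.smooth f x) - (LINT x|\<rho> 0. m.smooth f x) = integral {0..s} flux"
    if s: "s \<in> {0..T}" for s
  proof -
    have "set_integrable lborel {0..s} flux"
      using s by (intro borel_integrable_atLeastAtMost' continuous_on_subset[OF flux_continuous]) auto
    then have "(LINT r:{0..s}|lborel. flux r) = integral {0..s} flux"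
      by (rule set_borel_integral_eq_integral(2))
    then show ?thesis
      using weak[OF m.smooth_C1[OF f_cont f_bd f_supp] m.smooth_compactly_supported[OF f_cont f_bd f_supp] s]
      by (simp add: flux_def)
  qed
  have "integral {0..t} flux + integral {t..t + h} flux = integral {0..t + h} flux"
    using t by (intro Henstock_Kurzweil_Integration.integral_combine integrable_continuous_real
        continuous_on_subset[OF flux_continuous]) auto
  then show ?thesis
    using w[of t] w[of "t + h"] t by simp
qed

text \<open>Smoothing does not commute with the Euler step, but the commutator only involves the oscillation
  of a Lipschitz field over a ball of radius \<open>\<delta>\<close>.\<close>

lemma smooth_step_diff:
  assumes t: "t \<in> {0..T}" and h: "0 \<le> h" and \<delta>: "0 \<le> \<delta>"
  shows "\<bar>m.smooth (\<lambda>x. f (step K h t x)) x - m.smooth f x - h * (m.smooth_grad f x \<bullet> trunc K t x)\<bar>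
    \<le> H * h\<^sup>2 * M\<^sup>2 + \<Lambda> * h * L * \<delta>"
proof -
  let ?w = "trunc K t"
  have cont: "continuous_on UNIV (\<lambda>x. f (step K h t x))"
    unfolding step_def by (intro continuous_on_compose2[OF f_cont] continuous_intros trunc_cont t) auto
  have 1: "\<bar>m.smooth (\<lambda>x. f (step K h t x)) x - m.smooth f (step K h t x)\<bar> \<le> \<Lambda> * h * L * \<delta>"
  proof (rule m.smooth_diff_le[OF borel_measurable_continuous_onI[OF cont] f_bd f_borel f_bd])
    fix z :: 'a assume z: "norm z \<le> \<delta>"
    have "\<bar>f (step K h t (x - z)) - f (step K h t x - z)\<bar> \<le> \<Lambda> * norm (step K h t (x - z) - (step K h t x - z))"
      by (rule f_lip)
    also have "step K h t (x - z) - (step K h t x - z) = h *\<^sub>R (?w (x - z) - ?w x)"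
      by (simp add: step_def algebra_simps)
    also have "\<Lambda> * norm \<dots> \<le> \<Lambda> * (h * (L * \<delta>))"
    proof -
      have "norm (?w (x - z) - ?w x) \<le> L * norm z"
        using trunc_lip[OF t, of "x - z" x] by simp
      also have "\<dots> \<le> L * \<delta>" using z L_nonneg by (intro mult_left_mono)
      finally show ?thesis using h \<Lambda>_nonneg by (simp add: mult_left_mono)
    qed
    finally show "\<bar>f (step K h t (x - z)) - f (step K h t x - z)\<bar> \<le> \<Lambda> * h * L * \<delta>"
      by (simp add: mult_ac)
  qed
  have "\<bar>m.smooth f (step K h t x) - m.smooth f x - m.smooth_grad f x \<bullet> (step K h t x - x)\<bar>
      \<le> H * (norm (step K h t x - x))\<^sup>2"
    by (rule smooth_taylor)
  also have "\<dots> \<le> H * (h * M)\<^sup>2"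
    using h trunc_bounded[OF K_nonneg t, of x] H_nonneg
    by (intro mult_left_mono power_mono) (auto simp: step_def mult_left_mono)
  finally have 2: "\<bar>m.smooth f (step K h t x) - m.smooth f x - h * (m.smooth_grad f x \<bullet> ?w x)\<bar> \<le> H * h\<^sup>2 * M\<^sup>2"
    by (simp add: step_def power_mult_distrib mult_ac)
  show ?thesis using 1 2 by linarith
qed

text \<open>To leading order both sides change the mollified integral at time t by h times the flux:
  the left one by the equation, the right one by Taylor expansion along the step. What remains is
  the oscillation of the flux and the commutator.\<close>

lemma one_step:
  assumes t: "0 \<le> t" "0 \<le> h" "t + h \<le> T" and \<delta>: "0 \<le> \<delta>"
    and a: "\<And>s x. s \<in> {t..t + h} \<Longrightarrow> norm (trunc K s x - trunc K t x) \<le> a"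
    and b: "\<And>s. s \<in> {t..t + h} \<Longrightarrow> dW (\<rho> t) (\<rho> s) \<le> b"
  shows "\<bar>(LINT x|\<rho> (t + h). m.smooth f x) - (LINT x|\<rho> t. m.smooth (\<lambda>x. f (step K h t x)) x)\<bar> \<le> h * err h a b"
proof -
  have t': "t \<in> {0..T}" using t by auto
  have sub: "{t..t + h} \<subseteq> {0..T}" using t by auto
  have fl: "continuous_on {t..t + h} flux"
    by (rule continuous_on_subset[OF flux_continuous sub])
  have "norm (integral {t..t + h} (\<lambda>s. flux s - flux t)) \<le> (\<Lambda> * a + (H * M + \<Lambda> * L) * b) * (t + h - t)"
    using t sub fl
    by (intro integral_bound continuous_intros) (auto intro!: flux_diff a b)
  moreover have "integral {t..t + h} (\<lambda>s. flux s - flux t) = integral {t..t + h} flux - h * flux t"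
    using t fl by (subst Henstock_Kurzweil_Integration.integral_diff) (auto intro: integrable_continuous_real)
  ultimately have 1: "\<bar>(LINT x|\<rho> (t + h). m.smooth f x) - (LINT x|\<rho> t. m.smooth f x) - h * flux t\<bar>
      \<le> (\<Lambda> * a + (H * M + \<Lambda> * L) * b) * h"
    by (simp add: weak_increment[OF t])
  let ?fs = "\<lambda>x. f (step K h t x)"
  have lip: "\<bar>?fs x - ?fs y\<bar> \<le> (\<Lambda> * (1 + h * L)) * norm (x - y)" for x y
    using order.trans[OF f_lip mult_left_mono[OF step_lipschitz[OF t(2) trunc_lip[OF t']] \<Lambda>_nonneg]]
    by (simp add: mult_ac)
  have meas: "m.smooth g \<in> borel_measurable borel"
    if "\<And>x y. \<bar>g x - g y\<bar> \<le> L' * norm (x - y)" "\<And>x. \<bar>g x\<bar> \<le> 1" for g L'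
    by (rule lipschitz_imp_borel(2)[OF m.smooth_lipschitz[OF lipschitz_imp_borel(2)[OF that(1)] that(2,1)]])
  have bd: "norm (m.smooth g x) \<le> 1"
    if "\<And>x y. \<bar>g x - g y\<bar> \<le> L' * norm (x - y)" "\<And>x. \<bar>g x\<bar> \<le> 1" for g L' x
    using m.smooth_abs_le[OF lipschitz_imp_borel(2)[OF that(1)] that(2)] by simp
  note int = P2_integrable_bounded[OF P2_\<rho>[OF t'] meas bd]
  have i: "integrable (\<rho> t) (m.smooth f)" "integrable (\<rho> t) (m.smooth ?fs)"
    by (rule int[OF f_lip f_bd f_lip f_bd] int[OF lip f_bd lip f_bd])+
  have iG: "integrable (\<rho> t) (\<lambda>x. m.smooth_grad f x \<bullet> trunc K t x)"
    using integrand_le[OF t']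
    by (intro P2_integrable_bounded[OF P2_\<rho>[OF t'] borel_measurable_continuous_onI[OF integrand_cont[OF t']]]) auto
  have "(LINT x|\<rho> t. m.smooth ?fs x) - (LINT x|\<rho> t. m.smooth f x) - h * flux t
      = (LINT x|\<rho> t. m.smooth ?fs x - m.smooth f x - h * (m.smooth_grad f x \<bullet> trunc K t x))"
    using i iG by (simp add: flux_eq)
  also have "norm \<dots> \<le> H * h\<^sup>2 * M\<^sup>2 + \<Lambda> * h * L * \<delta>"
  proof (rule P2_norm_integral_le[OF P2_\<rho>[OF t']])
    show "(\<lambda>x. m.smooth ?fs x - m.smooth f x - h * (m.smooth_grad f x \<bullet> trunc K t x)) \<in> borel_measurable borel"
      by (intro borel_measurable_diff borel_measurable_times borel_measurable_const meas[OF lip f_bd] meas[OF f_lip f_bd]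
          borel_measurable_continuous_onI[OF integrand_cont[OF t']])
  qed (use smooth_step_diff[OF t' t(2) \<delta>] in simp)
  finally have 2: "\<bar>(LINT x|\<rho> t. m.smooth ?fs x) - (LINT x|\<rho> t. m.smooth f x) - h * flux t\<bar>
      \<le> H * h\<^sup>2 * M\<^sup>2 + \<Lambda> * h * L * \<delta>" by simp
  have "h * err h a b = (\<Lambda> * a + (H * M + \<Lambda> * L) * b) * h + (H * h\<^sup>2 * M\<^sup>2 + \<Lambda> * h * L * \<delta>)"
    by (simp add: err_def algebra_simps power2_eq_square)
  then show ?thesis using 1 2 by linarith
qed

end

end

section \<open>Iteration of the one-step estimate and passage to the limit\<close>

lemma P2_integral_diff_le:
  fixes f g :: "'a::euclidean_space \<Rightarrow> real"
  assumes \<mu>: "\<mu> \<in> P2" and f: "f \<in> borel_measurable borel" "\<And>x. \<bar>f x\<bar> \<le> B"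
    and g: "g \<in> borel_measurable borel" "\<And>x. \<bar>g x\<bar> \<le> B"
    and le: "AE x in \<mu>. \<bar>f x - g x\<bar> \<le> D"
  shows "\<bar>(LINT x|\<mu>. f x) - (LINT x|\<mu>. g x)\<bar> \<le> D"
proof -
  interpret prob_space \<mu> by (rule P2_prob[OF \<mu>])
  have i: "integrable \<mu> f" "integrable \<mu> g"
    using f g by (auto intro!: P2_integrable_bounded[OF \<mu>])
  have "\<bar>(LINT x|\<mu>. f x) - (LINT x|\<mu>. g x)\<bar> = \<bar>LINT x|\<mu>. f x - g x\<bar>"
    using i by simp
  also have "\<dots> \<le> (LINT x|\<mu>. \<bar>f x - g x\<bar>)"
    by (rule integral_abs_bound)
  also have "\<dots> \<le> (LINT x|\<mu>. D)"
    using i by (intro integral_mono_AE le) auto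
  finally show ?thesis by (simp add: prob_space)
qed

context mollified_transport
begin

text \<open>Pulling back through one step multiplies the Lipschitz constant by 1 + h L and 1 +
  (support radius) by 1 / (1 - h C). The last two assumptions reserve room for k such steps, so each
  intermediate function remains admissible for \<open>\<Lambda>\<close> and
  \<open>S\<close>.\<close>

lemma multi_step:
  assumes h: "0 \<le> h" "h * C < 1" "real k * h \<le> T" and \<delta>: "0 \<le> \<delta>" and S: "0 \<le> S"
    and a: "\<And>s t x. s \<in> {0..T} \<Longrightarrow> t \<in> {0..T} \<Longrightarrow> \<bar>s - t\<bar> \<le> h \<Longrightarrow> norm (trunc K s x - trunc K t x) \<le> a"
    and b: "\<And>s t. s \<in> {0..T} \<Longrightarrow> t \<in> {0..T} \<Longrightarrow> s \<le> t \<Longrightarrow> t - s \<le> h \<Longrightarrow> dW (\<rho> s) (\<rho> t) \<le> b"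
    and f: "admissible \<Lambda>' S' f" "0 \<le> \<Lambda>'" "\<Lambda>' * (1 + h * L) ^ k \<le> \<Lambda>" "1 + S' \<le> (1 + S) * (1 - h * C) ^ k"
  shows "\<bar>(LINT x|\<rho> (real k * h). m.smooth f x) - (LINT x|\<rho> 0. m.smooth (\<lambda>x. f (euler K h k x)) x)\<bar>
    \<le> real k * h * err h a b"
  using h(3) f
proof (induction k arbitrary: f \<Lambda>' S')
  case 0
  then show ?case by simp
next
  case (Suc k)
  let ?t = "real k * h" and ?q = "1 + h * L" and ?r = "1 - h * C"
  have t0: "0 \<le> ?t" using h(1) by simp
  have t1: "?t + h \<le> T" using Suc.prems(1) by (simp add: algebra_simps)
  have t: "?t \<in> {0..T}" using t0 t1 h(1) by auto
  have q: "1 \<le> ?q" using h(1) L_nonneg by simp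
  have r: "0 < ?r" "?r \<le> 1" using h C_nonneg by auto
  have "\<Lambda>' * 1 \<le> \<Lambda>' * ?q ^ Suc k"
    by (intro mult_left_mono one_le_power q Suc.prems(3))
  then have \<Lambda>': "\<Lambda>' \<le> \<Lambda>" using Suc.prems(4) by linarith
  have "(1 + S) * ?r ^ Suc k \<le> (1 + S) * 1"
    using S r by (intro mult_left_mono power_le_one) auto
  from order.trans[OF Suc.prems(5) this] have S': "S' \<le> S" by simp
  have adm: "admissible \<Lambda> S f"
    by (rule admissible_mono[OF Suc.prems(2) \<Lambda>' S'])
  define g where "g x = f (step K h ?t x)" for x
  \<comment> \<open>Solves 1 + S' = (1 - h C) (1 + S''), the threshold of
    \<open>step_expansion\<close>.\<close>
  define S'' where "S'' = (1 + S') / ?r - 1"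
  have g: "admissible (\<Lambda>' * ?q) S'' g"
    unfolding admissible_def
  proof (intro conjI allI impI)
    fix x y
    have "\<bar>g x - g y\<bar> \<le> \<Lambda>' * norm (step K h ?t x - step K h ?t y)"
      using Suc.prems(2) by (simp add: g_def admissible_def)
    also have "\<dots> \<le> \<Lambda>' * (?q * norm (x - y))"
      by (intro mult_left_mono step_lipschitz h(1) trunc_lip t Suc.prems(3))
    finally show "\<bar>g x - g y\<bar> \<le> \<Lambda>' * ?q * norm (x - y)" by simp
    show "\<bar>g x\<bar> \<le> 1"
      using Suc.prems(2) by (simp add: g_def admissible_def)
    assume "S'' < norm x"
    then have "1 + S' < ?r * (1 + norm x)"
      using r(1) by (simp add: S''_def pos_divide_less_eq algebra_simps)
    also have "\<dots> \<le> 1 + norm (step K h ?t x)"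
      by (rule step_expansion[OF h(1) K_nonneg t])
    finally show "g x = 0"
      using Suc.prems(2) by (simp add: g_def admissible_def)
  qed
  have "\<bar>(LINT x|\<rho> ?t. m.smooth g x) - (LINT x|\<rho> 0. m.smooth (\<lambda>x. g (euler K h k x)) x)\<bar> \<le> ?t * err h a b"
  proof (rule Suc.IH[OF _ g])
    show "?t \<le> T" using t by simp
    show "0 \<le> \<Lambda>' * ?q" using Suc.prems(3) q by simp
    show "\<Lambda>' * ?q * ?q ^ k \<le> \<Lambda>" using Suc.prems(4) by (simp add: mult_ac)
    show "1 + S'' \<le> (1 + S) * ?r ^ k"
      using Suc.prems(5) r(1) by (simp add: S''_def pos_divide_le_eq mult_ac)
  qed
  moreover have "\<bar>(LINT x|\<rho> (?t + h). m.smooth f x) - (LINT x|\<rho> ?t. m.smooth g x)\<bar> \<le> h * err h a b"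
    unfolding g_def
  proof (rule one_step[OF adm t0 h(1) t1 \<delta>])
    fix s assume "s \<in> {?t..?t + h}"
    then have s: "?t \<le> s" "s \<le> ?t + h" by auto
    have s': "s \<in> {0..T}" using s t0 t1 by (intro atLeastAtMost_iff[THEN iffD2] conjI) linarith+
    show "norm (trunc K s x - trunc K ?t x) \<le> a" for x
      by (rule a[OF s' t]) (use s in linarith)
    show "dW (\<rho> ?t) (\<rho> s) \<le> b"
      by (rule b[OF t s' s(1)]) (use s in linarith)
  qed
  moreover have "real (Suc k) * h = ?t + h" by (simp add: algebra_simps)
  moreover have "(?t + h) * err h a b = ?t * err h a b + h * err h a b" by (simp add: algebra_simps)
  ultimately show ?case
    by (simp add: g_def)
qed

end

text \<open>Four error terms get a quarter of the tolerance each; A + 1 in the denominator covers A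
  = 0.\<close>

lemma small_multiple:
  fixes A e :: real
  assumes "0 \<le> A" "0 < e"
  shows "0 < e / (4 * (A + 1))" "A * (e / (4 * (A + 1))) \<le> e / 4"
  using assms by (auto simp: divide_simps algebra_simps)

context transport
begin

text \<open>Four comparisons are chained: f with its mollification at time t, time t with time 0
  along the steps, mollified with plain pull-back at time 0, and Euler steps with the flow on the
  initial support.\<close>

lemma transport_identity:
  assumes lip: "\<And>x y. \<bar>f x - f y\<bar> \<le> \<Lambda>0 * norm (x - y)" and \<Lambda>0: "0 \<le> \<Lambda>0"
    and bd: "\<And>x. \<bar>f x\<bar> \<le> 1" and supp: "\<And>x. S0 < norm x \<Longrightarrow> f x = 0" and S0: "0 \<le> S0"
    and t: "0 < t" "t \<le> T"
  shows "(LINT x|\<rho> t. f x) = (LINT x|\<rho> 0. f (flow t x))"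
proof -
  have T: "0 < T" using t by simp
  have P2: "\<rho> 0 \<in> P2" "\<rho> t \<in> P2"
    using AC_curve_P2[OF ac] t by auto
  \<comment> \<open>Chosen so that (1 + S) exp (- 2 C T) = 1 + S0: the original support fits however
    many steps are taken.\<close>
  define S where "S = (1 + S0) * exp (2 * C * T) - 1"
  have "1 \<le> exp (2 * C * T)" using C_nonneg T_nonneg by simp
  then have "1 * 1 \<le> (1 + S0) * exp (2 * C * T)"
    using S0 by (intro mult_mono) auto
  then have S: "0 \<le> S" by (simp add: S_def)
  \<comment> \<open>The ball must hold the trajectories from the initial support and the
    \<delta>-neighbourhood of the ball of radius \<open>S\<close>. Requiring \<delta> \<le> 1 keeps
    \<open>K\<close>, and with it \<open>L\<close>, independent of \<delta>.\<close>
  define K where "K = max (exp (C * T) * (1 + \<bar>R\<bar>)) (S + 1)"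
  have K: "0 \<le> K" "S + 1 \<le> K" using S by (auto simp: K_def)
  obtain L where L: "0 < L" "\<And>t x y. t \<in> {0..T} \<Longrightarrow> norm (trunc K t x - trunc K t y) \<le> L * norm (x - y)"
    using trunc_lipschitz[OF K(1)] by blast
  define \<Lambda> where "\<Lambda> = \<Lambda>0 * exp (L * T)"
  have \<Lambda>: "0 \<le> \<Lambda>" using \<Lambda>0 by (simp add: \<Lambda>_def)
  have "\<bar>(LINT x|\<rho> t. f x) - (LINT x|\<rho> 0. f (flow t x))\<bar> \<le> e" if e: "0 < e" for e
  proof -
    \<comment> \<open>All terms of order \<delta>: mollification errors at both ends and the
      accumulated commutator. No quantity in it depends on \<delta>, so \<delta> can be fixed
      now.\<close>
    define A1 where "A1 = \<Lambda>0 + \<Lambda> + T * \<Lambda> * L"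
    have A1: "0 \<le> A1" using \<Lambda>0 \<Lambda> T_nonneg L by (simp add: A1_def)
    define \<delta> where "\<delta> = min 1 (e / (4 * (A1 + 1)))"
    have \<delta>: "0 < \<delta>" "\<delta> \<le> 1" using small_multiple(1)[OF A1 e] by (auto simp: \<delta>_def)
    have "A1 * \<delta> \<le> A1 * (e / (4 * (A1 + 1)))"
      using A1 by (intro mult_left_mono) (auto simp: \<delta>_def)
    then have e1: "A1 * \<delta> \<le> e / 4" using small_multiple(2)[OF A1 e] by linarith
    obtain \<eta> :: "'a \<Rightarrow> real" and G D where moll: "mollifier \<eta> G D \<delta>"
      using mollifier_exists[OF \<delta>(1)] by blast
    interpret m: mollifier \<eta> G D \<delta> by (rule moll)
    define H where "H = m.hessian_bound 1 (cball (0::'a) S)"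
    interpret mt: mollified_transport v T C \<rho> R \<eta> G D \<delta> K L S \<Lambda> H
      by unfold_locales (use K \<delta> L \<Lambda> in \<open>auto simp: H_def\<close>)
    \<comment> \<open>Coefficients of \<open>a\<close>, \<open>b\<close> and \<open>h\<close> in the
      total error. \<open>A3\<close> and \<open>A4\<close> contain \<open>H\<close>, hence depend on
      \<delta>, and are formed only after \<delta> is fixed.\<close>
    define A2 where "A2 = 2 * T * \<Lambda>"
    define A3 where "A3 = T * (H * (C * (1 + K)) + \<Lambda> * L)"
    define A4 where "A4 = T * H * (C * (1 + K))\<^sup>2 + T * \<Lambda> * L * (C * (1 + K))"
    have A2: "0 \<le> A2" using \<Lambda> T_nonneg by (simp add: A2_def)
    have A3: "0 \<le> A3" using \<Lambda> T_nonneg L mt.H_nonneg mt.M_nonneg by (simp add: A3_def)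
    have A4: "0 \<le> A4" using \<Lambda> T_nonneg L mt.H_nonneg mt.M_nonneg by (simp add: A4_def)
    define a where "a = e / (4 * (A2 + 1))"
    define b where "b = e / (4 * (A3 + 1))"
    note a = small_multiple[OF A2 e, folded a_def] and b = small_multiple[OF A3 e, folded b_def]
    obtain d1 where d1: "0 < d1" "\<And>s t x. s \<in> {0..T} \<Longrightarrow> t \<in> {0..T} \<Longrightarrow> \<bar>s - t\<bar> \<le> d1 \<Longrightarrow>
        norm (trunc K s x - trunc K t x) \<le> a"
      using trunc_uniformly_continuous[OF K(1) a(1)] by blast
    obtain d2 where d2: "0 < d2" "\<And>s t. s \<in> {0..T} \<Longrightarrow> t \<in> {0..T} \<Longrightarrow> s \<le> t \<Longrightarrow> t - s \<le> d2 \<Longrightarrow> dW (\<rho> s) (\<rho> t) \<le> b"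
      using AC_curve_modulus[OF ac b(1)] by blast
    \<comment> \<open>The last entry guarantees h C \<le> 1/2, the range of
      \<open>exp_le_one_minus\<close>.\<close>
    define hm where "hm = min (min d1 d2) (min (e / (4 * (A4 + 1))) (1 / (2 * (C + 1))))"
    have hm: "0 < hm" using d1(1) d2(1) small_multiple(1)[OF A4 e] C_nonneg by (simp add: hm_def)
    obtain n where n: "t / hm < real n" using reals_Archimedean2 by blast
    have n0: "0 < real n" using n hm t by (meson divide_pos_pos less_trans)
    \<comment> \<open>The step divides t exactly, so the scheme ends at t without a
      remainder.\<close>
    define h where "h = t / real n"
    have h: "0 < h" "h \<le> hm" "real n * h = t"
      using n n0 t hm by (auto simp: h_def divide_simps mult.commute)
    have hd: "h \<le> d1" "h \<le> d2" "h \<le> e / (4 * (A4 + 1))" "h \<le> 1 / (2 * (C + 1))"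
      using h(2) by (auto simp: hm_def)
    have "A4 * h \<le> A4 * (e / (4 * (A4 + 1)))"
      using A4 hd(3) by (intro mult_left_mono) auto
    then have e4: "A4 * h \<le> e / 4" using small_multiple(2)[OF A4 e] by linarith
    have "h * C \<le> 1 / (2 * (C + 1)) * C"
      using hd(4) C_nonneg by (intro mult_right_mono) auto
    also have "\<dots> \<le> 1 / 2" using C_nonneg by (simp add: divide_simps)
    finally have hC: "h * C \<le> 1 / 2" .
    have a': "norm (trunc K s x - trunc K t x) \<le> a"
      if "s \<in> {0..T}" "t \<in> {0..T}" "\<bar>s - t\<bar> \<le> h" for s t x
      using d1(2)[OF that(1,2)] that(3) hd(1) by simp
    have b': "dW (\<rho> s) (\<rho> t) \<le> b" if "s \<in> {0..T}" "t \<in> {0..T}" "s \<le> t" "t - s \<le> h" for s t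
      using d2(2)[OF that(1-3)] that(4) hd(2) by simp
    have "(1 + h * L) ^ n \<le> exp (h * L) ^ n"
      using h(1) L(1) by (intro power_mono) auto
    also have "\<dots> = exp (L * t)"
      using h(3) by (simp add: exp_of_nat_mult[symmetric] mult_ac)
    also have "\<dots> \<le> exp (L * T)" using L(1) t by simp
    finally have pow: "(1 + h * L) ^ n \<le> exp (L * T)" .
    have "exp (- 2 * C * T) \<le> exp (- 2 * C * t)"
      using C_nonneg t by (simp add: mult_left_mono)
    also have "\<dots> = exp (- 2 * (h * C)) ^ n"
      using h(3) by (simp add: exp_of_nat_mult[symmetric] mult_ac)
    also have "\<dots> \<le> (1 - h * C) ^ n"
      using h(1) C_nonneg hC by (intro power_mono exp_le_one_minus) auto
    finally have "(1 + S) * exp (- 2 * C * T) \<le> (1 + S) * (1 - h * C) ^ n"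
      using S by (intro mult_left_mono) auto
    then have suppn: "1 + S0 \<le> (1 + S) * (1 - h * C) ^ n"
      by (simp add: S_def mult.assoc mult_exp_exp)
    let ?F = "\<lambda>x. f (euler K h n x)"
    have lipn: "\<Lambda>0 * (1 + h * L) ^ n \<le> \<Lambda>"
      unfolding \<Lambda>_def by (intro mult_left_mono pow \<Lambda>0)
    have F_lip: "\<bar>?F x - ?F y\<bar> \<le> \<Lambda> * norm (x - y)" for x y
    proof -
      have "\<bar>?F x - ?F y\<bar> \<le> \<Lambda>0 * norm (euler K h n x - euler K h n y)" by (rule lip)
      also have "\<dots> \<le> \<Lambda>0 * ((1 + h * L) ^ n * norm (x - y))"
        using h t L by (intro mult_left_mono \<Lambda>0 euler_lipschitz) auto
      also have "\<dots> \<le> \<Lambda> * norm (x - y)"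
        using mult_right_mono[OF lipn norm_ge_zero] by (simp add: mult_ac)
      finally show ?thesis .
    qed
    have fm: "f \<in> borel_measurable borel" by (rule lipschitz_imp_borel(2)[OF lip])
    have Fm: "?F \<in> borel_measurable borel" by (rule lipschitz_imp_borel(2)[OF F_lip])
    have sm: "m.smooth g \<in> borel_measurable borel" "\<And>x. \<bar>m.smooth g x\<bar> \<le> 1" "\<And>x. \<bar>m.smooth g x - g x\<bar> \<le> L' * \<delta>"
      if g: "\<And>x y. \<bar>g x - g y\<bar> \<le> L' * norm (x - y)" "\<And>x. \<bar>g x\<bar> \<le> 1" "0 \<le> L'" for g L'
    proof -
      note gm = lipschitz_imp_borel(2)[OF g(1)]
      show "m.smooth g \<in> borel_measurable borel"
        by (rule lipschitz_imp_borel(2)[OF m.smooth_lipschitz[OF gm g(2,1)]])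
      show "\<bar>m.smooth g x\<bar> \<le> 1" for x
        by (rule m.smooth_abs_le[OF gm g(2)])
      show "\<bar>m.smooth g x - g x\<bar> \<le> L' * \<delta>" for x
      proof (rule m.smooth_minus_self[OF gm g(2)])
        fix z :: 'a assume "norm z \<le> \<delta>"
        then have "L' * norm z \<le> L' * \<delta>" using g(3) by (rule mult_left_mono)
        then show "\<bar>g (x - z) - g x\<bar> \<le> L' * \<delta>" using g(1)[of "x - z" x] by simp
      qed
    qed
    note sf = sm[OF lip bd \<Lambda>0] and sF = sm[OF F_lip bd \<Lambda>]
    have I1: "\<bar>(LINT x|\<rho> t. m.smooth f x) - (LINT x|\<rho> 0. m.smooth ?F x)\<bar> \<le> t * mt.err h a b"
    proof -
      have "mt.admissible \<Lambda>0 S0 f"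
        using lip bd supp by (auto simp: mt.admissible_def)
      then show ?thesis
        using mt.multi_step[of h n a b \<Lambda>0 S0 f] h hC t S \<delta> a' b' \<Lambda>0 lipn suppn by simp
    qed
    have I2: "\<bar>(LINT x|\<rho> t. m.smooth f x) - (LINT x|\<rho> t. f x)\<bar> \<le> \<Lambda>0 * \<delta>"
      by (rule P2_integral_diff_le[OF P2(2) sf(1,2) fm bd]) (use sf(3) in auto)
    have I3: "\<bar>(LINT x|\<rho> 0. m.smooth ?F x) - (LINT x|\<rho> 0. ?F x)\<bar> \<le> \<Lambda> * \<delta>"
      by (rule P2_integral_diff_le[OF P2(1) sF(1,2) Fm bd]) (use sF(3) in auto)
    let ?E = "a + L * (C * (1 + K) * h)"
    have E: "0 \<le> ?E" using a(1) L mt.M_nonneg h(1) by simp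
    have I4: "\<bar>(LINT x|\<rho> 0. ?F x) - (LINT x|\<rho> 0. f (flow t x))\<bar> \<le> T * \<Lambda> * ?E"
    proof (rule P2_integral_diff_le[OF P2(1) Fm bd _ bd])
      have "continuous_on UNIV (\<lambda>x. f (flow t x))"
        using t by (intro continuous_on_compose2[OF lipschitz_imp_borel(1)[OF lip] flow_continuous]) auto
      then show "(\<lambda>x. f (flow t x)) \<in> borel_measurable borel"
        by (rule borel_measurable_continuous_onI)
      show "AE x in \<rho> 0. \<bar>?F x - f (flow t x)\<bar> \<le> T * \<Lambda> * ?E"
        using initial_bounded
      proof eventually_elim
        fix x :: 'a assume x: "norm x \<le> R"
        have inK: "flow s x \<in> cball 0 K" if "s \<in> {0..T}" for s
        proof -
          have "norm x \<le> \<bar>R\<bar>" using x by linarith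
          from solution_bounded[OF flow_solves that this] show ?thesis
            by (simp add: K_def le_max_iff_disj)
        qed
        have "norm (euler K h n x - flow t x) \<le> t * ?E * (1 + h * L) ^ n"
          using euler_error[OF flow_solves inK K(1) less_imp_le[OF L(1)] L(2), where h=h and m=n and a=a] h t a' by simp
        then have "\<Lambda>0 * norm (euler K h n x - flow t x) \<le> \<Lambda>0 * (t * ?E * (1 + h * L) ^ n)"
          using \<Lambda>0 by (rule mult_left_mono)
        also have "\<dots> = (\<Lambda>0 * (1 + h * L) ^ n) * (t * ?E)" by (simp add: mult_ac)
        also have "\<dots> \<le> \<Lambda> * (T * ?E)"
          using lipn t E \<Lambda> by (intro mult_mono) auto
        finally show "\<bar>?F x - f (flow t x)\<bar> \<le> T * \<Lambda> * ?E"
          using lip[of "euler K h n x" "flow t x"] by (simp add: mult_ac)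
      qed
    qed
    have "0 \<le> mt.err h a b"
      using a(1) b(1) h(1) \<delta>(1) by (intro mt.err_nonneg) auto
    then have "t * mt.err h a b \<le> T * mt.err h a b"
      using t by (intro mult_right_mono) auto
    then have "\<bar>(LINT x|\<rho> t. f x) - (LINT x|\<rho> 0. f (flow t x))\<bar>
        \<le> \<Lambda>0 * \<delta> + T * mt.err h a b + \<Lambda> * \<delta> + T * \<Lambda> * ?E"
      using I1 I2 I3 I4 by linarith
    \<comment> \<open>The factor 2 in \<open>A2\<close> arises because \<open>a\<close> is charged
      twice, in \<open>err\<close> and in the Euler error.\<close>
    also have "\<dots> = A1 * \<delta> + A2 * a + A3 * b + A4 * h"
      by (simp add: mt.err_def A1_def A2_def A3_def A4_def algebra_simps)
    also have "\<dots> \<le> e" using e1 a(2) b(2) e4 by linarith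
    finally show ?thesis .
  qed
  then show ?thesis
    using field_le_epsilon[of "\<bar>(LINT x|\<rho> t. f x) - (LINT x|\<rho> 0. f (flow t x))\<bar>" 0] by simp
qed

theorem flow_pushforward:
  assumes t: "t \<in> {0..T}"
  shows "is_pushforward (flow t) (\<rho> 0) (\<rho> t)"
proof -
  have P2: "\<rho> 0 \<in> P2" "\<rho> t \<in> P2"
    using AC_curve_P2[OF ac] t by auto
  have fl: "flow t \<in> borel_measurable borel"
    by (rule borel_measurable_continuous_onI[OF flow_continuous[OF t]])
  then have fl': "flow t \<in> \<rho> 0 \<rightarrow>\<^sub>M borel"
    by (simp cong: measurable_cong_sets add: P2_sets[OF P2(1)])
  have "\<rho> t = distr (\<rho> 0) borel (flow t)"
  proof (rule borel_prob_eqI_lipschitz)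
    show "prob_space (\<rho> t)" "sets (\<rho> t) = sets borel" using P2 by (auto simp: P2_prob P2_sets)
    show "prob_space (distr (\<rho> 0) borel (flow t))"
      by (rule prob_space.prob_space_distr[OF P2_prob[OF P2(1)] fl'])
    show "sets (distr (\<rho> 0) borel (flow t)) = sets borel" by simp
    fix f :: "'a \<Rightarrow> real" and L S
    assume lip: "\<And>x y. \<bar>f x - f y\<bar> \<le> L * norm (x - y)" and bd: "\<And>x. \<bar>f x\<bar> \<le> 1"
      and supp: "\<And>x. S < norm x \<Longrightarrow> f x = 0"
    have "(LINT x|\<rho> t. f x) = (LINT x|\<rho> 0. f (flow t x))"
    \<comment> \<open>At t = 0 there is no step to take, and the flow is the identity.\<close>
    proof (cases "t = 0")
      case True
      have "flow 0 x = x" for x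
        using flow_solves[of x] by (simp add: solves_ode_from_def)
      then show ?thesis using True by simp
    next
      case False
      show ?thesis
      proof (rule transport_identity[where ?\<Lambda>0.0="\<bar>L\<bar>" and ?S0.0="\<bar>S\<bar>"])
        show "\<bar>f x - f y\<bar> \<le> \<bar>L\<bar> * norm (x - y)" for x y
          by (rule order.trans[OF lip mult_right_mono]) auto
      qed (use False t bd supp in auto)
    qed
    then show "(LINT x|\<rho> t. f x) = (LINT x|distr (\<rho> 0) borel (flow t). f x)"
      by (subst integral_distr[OF fl' lipschitz_imp_borel(2)[OF lip]])
  qed
  with fl show ?thesis by (simp add: is_pushforward_def)
qed

end

section \<open>Velocity fields of logarithmic convolution type\<close>

lemma abs_ln_diff_le:
  fixes a b c :: real
  assumes "0 < c" "c \<le> a" "c \<le> b"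
  shows "\<bar>ln a - ln b\<bar> \<le> \<bar>a - b\<bar> / c"
proof -
  have *: "ln x - ln y \<le> \<bar>x - y\<bar> / c" if "c \<le> x" "c \<le> y" for x y
  proof -
    have "ln x - ln y \<le> (x - y) / y"
      using assms(1) that by (intro ln_diff_le) auto
    also have "\<dots> \<le> \<bar>x - y\<bar> / c"
      using assms(1) that by (intro frac_le) auto
    finally show ?thesis .
  qed
  show ?thesis using *[of a b] *[of b a] assms by (auto simp: abs_le_iff abs_minus_commute)
qed

text \<open>The complement of the support is a union of open null sets; by the Lindelof property
  countably many of them already cover it.\<close>

lemma AE_in_measure_support:
  fixes \<mu> :: "'a::euclidean_space measure"
  assumes "sets \<mu> = sets borel"
  shows "AE x in \<mu>. x \<in> measure_support \<mu>"
proof -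
  define F where "F = {U::'a set. open U \<and> emeasure \<mu> U = 0}"
  obtain F' where F': "F' \<subseteq> F" "countable F'" "\<Union>F' = \<Union>F"
    using Lindelof[of F] by (auto simp: F_def)
  have "(\<Union>U\<in>F'. U) \<in> null_sets \<mu>"
    using F'(1,2) assms by (intro null_sets_UN') (auto simp: F_def null_sets_def)
  moreover have "- measure_support \<mu> = \<Union>F"
    by (auto simp: measure_support_def F_def not_gr_zero)
  ultimately have "- measure_support \<mu> \<in> null_sets \<mu>"
    using F'(3) by simp
  then show ?thesis by (auto intro: AE_I')
qed

lemma closed_measure_support: "closed (measure_support \<mu>)"
proof -
  have "- measure_support \<mu> = \<Union>{U. open U \<and> emeasure \<mu> U = 0}"
    by (auto simp: measure_support_def not_gr_zero)
  then show ?thesis by (simp add: closed_def open_Union)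
qed

lemma measure_support_subset:
  assumes \<mu>: "sets \<mu> = sets borel" and S: "closed S" and AE: "AE x in \<mu>. x \<in> S"
  shows "measure_support \<mu> \<subseteq> S"
proof
  fix x assume x: "x \<in> measure_support \<mu>"
  show "x \<in> S"
  proof (rule ccontr)
    assume "x \<notin> S"
    then have "0 < emeasure \<mu> (- S)"
      using x S by (auto simp: measure_support_def closed_def)
    moreover have "emeasure \<mu> (- S) = 0"
      using AE S \<mu> sets_eq_imp_space_eq[OF \<mu>]
      by (subst (asm) AE_iff_measurable[where N="- S"]) (auto simp: borel_open)
    ultimately show False by simp
  qed
qed

lemma pushforward_AE:
  assumes "is_pushforward X \<mu> \<nu>" "sets \<mu> = sets borel" "closed S" "AE x in \<mu>. X x \<in> S"
  shows "measure_support \<nu> \<subseteq> S"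
proof -
  have X: "X \<in> \<mu> \<rightarrow>\<^sub>M borel" and \<nu>: "\<nu> = distr \<mu> borel X"
    using assms(1,2) by (auto simp: is_pushforward_def cong: measurable_cong_sets)
  show ?thesis
    unfolding \<nu> using assms(3,4)
    by (intro measure_support_subset) (simp_all add: AE_distr_iff[OF X])
qed

lemma grad_rescale:
  fixes V :: "'a::euclidean_space \<Rightarrow> real"
  assumes "V differentiable (at (x /\<^sub>R \<epsilon>))"
  shows "(rescale V \<epsilon> has_derivative (\<lambda>h. (grad V (x /\<^sub>R \<epsilon>) /\<^sub>R \<epsilon> ^ (DIM('a) + 1)) \<bullet> h)) (at x)"
    and "grad (rescale V \<epsilon>) x = grad V (x /\<^sub>R \<epsilon>) /\<^sub>R \<epsilon> ^ (DIM('a) + 1)"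
proof -
  have "((\<lambda>x. x /\<^sub>R \<epsilon>) has_derivative (\<lambda>h. h /\<^sub>R \<epsilon>)) (at x)"
    by (auto intro!: derivative_eq_intros)
  from has_derivative_compose[OF this has_derivative_grad[OF assms]]
  have "((\<lambda>x. inverse (\<epsilon> ^ DIM('a)) * V (x /\<^sub>R \<epsilon>)) has_derivative
      (\<lambda>h. inverse (\<epsilon> ^ DIM('a)) * (grad V (x /\<^sub>R \<epsilon>) \<bullet> (h /\<^sub>R \<epsilon>)))) (at x)"
    by (rule has_derivative_mult_right)
  then show *: "(rescale V \<epsilon> has_derivative (\<lambda>h. (grad V (x /\<^sub>R \<epsilon>) /\<^sub>R \<epsilon> ^ (DIM('a) + 1)) \<bullet> h)) (at x)"
    unfolding rescale_def[abs_def] by (simp add: divide_inverse mult_ac)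
  show "grad (rescale V \<epsilon>) x = grad V (x /\<^sub>R \<epsilon>) /\<^sub>R \<epsilon> ^ (DIM('a) + 1)"
    by (rule grad_eqI[OF *])
qed

lemma lborel_integral_rescale:
  fixes f :: "'a::euclidean_space \<Rightarrow> real"
  assumes "0 < \<epsilon>" "f \<in> borel_measurable borel"
  shows "(LINT z|lborel. f (z /\<^sub>R \<epsilon>)) = \<epsilon> ^ DIM('a) * (LINT z|lborel. f z)"
    and "integrable lborel (\<lambda>z. f (z /\<^sub>R \<epsilon>)) \<longleftrightarrow> integrable lborel f"
proof -
  have "(\<lambda>z. f (z /\<^sub>R \<epsilon>)) \<in> borel_measurable borel"
    using assms(2) by measurable
  from lborel_integral_affine[of \<epsilon>, OF _ this, of 0]
  show "(LINT z|lborel. f (z /\<^sub>R \<epsilon>)) = \<epsilon> ^ DIM('a) * (LINT z|lborel. f z)"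
    and "integrable lborel (\<lambda>z. f (z /\<^sub>R \<epsilon>)) \<longleftrightarrow> integrable lborel f"
    using assms(1) by simp_all
qed

text \<open>\<open>\<l>\<close> is the logarithm of a density and \<open>G\<close> the gradient of a
  kernel. The moment of \<open>G\<close> tames the linear growth of \<open>\<l>\<close>. The
  Lipschitz condition only looks at points shifted by z with \<open>G z \<noteq> 0\<close>, which
  fits two situations: a compactly supported \<open>G\<close> with \<open>\<l>\<close> Lipschitz on
  balls, and an arbitrary \<open>G\<close> with \<open>\<l>\<close> Lipschitz everywhere.\<close>

locale log_convolution =
  fixes \<l> :: "real \<Rightarrow> 'a::euclidean_space \<Rightarrow> real" and G :: "'a \<Rightarrow> 'a" and T A B :: real
  assumes \<l>_continuous: "\<And>t. t \<in> {0..T} \<Longrightarrow> continuous_on UNIV (\<l> t)"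
    and \<l>_time: "\<And>y. continuous_on {0..T} (\<lambda>t. \<l> t y)"
    and \<l>_growth: "\<And>t y. t \<in> {0..T} \<Longrightarrow> \<bar>\<l> t y\<bar> \<le> A + B * norm y"
    and B_nonneg: "0 \<le> B"
    and G_continuous: "continuous_on UNIV G"
    and G_moment: "integrable lborel (\<lambda>z. (1 + norm z) * norm (G z))"
    and \<l>_lipschitz: "\<And>K. \<exists>\<Lambda>. \<forall>t\<in>{0..T}. \<forall>x\<in>cball 0 K. \<forall>y\<in>cball 0 K. \<forall>z. G z \<noteq> 0 \<longrightarrow>
      \<bar>\<l> t (x - z) - \<l> t (y - z)\<bar> \<le> \<Lambda> * norm (x - y)"
begin

definition drift :: "real \<Rightarrow> 'a \<Rightarrow> 'a" where
  "drift t x = (LINT y|lborel. \<l> t y *\<^sub>R G (x - y))"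

lemma measurable_integrand:
  assumes "t \<in> {0..T}"
  shows "(\<lambda>z. \<l> t (x - z) *\<^sub>R G z) \<in> borel_measurable borel"
  using assms by (intro borel_measurable_continuous_onI continuous_intros G_continuous
      continuous_on_compose2[OF \<l>_continuous]) auto

lemma dominated:
  assumes "t \<in> {0..T}"
  shows "norm (\<l> t (x - z) *\<^sub>R G z) \<le> (\<bar>A\<bar> + B * norm x + B) * ((1 + norm z) * norm (G z))"
proof -
  have "\<bar>\<l> t (x - z)\<bar> \<le> A + B * norm (x - z)"
    by (rule \<l>_growth[OF assms])
  also have "\<dots> \<le> \<bar>A\<bar> + B * (norm x + norm z)"
    using B_nonneg norm_triangle_ineq4[of x z] by (intro add_mono mult_left_mono) auto
  also have "\<dots> \<le> (\<bar>A\<bar> + B * norm x + B) * (1 + norm z)"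
    using B_nonneg by (simp add: algebra_simps)
  finally have "\<bar>\<l> t (x - z)\<bar> * norm (G z) \<le> (\<bar>A\<bar> + B * norm x + B) * (1 + norm z) * norm (G z)"
    by (intro mult_right_mono) auto
  then show ?thesis by (simp add: mult.assoc)
qed

lemma integrable_integrand:
  assumes "t \<in> {0..T}"
  shows "integrable lborel (\<lambda>z. \<l> t (x - z) *\<^sub>R G z)"
proof (rule Bochner_Integration.integrable_bound[OF integrable_mult_right[OF G_moment, of "\<bar>A\<bar> + B * norm x + B"]])
  show "(\<lambda>z. \<l> t (x - z) *\<^sub>R G z) \<in> borel_measurable lborel"
    using measurable_integrand[OF assms] by simp
  show "AE z in lborel. norm (\<l> t (x - z) *\<^sub>R G z) \<le> norm ((\<bar>A\<bar> + B * norm x + B) * ((1 + norm z) * norm (G z)))"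
    by (rule AE_I2) (rule order.trans[OF dominated[OF assms]], simp only: real_norm_def abs_ge_self)
qed

lemma integrable_G: "integrable lborel G"
proof (rule Bochner_Integration.integrable_bound[OF G_moment])
  show "G \<in> borel_measurable lborel"
    using borel_measurable_continuous_onI[OF G_continuous] by simp
  show "AE z in lborel. norm (G z) \<le> norm ((1 + norm z) * norm (G z))"
    by (intro AE_I2) (simp add: abs_mult mult_le_cancel_right1 algebra_simps)
qed

lemma drift_eq: "t \<in> {0..T} \<Longrightarrow> drift t x = (LINT z|lborel. \<l> t (x - z) *\<^sub>R G z)"
  unfolding drift_def using lborel_integral_reflect[OF measurable_integrand, of t x x] by simp

text \<open>Dominated convergence along sequences of times; the majorant depends on x but not on
  t.\<close>

lemma drift_time: "continuous_on {0..T} (\<lambda>t. drift t x)"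
  unfolding continuous_on_sequentially
proof (intro allI ballI impI, elim conjE)
  fix X :: "nat \<Rightarrow> real" and t
  assume t: "t \<in> {0..T}" and X: "\<forall>n. X n \<in> {0..T}" "X \<longlonglongrightarrow> t"
  have "(\<lambda>n. LINT z|lborel. \<l> (X n) (x - z) *\<^sub>R G z) \<longlonglongrightarrow> (LINT z|lborel. \<l> t (x - z) *\<^sub>R G z)"
  proof (rule integral_dominated_convergence[OF _ _ integrable_mult_right[OF G_moment, of "\<bar>A\<bar> + B * norm x + B"]])
    show "(\<lambda>z. \<l> t (x - z) *\<^sub>R G z) \<in> borel_measurable lborel"
      using measurable_integrand[OF t] by simp
    show "(\<lambda>z. \<l> (X n) (x - z) *\<^sub>R G z) \<in> borel_measurable lborel" for n
      using measurable_integrand X(1) by simp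
    show "AE z in lborel. (\<lambda>n. \<l> (X n) (x - z) *\<^sub>R G z) \<longlonglongrightarrow> \<l> t (x - z) *\<^sub>R G z"
    proof (intro AE_I2 tendsto_scaleR tendsto_const)
      show "(\<lambda>n. \<l> (X n) (x - z)) \<longlonglongrightarrow> \<l> t (x - z)" for z
        using \<l>_time[of "x - z"] t X unfolding continuous_on_sequentially comp_def by blast
    qed
    show "AE z in lborel. norm (\<l> (X n) (x - z) *\<^sub>R G z) \<le> (\<bar>A\<bar> + B * norm x + B) * ((1 + norm z) * norm (G z))" for n
      using dominated X(1) by (intro AE_I2) blast
  qed
  then show "((\<lambda>t. drift t x) \<circ> X) \<longlonglongrightarrow> drift t x"
    using t X(1) by (simp add: comp_def drift_eq)
qed

lemma integral_scaleR_G_le: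
  assumes h: "integrable lborel (\<lambda>z. h z *\<^sub>R G z)" and Q: "\<And>z. G z \<noteq> 0 \<Longrightarrow> \<bar>h z\<bar> \<le> Q"
  shows "norm (LINT z|lborel. h z *\<^sub>R G z) \<le> Q * (LINT z|lborel. norm (G z))"
proof -
  have "norm (LINT z|lborel. h z *\<^sub>R G z) \<le> (LINT z|lborel. norm (h z *\<^sub>R G z))"
    by (rule integral_norm_bound)
  also have "\<dots> \<le> (LINT z|lborel. Q * norm (G z))"
  proof (rule integral_mono)
    show "norm (h z *\<^sub>R G z) \<le> Q * norm (G z)" for z
      using Q[of z] by (cases "G z = 0") (auto intro: mult_right_mono)
    show "integrable lborel (\<lambda>z. norm (h z *\<^sub>R G z))"
      by (rule integrable_norm[OF h])
  qed (use integrable_G in auto)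
  finally show ?thesis by simp
qed

lemma drift_local_lipschitz:
  "\<exists>L\<ge>0. \<forall>t\<in>{0..T}. \<forall>x\<in>cball 0 K. \<forall>y\<in>cball 0 K. norm (drift t x - drift t y) \<le> L * norm (x - y)"
proof -
  obtain \<Lambda> where \<Lambda>: "\<And>t x y z. t \<in> {0..T} \<Longrightarrow> x \<in> cball 0 K \<Longrightarrow> y \<in> cball 0 K \<Longrightarrow> G z \<noteq> 0 \<Longrightarrow>
      \<bar>\<l> t (x - z) - \<l> t (y - z)\<bar> \<le> \<Lambda> * norm (x - y)"
    using \<l>_lipschitz[of K] by blast
  let ?I = "LINT z|lborel. norm (G z)"
  have "norm (drift t x - drift t y) \<le> (\<bar>\<Lambda>\<bar> * ?I) * norm (x - y)"
    if t: "t \<in> {0..T}" and xy: "x \<in> cball 0 K" "y \<in> cball 0 K" for t x y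
  proof -
    have "drift t x - drift t y = (LINT z|lborel. (\<l> t (x - z) - \<l> t (y - z)) *\<^sub>R G z)"
      using integrable_integrand[OF t] by (simp add: drift_eq[OF t] scaleR_diff_left)
    also have "norm \<dots> \<le> (\<Lambda> * norm (x - y)) * ?I"
      using integrable_integrand[OF t, of x] integrable_integrand[OF t, of y]
      by (intro integral_scaleR_G_le \<Lambda>[OF t xy]) (simp_all add: scaleR_diff_left)
    also have "\<dots> \<le> (\<bar>\<Lambda>\<bar> * norm (x - y)) * ?I"
      by (intro mult_right_mono integral_nonneg) auto
    finally show ?thesis by (simp add: mult_ac)
  qed
  moreover have "0 \<le> \<bar>\<Lambda>\<bar> * ?I" by simp
  ultimately show ?thesis by blast
qed

lemma drift_le:
  assumes "t \<in> {0..T}" "\<And>z. G z \<noteq> 0 \<Longrightarrow> \<bar>\<l> t (x - z)\<bar> \<le> Q"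
  shows "norm (drift t x) \<le> Q * (LINT z|lborel. norm (G z))"
  unfolding drift_eq[OF assms(1)] by (intro integral_scaleR_G_le integrable_integrand assms)

lemma scaled_drift_linear_growth:
  assumes "0 \<le> T" "\<bar>c\<bar> \<le> 1" "\<And>t x. t \<in> {0..T} \<Longrightarrow> norm (drift t x) \<le> C * jap x"
  shows "linear_growth_field (\<lambda>t x. c *\<^sub>R drift t x) T C"
proof
  show "continuous_on {0..T} (\<lambda>t. c *\<^sub>R drift t x)" for x
    by (intro continuous_intros drift_time)
  have le: "norm (c *\<^sub>R w) \<le> norm w" for w :: 'a
    using assms(2) by (simp add: mult_left_le_one_le)
  show "\<exists>L\<ge>0. \<forall>t\<in>{0..T}. \<forall>x\<in>cball 0 K. \<forall>y\<in>cball 0 K.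
      norm (c *\<^sub>R drift t x - c *\<^sub>R drift t y) \<le> L * norm (x - y)" for K
    using drift_local_lipschitz[of K] order.trans[OF le] by (metis scaleR_diff_right)
  show "norm (c *\<^sub>R drift t x) \<le> C * jap x" if "t \<in> {0..T}" for t x
    by (rule order.trans[OF le assms(3)[OF that]])
qed (rule assms(1))

end

section \<open>Densities along an absolutely continuous curve of measures\<close>

locale density_curve =
  fixes W :: "'a::euclidean_space \<Rightarrow> real" and \<rho> :: "real \<Rightarrow> 'a measure" and T Bw Lw :: real
  assumes ac: "AC_curve T \<rho>"
    and W_nonneg: "\<And>x. 0 \<le> W x" and W_le: "\<And>x. W x \<le> Bw"
    and W_lipschitz: "\<And>x y. \<bar>W x - W y\<bar> \<le> Lw * norm (x - y)"
begin

definition conv :: "real \<Rightarrow> 'a \<Rightarrow> real" where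
  "conv t y = (LINT z|\<rho> t. W (y - z))"

lemma P2_\<rho>: "t \<in> {0..T} \<Longrightarrow> \<rho> t \<in> P2"
  by (rule AC_curve_P2[OF ac])

lemma shift_lipschitz: "\<bar>W (y - z) - W (y - z')\<bar> \<le> Lw * norm (z - z')"
  using W_lipschitz[of "y - z" "y - z'"] by (simp add: norm_minus_commute)

lemma W_bound: "\<bar>W x\<bar> \<le> Bw"
  using W_nonneg[of x] W_le[of x] by simp

lemma shift_measurable: "(\<lambda>z. W (y - z)) \<in> borel_measurable borel"
  by (rule lipschitz_imp_borel(2)[OF shift_lipschitz])

lemma shift_integrable: "t \<in> {0..T} \<Longrightarrow> integrable (\<rho> t) (\<lambda>z. W (y - z))"
  using W_bound by (intro P2_integrable_bounded[OF P2_\<rho> shift_measurable]) auto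

lemma conv_nonneg: "0 \<le> conv t y"
  unfolding conv_def by (simp add: W_nonneg)

lemma conv_le: "t \<in> {0..T} \<Longrightarrow> conv t y \<le> Bw"
  using P2_norm_integral_le[OF P2_\<rho> shift_measurable, of t y Bw] W_bound by (auto simp: conv_def)

lemma conv_lipschitz:
  assumes "t \<in> {0..T}"
  shows "\<bar>conv t x - conv t y\<bar> \<le> Lw * norm (x - y)"
proof -
  have "conv t x - conv t y = (LINT z|\<rho> t. W (x - z) - W (y - z))"
    using assms by (simp add: conv_def shift_integrable)
  moreover have "\<bar>W (x - z) - W (y - z)\<bar> \<le> Lw * norm (x - y)" for z
    using W_lipschitz[of "x - z" "y - z"] by simp
  ultimately show ?thesis
    using P2_norm_integral_le[OF P2_\<rho>[OF assms], of "\<lambda>z. W (x - z) - W (y - z)" "Lw * norm (x - y)"]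
    by (simp add: borel_measurable_diff shift_measurable)
qed

text \<open>For fixed y the shifted kernel is a bounded Lipschitz test function, so its integral
  inherits continuity from the curve.\<close>

lemma conv_time: "continuous_on {0..T} (\<lambda>t. conv t y)"
  unfolding conv_def by (rule AC_curve_integral_continuous[OF ac shift_lipschitz W_bound shift_measurable])

end

lemma N1_lower:
  assumes "norm (y::'a::euclidean_space) \<le> K"
  shows "exp (- (1 + K)) / Z1 TYPE('a) \<le> N1 y"
  unfolding N1_eq using jap_le[of y] assms Z1_pos[where 'a='a] by (intro divide_right_mono) auto

locale regularised_curve = density_curve W \<rho> T Bw Lw
  for W :: "'a::euclidean_space \<Rightarrow> real" and \<rho> T Bw Lw +
  fixes \<sigma> r :: real
  assumes \<sigma>: "0 < \<sigma>" "\<sigma> < 1"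
    and grad_W_continuous: "continuous_on UNIV (grad W)"
    and grad_W_supp: "\<And>z. r < norm z \<Longrightarrow> grad W z = 0"
begin

definition dens :: "real \<Rightarrow> 'a \<Rightarrow> real" where
  "dens t y = (1 - \<sigma>) * conv t y + \<sigma> * N1 y"

lemma dens_lower: "\<sigma> * N1 y \<le> dens t y"
  using \<sigma> conv_nonneg[of t y] by (simp add: dens_def)

lemma dens_pos: "0 < dens t y"
  using dens_lower[of y t] N1_pos[of y] \<sigma> by (meson less_le_trans mult_pos_pos)

lemma dens_upper:
  assumes "t \<in> {0..T}"
  shows "dens t y \<le> Bw + 1 / Z1 TYPE('a)"
proof -
  have "(1 - \<sigma>) * conv t y \<le> 1 * Bw"
    using \<sigma> conv_nonneg[of t y] conv_le[OF assms] by (intro mult_mono) auto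
  moreover have "\<sigma> * N1 y \<le> 1 * (1 / Z1 TYPE('a))"
    using \<sigma> N1_pos[of y] N1_le[of y] by (intro mult_mono) auto
  ultimately show ?thesis unfolding dens_def by linarith
qed

lemma dens_lipschitz:
  assumes "t \<in> {0..T}"
  shows "\<bar>dens t x - dens t y\<bar> \<le> (Lw + 1 / Z1 TYPE('a)) * norm (x - y)"
proof -
  have "(1 - \<sigma>) * \<bar>conv t x - conv t y\<bar> \<le> 1 * (Lw * norm (x - y))"
    using \<sigma> by (intro mult_mono conv_lipschitz assms) auto
  moreover have "\<sigma> * \<bar>N1 x - N1 y\<bar> \<le> 1 * (1 / Z1 TYPE('a) * norm (x - y))"
    using \<sigma> by (intro mult_mono N1_lipschitz) auto
  moreover have "\<bar>dens t x - dens t y\<bar> \<le> (1 - \<sigma>) * \<bar>conv t x - conv t y\<bar> + \<sigma> * \<bar>N1 x - N1 y\<bar>"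
  proof -
    have "dens t x - dens t y = (1 - \<sigma>) * (conv t x - conv t y) + \<sigma> * (N1 x - N1 y)"
      by (simp add: dens_def algebra_simps)
    then show ?thesis
      using \<sigma> abs_triangle_ineq[of "(1 - \<sigma>) * (conv t x - conv t y)" "\<sigma> * (N1 x - N1 y)"]
      by (simp add: abs_mult)
  qed
  ultimately show ?thesis by (simp add: distrib_right)
qed

lemma ln_dens_growth:
  assumes "t \<in> {0..T}"
  shows "\<bar>ln (dens t y)\<bar> \<le> \<bar>ln \<sigma>\<bar> + \<bar>ln (Z1 TYPE('a))\<bar> + \<bar>ln (Bw + 1 / Z1 TYPE('a))\<bar> + jap y"
proof -
  have "ln (\<sigma> * N1 y) \<le> ln (dens t y)"
    by (subst ln_le_cancel_iff) (use dens_lower[of y t] N1_pos[of y] dens_pos[of t y] \<sigma> in auto)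
  moreover have "ln (\<sigma> * N1 y) = ln \<sigma> - jap y - ln (Z1 TYPE('a))"
    using \<sigma> Z1_pos[where 'a='a] N1_pos[of y] by (simp add: N1_eq ln_mult ln_div)
  moreover have "ln (dens t y) \<le> ln (Bw + 1 / Z1 TYPE('a))"
    using dens_upper[OF assms, of y] dens_pos[of t y] by simp
  ultimately show ?thesis using jap_pos[of y] by linarith
qed

text \<open>On a ball the floor \<open>\<sigma> * N1\<close> is bounded below by a positive
  constant, and the logarithm is Lipschitz above it. The constant grows exponentially with the
  radius.\<close>

lemma ln_dens_local_lipschitz:
  assumes "t \<in> {0..T}" "norm x \<le> K" "norm y \<le> K"
  shows "\<bar>ln (dens t x) - ln (dens t y)\<bar>
    \<le> (Lw + 1 / Z1 TYPE('a)) / (\<sigma> * (exp (- (1 + K)) / Z1 TYPE('a))) * norm (x - y)"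
proof -
  define c where "c = \<sigma> * (exp (- (1 + K)) / Z1 TYPE('a))"
  have c: "0 < c" using \<sigma> Z1_pos[where 'a='a] by (simp add: c_def)
  have low: "c \<le> dens t z" if "norm z \<le> K" for z
    unfolding c_def using order.trans[OF mult_left_mono[OF N1_lower[OF that]] dens_lower] \<sigma> by simp
  have "\<bar>ln (dens t x) - ln (dens t y)\<bar> \<le> \<bar>dens t x - dens t y\<bar> / c"
    by (intro abs_ln_diff_le c low assms)
  also have "\<dots> \<le> ((Lw + 1 / Z1 TYPE('a)) * norm (x - y)) / c"
    using c by (intro divide_right_mono dens_lipschitz assms) auto
  finally show ?thesis unfolding c_def by (simp only: times_divide_eq_left)
qed

text \<open>The slope 1 is that of \<open>jap\<close>, i.e. of the logarithm of \<open>N1\<close>;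
  the added 1 comes from \<open>jap y \<le> 1 + norm y\<close>.\<close>

sublocale log_convolution "\<lambda>t y. ln (dens t y)" "grad W" T
  "\<bar>ln \<sigma>\<bar> + \<bar>ln (Z1 TYPE('a))\<bar> + \<bar>ln (Bw + 1 / Z1 TYPE('a))\<bar> + 1" 1
proof
  fix t assume t: "t \<in> {0..T}"
  have "continuous_on UNIV (dens t)"
    by (rule lipschitz_imp_borel(1)[OF dens_lipschitz[OF t]])
  then show "continuous_on UNIV (\<lambda>y. ln (dens t y))"
    using dens_pos[of t] by (intro continuous_on_ln) (auto simp: less_imp_neq[symmetric])
  show "\<bar>ln (dens t y)\<bar> \<le> \<bar>ln \<sigma>\<bar> + \<bar>ln (Z1 TYPE('a))\<bar> + \<bar>ln (Bw + 1 / Z1 TYPE('a))\<bar> + 1 + 1 * norm y" for y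
    using ln_dens_growth[OF t, of y] jap_le[of y] by simp
next
  fix y :: 'a
  have "continuous_on {0..T} (\<lambda>t. dens t y)"
    unfolding dens_def by (intro continuous_intros conv_time)
  then show "continuous_on {0..T} (\<lambda>t. ln (dens t y))"
    using dens_pos[of _ y] by (intro continuous_on_ln) (auto simp: less_imp_neq[symmetric])
next
  show "integrable lborel (\<lambda>z. (1 + norm z) * norm (grad W z))"
    using grad_W_supp
    by (intro integrable_continuous_supported[where S=r] continuous_intros grad_W_continuous) auto
next
  fix K
  \<comment> \<open>The radius is K + r, since x ranges over a ball of radius K and the shift over
    one of radius r.\<close>
  define \<Lambda> where "\<Lambda> = (Lw + 1 / Z1 TYPE('a)) / (\<sigma> * (exp (- (1 + (K + r))) / Z1 TYPE('a)))"
  have "\<bar>ln (dens t (x - z)) - ln (dens t (y - z))\<bar> \<le> \<Lambda> * norm (x - y)"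
    if "t \<in> {0..T}" "x \<in> cball 0 K" "y \<in> cball 0 K" "grad W z \<noteq> 0" for t x y z
  proof -
    have "norm z \<le> r" using that(4) grad_W_supp[of z] by force
    then have "norm (x - z) \<le> K + r" "norm (y - z) \<le> K + r"
      using that(2,3) norm_triangle_ineq4[of x z] norm_triangle_ineq4[of y z] by auto
    from ln_dens_local_lipschitz[OF that(1) this] show ?thesis by (simp add: \<Lambda>_def)
  qed
  then show "\<exists>\<Lambda>. \<forall>t\<in>{0..T}. \<forall>x\<in>cball 0 K. \<forall>y\<in>cball 0 K. \<forall>z. grad W z \<noteq> 0 \<longrightarrow>
      \<bar>ln (dens t (x - z)) - ln (dens t (y - z))\<bar> \<le> \<Lambda> * norm (x - y)" by blast
qed (use grad_W_continuous in auto)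

lemma drift_growth:
  assumes "t \<in> {0..T}" "0 \<le> r"
  shows "norm (drift t x) \<le> (\<bar>ln \<sigma>\<bar> + \<bar>ln (Z1 TYPE('a))\<bar> + \<bar>ln (Bw + 1 / Z1 TYPE('a))\<bar> + jap x + r)
    * (LINT z|lborel. norm (grad W z))"
proof (rule drift_le[OF assms(1)])
  fix z assume "grad W z \<noteq> 0"
  then have "norm z \<le> r" using grad_W_supp[of z] by force
  then have "jap (x - z) \<le> jap x + r"
    using jap_lipschitz[of "x - z" x] by simp
  then show "\<bar>ln (dens t (x - z))\<bar> \<le> \<bar>ln \<sigma>\<bar> + \<bar>ln (Z1 TYPE('a))\<bar> + \<bar>ln (Bw + 1 / Z1 TYPE('a))\<bar> + jap x + r"
    using ln_dens_growth[OF assms(1), of "x - z"] by simp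
qed

end

section \<open>Growth of the velocity for compactly supported kernels, with its dependence on
  \<epsilon> and \<sigma>\<close>

lemma rescale_le:
  fixes V :: "'a::euclidean_space \<Rightarrow> real"
  assumes "0 < \<epsilon>" "\<And>x. V x \<le> B"
  shows "rescale V \<epsilon> x \<le> B / \<epsilon> ^ DIM('a)"
  using assms by (simp add: rescale_def divide_right_mono)

lemma rescale_lipschitz:
  fixes V :: "'a::euclidean_space \<Rightarrow> real"
  assumes "0 < \<epsilon>" "\<And>x y. \<bar>V x - V y\<bar> \<le> L * norm (x - y)"
  shows "\<bar>rescale V \<epsilon> x - rescale V \<epsilon> y\<bar> \<le> L / \<epsilon> ^ (DIM('a) + 1) * norm (x - y)"
proof -
  have "\<bar>rescale V \<epsilon> x - rescale V \<epsilon> y\<bar> = \<bar>V (x /\<^sub>R \<epsilon>) - V (y /\<^sub>R \<epsilon>)\<bar> / \<epsilon> ^ DIM('a)"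
    using assms(1) by (simp add: rescale_def diff_divide_distrib[symmetric] abs_divide)
  also have "\<dots> \<le> (L * norm (x /\<^sub>R \<epsilon> - y /\<^sub>R \<epsilon>)) / \<epsilon> ^ DIM('a)"
    using assms by (intro divide_right_mono) auto
  also have "\<dots> = L / \<epsilon> ^ (DIM('a) + 1) * norm (x - y)"
    using assms(1) by (simp add: scaleR_diff_right[symmetric] divide_inverse mult_ac)
  finally show ?thesis .
qed

text \<open>Evaluated along the solution the velocity is simply a given field; the scalar moves
  inside the inner product, and the initial measure charges only its support.\<close>

lemma weak_solution_transport:
  fixes \<rho> :: "real \<Rightarrow> 'a::euclidean_space measure"
  assumes weak: "weak_measure_solution V \<epsilon> \<sigma> T \<rho>"
    and field: "linear_growth_field (\<lambda>t x. - (1 - \<sigma>) *\<^sub>R omega V \<epsilon> \<sigma> (\<rho> t) x) T C"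
    and supp: "measure_support (\<rho> 0) = cball 0 R"
  shows "transport (\<lambda>t x. - (1 - \<sigma>) *\<^sub>R omega V \<epsilon> \<sigma> (\<rho> t) x) T C \<rho> R"
proof -
  interpret linear_growth_field "\<lambda>t x. - (1 - \<sigma>) *\<^sub>R omega V \<epsilon> \<sigma> (\<rho> t) x" T C
    by (rule field)
  show ?thesis
  proof
    show ac: "AC_curve T \<rho>" using weak by (simp add: weak_measure_solution_def)
    show "AE x in \<rho> 0. norm x \<le> R"
      using AE_in_measure_support[of "\<rho> 0"] P2_sets[OF AC_curve_P2[OF ac, of 0]] T_nonneg
      by (simp add: supp)
    fix \<phi> :: "'a \<Rightarrow> real" and t
    assume "C1_fun \<phi>" "compactly_supported \<phi>" "t \<in> {0..T}"
    then show "(LINT x|\<rho> t. \<phi> x) - (LINT x|\<rho> 0. \<phi> x)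
        = (LINT s:{0..t}|lborel. (LINT x|\<rho> s. grad \<phi> x \<bullet> (- (1 - \<sigma>) *\<^sub>R omega V \<epsilon> \<sigma> (\<rho> s) x)))"
      using weak unfolding weak_measure_solution_def inner_scaleR_right
        integral_mult_right_zero set_integral_mult_right by blast
  qed
qed

lemma (in transport) support_bound:
  assumes t: "t \<in> {0..T}" and S: "\<And>x. norm x \<le> R \<Longrightarrow> norm (flow t x) \<le> S"
  shows "measure_support (\<rho> t) \<subseteq> cball 0 S"
proof (rule pushforward_AE[OF flow_pushforward[OF t]])
  show "sets (\<rho> 0) = sets borel"
    using T_nonneg by (intro P2_sets AC_curve_P2[OF ac]) auto
  show "AE x in \<rho> 0. flow t x \<in> cball 0 S"
    using initial_bounded by eventually_elim (simp add: S)
qed simp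

text \<open>Gronwall's inequality for \<open>jap\<close>, rather than for the norm, yields the
  prefactor \<open>jap R\<close>.\<close>

lemma (in transport) support_bound_exp:
  assumes t: "t \<in> {0..T}"
  shows "measure_support (\<rho> t) \<subseteq> cball 0 (jap R * exp (C * T))"
proof (rule support_bound[OF t])
  fix x :: 'a assume "norm x \<le> R"
  then have "jap x \<le> jap R" by (intro jap_mono) simp
  then have "exp (C * T) * jap x \<le> exp (C * T) * jap R" by (intro mult_left_mono) auto
  then have "norm (flow t x) \<le> exp (C * T) * jap R"
    using solution_growth[OF flow_solves t, of x] norm_le_jap[of "flow t x"] by linarith
  then show "norm (flow t x) \<le> jap R * exp (C * T)"
    by (simp add: mult.commute)
qed

text \<open>The constant collects the logarithms of the bounds \<open>\<sigma> N1 \<le> density \<le> B / \<epsilon> ^ d + 1 / Z\<close>.\<close>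

definition growth_const :: "('a::euclidean_space \<Rightarrow> real) \<Rightarrow> real \<Rightarrow> real \<Rightarrow> real \<Rightarrow> real \<Rightarrow> real" where
  "growth_const V B r \<epsilon> \<sigma> = ((LINT z|lborel. norm (grad V z)) + 1)
    * (2 * \<bar>ln (Z1 TYPE('a))\<bar> + \<bar>ln (B + 1 / Z1 TYPE('a))\<bar> + 2 + r) * (1 + \<epsilon>)
    * ((\<bar>ln \<sigma>\<bar> + real DIM('a) * \<bar>ln \<epsilon>\<bar> + 1) / \<epsilon>)"

lemma growth_const_factor_pos:
  assumes "0 \<le> r"
  shows "0 < ((LINT z|lborel. norm (grad V z)) + 1)
    * (2 * \<bar>ln (Z1 TYPE('a::euclidean_space))\<bar> + \<bar>ln (B + 1 / Z1 TYPE('a))\<bar> + 2 + r)"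
proof -
  have "0 \<le> (LINT z|lborel. norm (grad V z))" by simp
  then show ?thesis using assms by (intro mult_pos_pos add_pos_nonneg add_nonneg_pos) auto
qed

lemma growth_const_pos:
  fixes V :: "'a::euclidean_space \<Rightarrow> real"
  assumes "0 \<le> r" "0 < \<epsilon>"
  shows "0 < growth_const V B r \<epsilon> \<sigma>"
  unfolding growth_const_def using assms
  by (intro mult_pos_pos[OF mult_pos_pos[OF growth_const_factor_pos]] divide_pos_pos)
     (auto intro!: add_nonneg_pos)

text \<open>The constant is k (1 + \<epsilon>) times the claimed rate, with k > 0 independent of
  both parameters; for \<epsilon> < 1 the quotient lies between k and 2 k.\<close>

lemma growth_const_bigtheta:
  fixes V :: "'a::euclidean_space \<Rightarrow> real"
  assumes "0 \<le> r"
  shows "(\<lambda>(\<epsilon>, \<sigma>). growth_const V B r \<epsilon> \<sigma>) \<in> \<Theta>[at_right 0 \<times>\<^sub>F at_right 0](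
      \<lambda>(\<epsilon>, \<sigma>). (\<bar>ln \<sigma>\<bar> + real DIM('a) * \<bar>ln \<epsilon>\<bar> + 1) / \<epsilon>)"
proof -
  define k where "k = ((LINT z|lborel. norm (grad V z)) + 1)
    * (2 * \<bar>ln (Z1 TYPE('a))\<bar> + \<bar>ln (B + 1 / Z1 TYPE('a))\<bar> + 2 + r)"
  have k: "0 < k" unfolding k_def by (rule growth_const_factor_pos[OF assms])
  let ?F = "\<lambda>\<epsilon> \<sigma>. (\<bar>ln \<sigma>\<bar> + real DIM('a) * \<bar>ln \<epsilon>\<bar> + 1) / \<epsilon>"
  have le: "k * norm (?F \<epsilon> \<sigma>) \<le> norm (growth_const V B r \<epsilon> \<sigma>) \<and> norm (growth_const V B r \<epsilon> \<sigma>) \<le> 2 * k * norm (?F \<epsilon> \<sigma>)"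
    if \<epsilon>: "0 < \<epsilon>" "\<epsilon> < 1" for \<epsilon> \<sigma>
  proof -
    have F: "0 \<le> ?F \<epsilon> \<sigma>" using \<epsilon>(1) by (intro divide_nonneg_pos add_nonneg_nonneg mult_nonneg_nonneg) auto
    have eq: "growth_const V B r \<epsilon> \<sigma> = k * (1 + \<epsilon>) * ?F \<epsilon> \<sigma>"
      by (simp add: growth_const_def k_def)
    have "k * ?F \<epsilon> \<sigma> \<le> k * (1 + \<epsilon>) * ?F \<epsilon> \<sigma>" "k * (1 + \<epsilon>) * ?F \<epsilon> \<sigma> \<le> 2 * k * ?F \<epsilon> \<sigma>"
      using k \<epsilon> F by (intro mult_right_mono; simp)+
    moreover have "norm (?F \<epsilon> \<sigma>) = ?F \<epsilon> \<sigma>" using F by (simp only: real_norm_def abs_of_nonneg)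
    moreover have "norm (growth_const V B r \<epsilon> \<sigma>) = k * (1 + \<epsilon>) * ?F \<epsilon> \<sigma>"
      unfolding eq real_norm_def using k \<epsilon> F by (intro abs_of_nonneg mult_nonneg_nonneg) auto
    ultimately show ?thesis by metis
  qed
  have "\<forall>\<^sub>F \<epsilon> in at_right (0::real). 0 < \<epsilon> \<and> \<epsilon> < 1"
    unfolding eventually_at_right_field by (intro exI[of _ 1]) auto
  then have "\<forall>\<^sub>F (\<epsilon>, \<sigma>) in at_right (0::real) \<times>\<^sub>F at_right (0::real). 0 < \<epsilon> \<and> \<epsilon> < 1"
    by (subst eventually_prod1) auto
  then show ?thesis
    using k le by (intro bigthetaI'[of k "2 * k"]) (auto elim!: eventually_mono)
qed

lemma omega_growth:
  fixes V :: "'a::euclidean_space \<Rightarrow> real"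
  assumes V: "C1_fun V" "\<And>x. 0 \<le> V x" "\<And>x. V x \<le> B" "\<And>x y. \<bar>V x - V y\<bar> \<le> L * norm (x - y)"
    and r: "0 \<le> r" "\<And>z. r < norm z \<Longrightarrow> grad V z = 0"
    and \<epsilon>: "0 < \<epsilon>" and \<sigma>: "0 < \<sigma>" "\<sigma> < 1" and T: "0 \<le> T" and ac: "AC_curve T \<rho>"
  shows "linear_growth_field (\<lambda>t x. - (1 - \<sigma>) *\<^sub>R omega V \<epsilon> \<sigma> (\<rho> t) x) T (growth_const V B r \<epsilon> \<sigma>)"
    and "\<And>t x. t \<in> {0..T} \<Longrightarrow> norm (omega V \<epsilon> \<sigma> (\<rho> t) x) \<le> growth_const V B r \<epsilon> \<sigma> * jap x"
proof -
  let ?d = "DIM('a)" and ?W = "rescale V \<epsilon>" and ?Z = "Z1 TYPE('a)"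
  define P where "P = \<bar>ln \<sigma>\<bar> + real ?d * \<bar>ln \<epsilon>\<bar>"
  define I where "I = (LINT z|lborel. norm (grad V z))"
  define c where "c = 2 * \<bar>ln ?Z\<bar> + \<bar>ln (B + 1 / ?Z)\<bar>"
  have Z: "0 < ?Z" by (rule Z1_pos)
  have B: "0 \<le> B" using order.trans[OF V(2,3)] .
  have diff: "V differentiable (at x)" for x
    using V(1) by (simp add: C1_fun_def)
  have grad_W: "grad ?W = (\<lambda>x. grad V (x /\<^sub>R \<epsilon>) /\<^sub>R \<epsilon> ^ (?d + 1))"
    using grad_rescale(2)[OF diff] by blast
  have gV: "continuous_on UNIV (grad V)"
    using V(1) by (simp add: C1_fun_def)
  \<comment> \<open>Rescaling multiplies the sup norm by \<epsilon>^(-d), the Lipschitz constant by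
    one more factor 1 / \<epsilon>, and the support radius by \<epsilon>.\<close>
  interpret regularised_curve ?W \<rho> T "B / \<epsilon> ^ ?d" "L / \<epsilon> ^ (?d + 1)" \<sigma> "\<epsilon> * r"
  proof
    show "0 \<le> ?W x" for x using V(2) \<epsilon> by (simp add: rescale_def)
    show "?W x \<le> B / \<epsilon> ^ ?d" for x by (rule rescale_le[OF \<epsilon> V(3)])
    show "\<bar>?W x - ?W y\<bar> \<le> L / \<epsilon> ^ (?d + 1) * norm (x - y)" for x y by (rule rescale_lipschitz[OF \<epsilon> V(4)])
    show "continuous_on UNIV (grad ?W)"
      unfolding grad_W by (intro continuous_intros continuous_on_compose2[OF gV]) auto
    show "grad ?W z = 0" if "\<epsilon> * r < norm z" for z
    proof -
      have "r < norm (z /\<^sub>R \<epsilon>)" using that \<epsilon> by (simp add: field_simps)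
      then show ?thesis by (simp add: grad_W r(2))
    qed
  qed (use ac \<sigma> in auto)
  have omega: "omega V \<epsilon> \<sigma> (\<rho> t) x = drift t x" for t x
    unfolding omega_def drift_def by (simp only: dens_def reg_density_def conv_def)
  \<comment> \<open>The factor 1 / \<epsilon> of the growth constant: the L1 norm of the kernel
    gradient scales like this.\<close>
  have int_W: "(LINT z|lborel. norm (grad ?W z)) = I / \<epsilon>"
  proof -
    have "(\<lambda>z. norm (grad V z)) \<in> borel_measurable borel"
      by (intro borel_measurable_continuous_onI continuous_intros gV)
    from lborel_integral_rescale(1)[OF \<epsilon> this] show ?thesis
      using \<epsilon> by (simp add: grad_W I_def divide_inverse)
  qed
  \<comment> \<open>The sup norm enters through its logarithm only, which is the origin of d |log
    \<epsilon>|. The auxiliary \<open>E\<close> dominates both \<epsilon>^(-d) and 1, so no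
    distinction between small and large \<epsilon> is needed.\<close>
  have ln_B: "\<bar>ln (B / \<epsilon> ^ ?d + 1 / ?Z)\<bar> \<le> real ?d * \<bar>ln \<epsilon>\<bar> + \<bar>ln (B + 1 / ?Z)\<bar> + \<bar>ln ?Z\<bar>"
  proof -
    define E where "E = exp (real ?d * \<bar>ln \<epsilon>\<bar>)"
    have "1 / \<epsilon> ^ ?d = exp (- (real ?d * ln \<epsilon>))"
      using \<epsilon> by (simp add: exp_minus exp_of_nat_mult divide_inverse)
    also have "\<dots> \<le> E"
      unfolding E_def by (simp add: abs_if mult_left_mono)
    finally have "B * (1 / \<epsilon> ^ ?d) \<le> B * E"
      using B by (rule mult_left_mono)
    moreover have "1 / ?Z * 1 \<le> 1 / ?Z * E"
      using Z by (intro mult_left_mono) (auto simp: E_def)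
    ultimately have le: "B / \<epsilon> ^ ?d + 1 / ?Z \<le> (B + 1 / ?Z) * E"
      by (simp add: algebra_simps)
    have pos: "0 < B / \<epsilon> ^ ?d + 1 / ?Z" "0 < B + 1 / ?Z" "1 / ?Z \<le> B / \<epsilon> ^ ?d + 1 / ?Z"
      using B Z \<epsilon> by (auto intro!: add_nonneg_pos)
    have "ln (B / \<epsilon> ^ ?d + 1 / ?Z) \<le> ln ((B + 1 / ?Z) * E)"
      using le pos by (subst ln_le_cancel_iff) (auto simp: E_def)
    also have "\<dots> = ln (B + 1 / ?Z) + real ?d * \<bar>ln \<epsilon>\<bar>"
      using pos(2) by (simp add: ln_mult E_def)
    finally have "ln (B / \<epsilon> ^ ?d + 1 / ?Z) \<le> ln (B + 1 / ?Z) + real ?d * \<bar>ln \<epsilon>\<bar>" .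
    moreover have "ln (1 / ?Z) \<le> ln (B / \<epsilon> ^ ?d + 1 / ?Z)"
      using pos Z by (subst ln_le_cancel_iff) auto
    moreover have "ln (1 / ?Z) = - ln ?Z" using Z by (simp add: ln_div)
    moreover have "0 \<le> real ?d * \<bar>ln \<epsilon>\<bar>" by simp
    ultimately show ?thesis by linarith
  qed
  show bound: "norm (omega V \<epsilon> \<sigma> (\<rho> t) x) \<le> growth_const V B r \<epsilon> \<sigma> * jap x" if t: "t \<in> {0..T}" for t x
  proof -
    \<comment> \<open>The product dominates each of 1, P and \<open>jap x\<close>, which turns a sum
      of these terms into a multiple of (P + 1) \<open>jap x\<close>.\<close>
    define q where "q = (P + 1) * jap x"
    have P: "0 \<le> P" by (simp add: P_def)
    have I: "0 \<le> I" by (simp add: I_def)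
    have c0: "0 \<le> c" by (simp add: c_def)
    have q: "1 \<le> q" "P \<le> q" "jap x \<le> q"
    proof -
      show "jap x \<le> q" using P jap_pos[of x] by (simp add: q_def algebra_simps)
      then show "1 \<le> q" using jap_ge_1[of x] by linarith
      have "P * 1 \<le> P * jap x" using P by (intro mult_left_mono jap_ge_1)
      then show "P \<le> q" using jap_pos[of x] by (simp add: q_def algebra_simps)
    qed
    have "norm (omega V \<epsilon> \<sigma> (\<rho> t) x) \<le> (\<bar>ln \<sigma>\<bar> + \<bar>ln ?Z\<bar> + \<bar>ln (B / \<epsilon> ^ ?d + 1 / ?Z)\<bar> + jap x + \<epsilon> * r) * (I / \<epsilon>)"
      using drift_growth[OF t, of x] r \<epsilon> by (simp add: omega int_W)
    also have "\<dots> \<le> (P + c + jap x + \<epsilon> * r) * (I / \<epsilon>)"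
      using ln_B I \<epsilon> by (intro mult_right_mono) (auto simp: P_def c_def)
    \<comment> \<open>The 2 pays for P and \<open>jap x\<close>; the factor 1 + \<epsilon> pays for
      the shift \<epsilon> r, which is not small for large \<epsilon>.\<close>
    also have "\<dots> \<le> ((c + 2 + r) * (1 + \<epsilon>) * q) * ((I + 1) / \<epsilon>)"
    proof (intro mult_mono divide_right_mono)
      have "c * 1 \<le> c * q" "\<epsilon> * r * 1 \<le> \<epsilon> * r * q"
        using c0 r \<epsilon> q by (intro mult_left_mono; simp)+
      moreover have "0 \<le> c * \<epsilon> * q" "0 \<le> \<epsilon> * q" "0 \<le> r * q"
        using c0 \<epsilon> r q by simp_all
      ultimately show "P + c + jap x + \<epsilon> * r \<le> (c + 2 + r) * (1 + \<epsilon>) * q"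
        using q by (simp add: algebra_simps)
    qed (use c0 r \<epsilon> q I in auto)
    also have "\<dots> = growth_const V B r \<epsilon> \<sigma> * jap x"
      by (simp add: growth_const_def I_def c_def q_def P_def mult_ac)
    finally show ?thesis .
  qed
  show "linear_growth_field (\<lambda>t x. - (1 - \<sigma>) *\<^sub>R omega V \<epsilon> \<sigma> (\<rho> t) x) T (growth_const V B r \<epsilon> \<sigma>)"
    unfolding omega by (rule scaled_drift_linear_growth) (use T \<sigma> bound in \<open>auto simp: omega\<close>)
qed

lemma compactly_supported_C1_bounds:
  fixes V :: "'a::euclidean_space \<Rightarrow> real"
  assumes "C1_fun V" "compactly_supported V"
  obtains r L where "0 \<le> r" "\<And>z. r < norm z \<Longrightarrow> grad V z = 0" "\<And>x y. \<bar>V x - V y\<bar> \<le> L * norm (x - y)"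
proof -
  have "bounded {x. V x \<noteq> 0}"
    using assms(2) bounded_subset[OF compact_imp_bounded closure_subset]
    by (auto simp: compactly_supported_def)
  then obtain r where r: "0 < r" "\<And>x. V x \<noteq> 0 \<Longrightarrow> norm x \<le> r"
    unfolding bounded_pos by blast
  have diff: "V differentiable (at x)" for x
    using assms(1) by (simp add: C1_fun_def)
  have supp: "grad V z = 0" if "r < norm z" for z
    by (rule grad_eq_0_outside[OF _ that]) (use r(2) in force)
  have "compact (grad V ` cball 0 r)"
    using assms(1) by (intro compact_continuous_image) (auto simp: C1_fun_def intro: continuous_on_subset)
  then have "bounded (grad V ` cball 0 r)" by (rule compact_imp_bounded)
  then obtain L where "0 < L" "\<forall>y\<in>grad V ` cball 0 r. norm y \<le> L"
    unfolding bounded_pos by blast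
  then have L: "0 < L" "\<And>x. norm x \<le> r \<Longrightarrow> norm (grad V x) \<le> L"
    by auto
  have "norm (grad V x) \<le> L" for x
    using L supp[of x] by (cases "norm x \<le> r") auto
  from that[OF less_imp_le[OF r(1)] supp grad_bounded_imp_lipschitz[OF diff this]]
  show thesis .
qed

section \<open>The exponential kernel\<close>

lemma N1_has_derivative:
  fixes x :: "'a::euclidean_space"
  shows "(N1 has_derivative (\<lambda>h. ((- N1 x) *\<^sub>R (x /\<^sub>R jap x)) \<bullet> h)) (at x)"
proof -
  have "((\<lambda>x. exp (- jap x)) has_derivative (\<lambda>h. - ((x /\<^sub>R jap x) \<bullet> h) * exp (- jap x))) (at x)"
    by (rule has_derivative_exp[OF has_derivative_minus[OF has_derivative_jap]])
  then have "((\<lambda>x. inverse (Z1 TYPE('a)) * exp (- jap x)) has_derivative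
      (\<lambda>h. inverse (Z1 TYPE('a)) * (- ((x /\<^sub>R jap x) \<bullet> h) * exp (- jap x)))) (at x)"
    by (rule has_derivative_mult_right)
  moreover have "N1 = (\<lambda>x::'a. inverse (Z1 TYPE('a)) * exp (- jap x))"
    by (simp add: fun_eq_iff N1_eq divide_inverse mult.commute)
  ultimately show ?thesis
    by (simp add: N1_eq divide_inverse mult_ac)
qed

lemma grad_N1: "grad N1 x = (- N1 x) *\<^sub>R (x /\<^sub>R jap x)"
  by (rule grad_eqI[OF N1_has_derivative])

lemma N1_differentiable: "N1 differentiable (at (x::'a::euclidean_space))"
  using N1_has_derivative by (auto simp: differentiable_def)

lemma continuous_N1: "continuous_on UNIV (N1 :: 'a::euclidean_space \<Rightarrow> real)"
  by (rule lipschitz_imp_borel(1)[OF N1_lipschitz])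

lemma continuous_grad_N1: "continuous_on UNIV (grad (N1 :: 'a::euclidean_space \<Rightarrow> real))"
proof -
  have "continuous_on UNIV (\<lambda>x::'a. (- N1 x) *\<^sub>R (x /\<^sub>R jap x))"
    by (intro continuous_intros continuous_N1) (auto simp: less_imp_neq[OF jap_pos, symmetric])
  moreover have "grad N1 = (\<lambda>x::'a. (- N1 x) *\<^sub>R (x /\<^sub>R jap x))"
    by (simp add: fun_eq_iff grad_N1)
  ultimately show ?thesis by simp
qed

lemma norm_grad_N1_le: "norm (grad N1 (x::'a::euclidean_space)) \<le> N1 x"
proof -
  have "norm (grad N1 x) = N1 x * norm (x /\<^sub>R jap x)"
    by (simp only: grad_N1 norm_scaleR[of "- N1 x"] abs_minus_cancel abs_of_pos[OF N1_pos])
  also have "\<dots> \<le> N1 x * 1"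
    using N1_pos[of x] by (intro mult_left_mono norm_div_jap_le) auto
  finally show ?thesis by simp
qed

lemma grad_N1_odd: "grad N1 (- x) = - grad N1 (x::'a::euclidean_space)"
  by (simp add: grad_N1 N1_eq jap_minus)

text \<open>The Lipschitz bound on the logarithm of \<open>N1\<close> in multiplicative form,
  because in this form it can be integrated against a measure and so passes to the
  convolution.\<close>

lemma N1_harnack: "N1 x \<le> exp (norm (x - y)) * N1 (y::'a::euclidean_space)"
proof -
  have "exp (- jap x) \<le> exp (norm (x - y)) * exp (- jap y)"
    using jap_lipschitz[of x y] by (simp add: mult_exp_exp)
  then show ?thesis
    using divide_right_mono[of _ _ "Z1 TYPE('a)"] Z1_pos[where 'a='a] by (fastforce simp: N1_eq)
qed

lemma integrable_N1: "integrable lborel (N1 :: 'a::euclidean_space \<Rightarrow> real)"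
  and integrable_norm_N1: "integrable lborel (\<lambda>x::'a. norm x * N1 x)"
  using integrable_exp_jap[where 'a='a] integrable_norm_exp_jap[where 'a='a] by (simp_all add: N1_eq[abs_def])

text \<open>This first moment determines the constant of the second claim.\<close>

definition N1_moment :: "'a::euclidean_space itself \<Rightarrow> real" where
  "N1_moment _ = (LINT z|lborel. norm (z::'a) * N1 z)"

lemma N1_moment_nonneg: "0 \<le> N1_moment TYPE('a::euclidean_space)"
  unfolding N1_moment_def using less_imp_le[OF N1_pos] by (intro Bochner_Integration.integral_nonneg mult_nonneg_nonneg) auto

locale exponential_curve = density_curve "rescale N1 \<epsilon>" \<rho> T Bw Lw
  for \<epsilon> :: real and \<rho> :: "real \<Rightarrow> 'a::euclidean_space measure" and T Bw Lw +
  assumes \<epsilon>: "0 < \<epsilon>"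
begin

abbreviation "W \<equiv> rescale N1 \<epsilon> :: 'a \<Rightarrow> real"

lemma W_pos: "0 < W x"
  using N1_pos[of "x /\<^sub>R \<epsilon>"] \<epsilon> by (simp add: rescale_def)

lemma W_harnack: "W x \<le> exp (norm (x - y) / \<epsilon>) * W y"
proof -
  have "N1 (x /\<^sub>R \<epsilon>) \<le> exp (norm (x - y) / \<epsilon>) * N1 (y /\<^sub>R \<epsilon>)"
    using N1_harnack[of "x /\<^sub>R \<epsilon>" "y /\<^sub>R \<epsilon>"] \<epsilon>
    by (simp add: scaleR_diff_right[symmetric] divide_inverse mult.commute)
  then show ?thesis
    using divide_right_mono[of _ _ "\<epsilon> ^ DIM('a)"] \<epsilon> by (fastforce simp: rescale_def)
qed

text \<open>For \<sigma> = 0 there is no floor \<open>\<sigma> * N1\<close>; positivity comes from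
  that of the kernel, as a probability measure cannot integrate a positive function to 0.\<close>

lemma conv_pos:
  assumes t: "t \<in> {0..T}"
  shows "0 < conv t y"
proof -
  interpret prob_space "\<rho> t" by (rule P2_prob[OF P2_\<rho>[OF t]])
  have "conv t y \<noteq> 0"
  proof
    assume "conv t y = 0"
    then have "AE z in \<rho> t. W (y - z) = 0"
      unfolding conv_def using W_nonneg
      by (subst (asm) integral_nonneg_eq_0_iff_AE[OF shift_integrable[OF t]]) auto
    then have "AE z in \<rho> t. False"
      by (rule eventually_mono) (metis W_pos less_irrefl)
    then show False by (simp add: AE_False)
  qed
  then show ?thesis using conv_nonneg[of t y] by simp
qed

lemma conv_harnack:
  assumes t: "t \<in> {0..T}"
  shows "conv t x \<le> exp (norm (x - y) / \<epsilon>) * conv t y"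
proof -
  have "conv t x \<le> (LINT z|\<rho> t. exp (norm (x - y) / \<epsilon>) * W (y - z))"
    unfolding conv_def
  proof (rule integral_mono)
    show "W (x - z) \<le> exp (norm (x - y) / \<epsilon>) * W (y - z)" for z
      using W_harnack[of "x - z" "y - z"] by simp
  qed (use shift_integrable[OF t] in auto)
  then show ?thesis by (simp add: conv_def)
qed

lemma ln_conv_lipschitz:
  assumes t: "t \<in> {0..T}"
  shows "\<bar>ln (conv t x) - ln (conv t y)\<bar> \<le> norm (x - y) / \<epsilon>"
proof -
  have *: "ln (conv t x) - ln (conv t y) \<le> norm (x - y) / \<epsilon>" for x y
  proof -
    have "ln (conv t x) \<le> ln (exp (norm (x - y) / \<epsilon>) * conv t y)"
      using conv_harnack[OF t, of x y] conv_pos[OF t] by (subst ln_le_cancel_iff) auto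
    then show ?thesis using conv_pos[OF t, of y] by (simp add: ln_mult)
  qed
  show ?thesis
    using *[of x y] *[of y x] by (simp add: abs_le_iff norm_minus_commute)
qed

lemma grad_W: "grad W z = grad N1 (z /\<^sub>R \<epsilon>) /\<^sub>R \<epsilon> ^ (DIM('a) + 1)"
  by (rule grad_rescale(2)[OF N1_differentiable])

lemma continuous_grad_W: "continuous_on UNIV (grad W)"
proof -
  have "continuous_on UNIV (\<lambda>z::'a. grad N1 (z /\<^sub>R \<epsilon>) /\<^sub>R \<epsilon> ^ (DIM('a) + 1))"
    by (intro continuous_intros continuous_on_compose2[OF continuous_grad_N1]) auto
  then show ?thesis by (simp add: grad_W[abs_def])
qed

lemma grad_W_odd: "grad W (- z) = - grad W z"
  by (simp add: grad_W grad_N1_odd)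

lemma norm_grad_W_le: "norm (grad W z) \<le> W z / \<epsilon>"
proof -
  have "norm (grad W z) = norm (grad N1 (z /\<^sub>R \<epsilon>)) / \<epsilon> ^ (DIM('a) + 1)"
    using \<epsilon> by (simp add: grad_W divide_inverse mult.commute)
  also have "\<dots> \<le> N1 (z /\<^sub>R \<epsilon>) / \<epsilon> ^ (DIM('a) + 1)"
    using \<epsilon> by (intro divide_right_mono norm_grad_N1_le) auto
  finally show ?thesis by (simp add: rescale_def mult.commute)
qed

lemma W_moments:
  shows "integrable lborel W" "integrable lborel (\<lambda>z. norm z * W z)"
    and "(LINT z|lborel. norm z * W z) = \<epsilon> * N1_moment TYPE('a)"
proof -
  have m: "(N1 :: 'a \<Rightarrow> real) \<in> borel_measurable borel"
    by (rule borel_measurable_continuous_onI[OF continuous_N1])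
  then have m': "(\<lambda>z::'a. norm z * N1 z) \<in> borel_measurable borel" by measurable
  show "integrable lborel W"
    unfolding rescale_def[abs_def]
    by (rule integrable_divide) (use lborel_integral_rescale(2)[OF \<epsilon> m] integrable_N1 in simp)
  have eq: "norm z * W z = \<epsilon> / \<epsilon> ^ DIM('a) * (norm (z /\<^sub>R \<epsilon>) * N1 (z /\<^sub>R \<epsilon>))" for z
    using \<epsilon> by (simp add: rescale_def divide_inverse mult_ac)
  show "integrable lborel (\<lambda>z. norm z * W z)"
    unfolding eq using lborel_integral_rescale(2)[OF \<epsilon> m'] integrable_norm_N1
    by (intro integrable_mult_right) simp
  show "(LINT z|lborel. norm z * W z) = \<epsilon> * N1_moment TYPE('a)"
    unfolding eq integral_mult_right_zero lborel_integral_rescale(1)[OF \<epsilon> m'] N1_moment_def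
    using \<epsilon> by simp
qed

text \<open>\<open>A\<close> is obtained by compactness of [0, T] and is not explicit. It serves
  integrability and continuity only; the quantitative bound on the velocity comes from
  \<open>drift_bound\<close>.\<close>

lemma log_convolution: "\<exists>A. log_convolution (\<lambda>t y. ln (conv t y)) (grad W) T A (1 / \<epsilon>)"
proof -
  have time: "continuous_on {0..T} (\<lambda>t. ln (conv t y))" for y
    by (intro continuous_on_ln conv_time) (metis conv_pos less_irrefl)
  have "bounded ((\<lambda>t. ln (conv t 0)) ` {0..T})"
    by (intro compact_imp_bounded compact_continuous_image time) auto
  then obtain A where "\<forall>l\<in>(\<lambda>t. ln (conv t 0)) ` {0..T}. norm l \<le> A"
    unfolding bounded_iff by blast
  then have A: "\<bar>ln (conv t 0)\<bar> \<le> A" if "t \<in> {0..T}" for t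
    using that by simp
  have "log_convolution (\<lambda>t y. ln (conv t y)) (grad W) T A (1 / \<epsilon>)"
  proof
    fix t assume t: "t \<in> {0..T}"
    show "continuous_on UNIV (\<lambda>y. ln (conv t y))"
      by (rule lipschitz_imp_borel(1)[where L="1 / \<epsilon>"]) (use ln_conv_lipschitz[OF t] in simp)
    show "\<bar>ln (conv t y)\<bar> \<le> A + 1 / \<epsilon> * norm y" for y
      using ln_conv_lipschitz[OF t, of y 0] A[OF t] by simp
  next
    show "integrable lborel (\<lambda>z. (1 + norm z) * norm (grad W z))"
    proof (rule Bochner_Integration.integrable_bound)
      show "integrable lborel (\<lambda>z. (W z + norm z * W z) / \<epsilon>)"
        using W_moments(1,2) by simp
      show "(\<lambda>z. (1 + norm z) * norm (grad W z)) \<in> borel_measurable lborel"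
        using borel_measurable_continuous_onI[OF continuous_grad_W] by simp
      have "(1 + norm z) * norm (grad W z) \<le> (1 + norm z) * (W z / \<epsilon>)" for z
        by (intro mult_left_mono norm_grad_W_le) auto
      also have "(1 + norm z) * (W z / \<epsilon>) = (W z + norm z * W z) / \<epsilon>" for z
        by (simp add: add_divide_distrib algebra_simps)
      finally have "(1 + norm z) * norm (grad W z) \<le> (W z + norm z * W z) / \<epsilon>" for z .
      then show "AE z in lborel. norm ((1 + norm z) * norm (grad W z)) \<le> norm ((W z + norm z * W z) / \<epsilon>)"
        by (intro AE_I2) (smt (verit) mult_nonneg_nonneg norm_ge_zero real_norm_def)
    qed
  next
    fix K
    show "\<exists>\<Lambda>. \<forall>t\<in>{0..T}. \<forall>x\<in>cball 0 K. \<forall>y\<in>cball 0 K. \<forall>z. grad W z \<noteq> 0 \<longrightarrow>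
        \<bar>ln (conv t (x - z)) - ln (conv t (y - z))\<bar> \<le> \<Lambda> * norm (x - y)"
    proof (intro exI[of _ "1 / \<epsilon>"] ballI allI impI)
      show "\<bar>ln (conv t (x - z)) - ln (conv t (y - z))\<bar> \<le> 1 / \<epsilon> * norm (x - y)"
        if "t \<in> {0..T}" for t x y z
        using ln_conv_lipschitz[OF that, of "x - z" "y - z"] by simp
    qed
  qed (use time \<epsilon> continuous_grad_W in auto)
  then show ?thesis ..
qed

text \<open>\<open>grad W\<close> has mean zero because \<open>W\<close> is even, so a constant may be subtracted from the logarithm;
  then only its Lipschitz constant \<open>1 / \<epsilon>\<close> enters.\<close>

lemma drift_bound:
  assumes t: "t \<in> {0..T}"
  shows "norm (omega N1 \<epsilon> 0 (\<rho> t) x) \<le> N1_moment TYPE('a) / \<epsilon>"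
proof -
  obtain A where "log_convolution (\<lambda>t y. ln (conv t y)) (grad W) T A (1 / \<epsilon>)"
    using log_convolution by blast
  then interpret l: log_convolution "\<lambda>t y. ln (conv t y)" "grad W" T A "1 / \<epsilon>" .
  have "(LINT z|lborel. grad W z) = - (LINT z|lborel. grad W z)"
    using lborel_integral_reflect[OF borel_measurable_continuous_onI[OF continuous_grad_W], of 0]
    by (simp add: grad_W_odd)
  then have "(LINT z|lborel. grad W z) = 0"
    by (simp add: eq_neg_iff_add_eq_0 flip: scaleR_2)
  then have zero: "(LINT z|lborel. ln (conv t x) *\<^sub>R grad W z) = 0" by simp
  have i: "integrable lborel (\<lambda>z. ln (conv t (x - z)) *\<^sub>R grad W z)" "integrable lborel (\<lambda>z. ln (conv t x) *\<^sub>R grad W z)"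
    using l.integrable_integrand[OF t] l.integrable_G by auto
  have "omega N1 \<epsilon> 0 (\<rho> t) x = l.drift t x"
    unfolding omega_def l.drift_def by (simp add: reg_density_def conv_def)
  also have "\<dots> = (LINT z|lborel. ln (conv t (x - z)) *\<^sub>R grad W z - ln (conv t x) *\<^sub>R grad W z)"
    using Bochner_Integration.integral_diff[OF i] zero by (simp add: l.drift_eq[OF t])
  also have "norm \<dots> \<le> (LINT z|lborel. norm z * W z / \<epsilon>\<^sup>2)"
  proof (rule order.trans[OF integral_norm_bound integral_mono])
    show "integrable lborel (\<lambda>z. norm (ln (conv t (x - z)) *\<^sub>R grad W z - ln (conv t x) *\<^sub>R grad W z))"
      by (intro integrable_norm Bochner_Integration.integrable_diff i)
    show "integrable lborel (\<lambda>z. norm z * W z / \<epsilon>\<^sup>2)"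
      using W_moments(2) by simp
    show "norm (ln (conv t (x - z)) *\<^sub>R grad W z - ln (conv t x) *\<^sub>R grad W z) \<le> norm z * W z / \<epsilon>\<^sup>2" for z
    proof -
      have "\<bar>ln (conv t (x - z)) - ln (conv t x)\<bar> * norm (grad W z) \<le> (norm z / \<epsilon>) * (W z / \<epsilon>)"
        using ln_conv_lipschitz[OF t, of "x - z" x] \<epsilon> by (intro mult_mono norm_grad_W_le) auto
      then show ?thesis
        by (simp add: scaleR_diff_left[symmetric] power2_eq_square)
    qed
  qed
  \<comment> \<open>The first moment of \<open>W\<close> supplies \<epsilon>, against one 1 /
    \<epsilon> from the logarithm and one from the gradient of \<open>W\<close>.\<close>
  also have "\<dots> = N1_moment TYPE('a) / \<epsilon>"
    using \<epsilon> by (simp add: W_moments(3) power2_eq_square)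
  finally show ?thesis .
qed

text \<open>A bounded field has linear growth since \<open>jap\<close> is at least 1. The factor
  \<open>1 - 0\<close> keeps the shape that \<open>weak_solution_transport\<close> expects at
  \<sigma> = 0.\<close>

lemma omega_linear_growth:
  assumes T: "0 \<le> T"
  shows "linear_growth_field (\<lambda>t x. - (1 - 0) *\<^sub>R omega N1 \<epsilon> 0 (\<rho> t) x) T (N1_moment TYPE('a) / \<epsilon>)"
proof -
  obtain A where "log_convolution (\<lambda>t y. ln (conv t y)) (grad W) T A (1 / \<epsilon>)"
    using log_convolution by blast
  then interpret l: log_convolution "\<lambda>t y. ln (conv t y)" "grad W" T A "1 / \<epsilon>" .
  have eq: "omega N1 \<epsilon> 0 (\<rho> t) x = l.drift t x" for t x
    unfolding omega_def l.drift_def by (simp add: reg_density_def conv_def)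
  show ?thesis
    unfolding eq
  proof (rule l.scaled_drift_linear_growth[OF T])
    fix t and x :: 'a assume t: "t \<in> {0..T}"
    have "0 \<le> N1_moment TYPE('a) / \<epsilon>" using N1_moment_nonneg[where 'a='a] \<epsilon> by simp
    then have "N1_moment TYPE('a) / \<epsilon> * 1 \<le> N1_moment TYPE('a) / \<epsilon> * jap x"
      by (intro mult_left_mono jap_ge_1)
    then show "norm (l.drift t x) \<le> N1_moment TYPE('a) / \<epsilon> * jap x"
      using drift_bound[OF t, of x] by (simp add: eq)
  qed simp
qed

end

lemma exponential_curve_N1:
  fixes \<rho> :: "real \<Rightarrow> 'a::euclidean_space measure"
  assumes "0 < \<epsilon>" "AC_curve T \<rho>"
  shows "exponential_curve \<epsilon> \<rho> T (1 / Z1 TYPE('a) / \<epsilon> ^ DIM('a)) (1 / Z1 TYPE('a) / \<epsilon> ^ (DIM('a) + 1))"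
proof
  show "0 \<le> rescale N1 \<epsilon> x" for x :: 'a
    using N1_pos[of "x /\<^sub>R \<epsilon>"] assms(1) by (simp add: rescale_def)
qed (use assms rescale_le[OF assms(1) N1_le] rescale_lipschitz[OF assms(1) N1_lipschitz] in auto)

section \<open>The two claims for weak solutions\<close>

lemma compact_kernel_solution:
  fixes V :: "'a::euclidean_space \<Rightarrow> real"
  assumes V: "C1_fun V" "\<And>x. 0 \<le> V x" "\<And>x. V x \<le> B" "\<And>x y. \<bar>V x - V y\<bar> \<le> L * norm (x - y)"
    and r: "0 \<le> r" "\<And>z. r < norm z \<Longrightarrow> grad V z = 0"
    and \<epsilon>: "0 < \<epsilon>" and \<sigma>: "0 < \<sigma>" "\<sigma> < 1" and T: "0 < T"
    and weak: "weak_measure_solution V \<epsilon> \<sigma> T \<rho>" and supp: "measure_support (\<rho> 0) = cball 0 R"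
  shows "\<exists>X. (\<forall>x. solves_ode_from (\<lambda>t z. - (1 - \<sigma>) *\<^sub>R omega V \<epsilon> \<sigma> (\<rho> t) z) T x (\<lambda>t. X t x) \<and>
        (\<forall>y. solves_ode_from (\<lambda>t z. - (1 - \<sigma>) *\<^sub>R omega V \<epsilon> \<sigma> (\<rho> t) z) T x y \<longrightarrow> (\<forall>t\<in>{0..T}. y t = X t x))) \<and>
      (\<forall>t\<in>{0..T}. is_pushforward (X t) (\<rho> 0) (\<rho> t))"
    and "\<forall>t\<in>{0..T}. \<forall>x. norm (omega V \<epsilon> \<sigma> (\<rho> t) x) \<le> growth_const V B r \<epsilon> \<sigma> * jap x"
    and "\<forall>t\<in>{0..T}. compact (measure_support (\<rho> t)) \<and>
      measure_support (\<rho> t) \<subseteq> cball 0 (jap R * exp (growth_const V B r \<epsilon> \<sigma> * T))"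
proof -
  have ac: "AC_curve T \<rho>" using weak by (simp add: weak_measure_solution_def)
  note og = omega_growth[OF V r \<epsilon> \<sigma> less_imp_le[OF T] ac]
  interpret transport "\<lambda>t x. - (1 - \<sigma>) *\<^sub>R omega V \<epsilon> \<sigma> (\<rho> t) x" T "growth_const V B r \<epsilon> \<sigma>" \<rho> R
    by (rule weak_solution_transport[OF weak og(1) supp])
  show "\<exists>X. (\<forall>x. solves_ode_from (\<lambda>t z. - (1 - \<sigma>) *\<^sub>R omega V \<epsilon> \<sigma> (\<rho> t) z) T x (\<lambda>t. X t x) \<and>
        (\<forall>y. solves_ode_from (\<lambda>t z. - (1 - \<sigma>) *\<^sub>R omega V \<epsilon> \<sigma> (\<rho> t) z) T x y \<longrightarrow> (\<forall>t\<in>{0..T}. y t = X t x))) \<and>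
      (\<forall>t\<in>{0..T}. is_pushforward (X t) (\<rho> 0) (\<rho> t))"
    by (intro exI[of _ flow] conjI allI ballI impI flow_solves flow_unique flow_pushforward)
  show "\<forall>t\<in>{0..T}. \<forall>x. norm (omega V \<epsilon> \<sigma> (\<rho> t) x) \<le> growth_const V B r \<epsilon> \<sigma> * jap x"
    using og(2) by blast
  show "\<forall>t\<in>{0..T}. compact (measure_support (\<rho> t)) \<and>
      measure_support (\<rho> t) \<subseteq> cball 0 (jap R * exp (growth_const V B r \<epsilon> \<sigma> * T))"
  proof (intro ballI conjI)
    fix t assume "t \<in> {0..T}"
    then show sub: "measure_support (\<rho> t) \<subseteq> cball 0 (jap R * exp (growth_const V B r \<epsilon> \<sigma> * T))"
      by (rule support_bound_exp)
    show "compact (measure_support (\<rho> t))"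
      using closed_measure_support bounded_subset[OF bounded_cball sub] by (simp add: compact_eq_bounded_closed)
  qed
qed

lemma exponential_kernel_solution:
  fixes \<rho> :: "real \<Rightarrow> 'a::euclidean_space measure"
  assumes \<epsilon>: "0 < \<epsilon>" and T: "0 < T"
    and weak: "weak_measure_solution N1 \<epsilon> 0 T \<rho>" and supp: "measure_support (\<rho> 0) = cball 0 R"
  shows "\<exists>X. (\<forall>x. solves_ode_from (\<lambda>t z. - omega N1 \<epsilon> 0 (\<rho> t) z) T x (\<lambda>t. X t x)) \<and>
      (\<forall>t\<in>{0..T}. is_pushforward (X t) (\<rho> 0) (\<rho> t))"
    and "\<forall>t\<in>{0..T}. measure_support (\<rho> t) \<subseteq> cball 0 (R + (N1_moment TYPE('a) + 1) / \<epsilon> * T)"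
proof -
  let ?m = "N1_moment TYPE('a)"
  have ac: "AC_curve T \<rho>" using weak by (simp add: weak_measure_solution_def)
  interpret c: exponential_curve \<epsilon> \<rho> T "1 / Z1 TYPE('a) / \<epsilon> ^ DIM('a)" "1 / Z1 TYPE('a) / \<epsilon> ^ (DIM('a) + 1)"
    by (rule exponential_curve_N1[OF \<epsilon> ac])
  interpret transport "\<lambda>t x. - (1 - 0) *\<^sub>R omega N1 \<epsilon> 0 (\<rho> t) x" T "?m / \<epsilon>" \<rho> R
    by (rule weak_solution_transport[OF weak c.omega_linear_growth[OF less_imp_le[OF T]] supp])
  have sol: "solves_ode_from (\<lambda>t z. - omega N1 \<epsilon> 0 (\<rho> t) z) T x (\<lambda>t. flow t x)" for x
    using flow_solves[of x] by simp
  show "\<exists>X. (\<forall>x. solves_ode_from (\<lambda>t z. - omega N1 \<epsilon> 0 (\<rho> t) z) T x (\<lambda>t. X t x)) \<and>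
      (\<forall>t\<in>{0..T}. is_pushforward (X t) (\<rho> 0) (\<rho> t))"
    by (intro exI[of _ flow] conjI allI ballI sol flow_pushforward)
  show "\<forall>t\<in>{0..T}. measure_support (\<rho> t) \<subseteq> cball 0 (R + (?m + 1) / \<epsilon> * T)"
  proof
    fix t assume t: "t \<in> {0..T}"
    show "measure_support (\<rho> t) \<subseteq> cball 0 (R + (?m + 1) / \<epsilon> * T)"
    proof (rule support_bound[OF t])
      fix x :: 'a assume x: "norm x \<le> R"
      \<comment> \<open>The speed is bounded, so displacement is at most speed times time; this
        gives a radius linear in T instead of an exponential one.\<close>
      have "norm (flow t x - flow 0 x) \<le> ?m / \<epsilon> * (t - 0)"
      proof (rule norm_diff_le_of_derivative_bound)
        fix s assume s: "s \<in> {0..t}"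
        then have s': "s \<in> {0..T}" using t by auto
        have "((\<lambda>t. flow t x) has_vector_derivative - omega N1 \<epsilon> 0 (\<rho> s) (flow s x)) (at s within {0..T})"
          using sol[of x] s' by (auto simp: solves_ode_from_def)
        then show "((\<lambda>t. flow t x) has_vector_derivative - omega N1 \<epsilon> 0 (\<rho> s) (flow s x)) (at s within {0..t})"
          by (rule has_vector_derivative_within_subset) (use t in auto)
        show "norm (- omega N1 \<epsilon> 0 (\<rho> s) (flow s x)) \<le> ?m / \<epsilon>"
          using c.drift_bound[OF s'] by simp
      qed (use t in simp)
      also have "\<dots> \<le> (?m + 1) / \<epsilon> * T"
        using t \<epsilon> N1_moment_nonneg[where 'a='a] by (intro mult_mono divide_right_mono) auto
      finally have "norm (flow t x - x) \<le> (?m + 1) / \<epsilon> * T"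
        using sol[of x] by (simp add: solves_ode_from_def)
      then show "norm (flow t x) \<le> R + (?m + 1) / \<epsilon> * T"
        using norm_triangle_sub[of "flow t x" x] x by linarith
    qed
  qed
qed

lemma admissible_kernel_bounds:
  assumes "admissible_kernel V"
  shows "C1_fun V" "\<And>x. 0 \<le> V x" "\<exists>B. \<forall>x. V x \<le> B"
proof -
  show "C1_fun V" "\<And>x. 0 \<le> V x" using assms by (auto simp: admissible_kernel_def)
  have "bounded (range V)" using assms by (simp add: admissible_kernel_def Cb_fun_def)
  then obtain B where "\<forall>x. norm (V x) \<le> B" unfolding bounded_iff by auto
  then show "\<exists>B. \<forall>x. V x \<le> B" by (metis abs_le_D1 real_norm_def)
qed

theorem proposition5p2:
  shows
    "(\<forall>V1 :: 'a::euclidean_space \<Rightarrow> real.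
        admissible_kernel V1 \<and> C2_fun V1 \<and> compactly_supported V1 \<longrightarrow>
        (\<exists>C1 :: real \<Rightarrow> real \<Rightarrow> real.
           (\<forall>\<epsilon> \<sigma>. 0 < \<epsilon> \<and> 0 < \<sigma> \<and> \<sigma> < 1 \<longrightarrow> 0 < C1 \<epsilon> \<sigma>) \<and>
           (\<lambda>(\<epsilon>, \<sigma>). C1 \<epsilon> \<sigma>) \<in> \<Theta>[at_right 0 \<times>\<^sub>F at_right 0](\<lambda>(\<epsilon>, \<sigma>). (\<bar>ln \<sigma>\<bar> + real DIM('a) * \<bar>ln \<epsilon>\<bar> + 1) / \<epsilon>) \<and>
           (\<forall>(\<epsilon>::real) (\<sigma>::real) (T::real) (R::real) (\<rho>\<^sub>0 :: 'a measure) \<rho>.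
              0 < \<epsilon> \<and> 0 < \<sigma> \<and> \<sigma> < 1 \<and> 0 < T \<and> 0 < R \<and>
              \<rho>\<^sub>0 \<in> P2 \<and> measure_support \<rho>\<^sub>0 = cball 0 R \<and>
              jko_solution V1 \<epsilon> \<sigma> T \<rho>\<^sub>0 \<rho> \<longrightarrow>
              (\<exists>X :: real \<Rightarrow> 'a \<Rightarrow> 'a.
                 (\<forall>x. solves_ode_from (\<lambda>t z. - (1 - \<sigma>) *\<^sub>R omega V1 \<epsilon> \<sigma> (\<rho> t) z) T x (\<lambda>t. X t x) \<and>
                      (\<forall>y. solves_ode_from (\<lambda>t z. - (1 - \<sigma>) *\<^sub>R omega V1 \<epsilon> \<sigma> (\<rho> t) z) T x y \<longrightarrow>
                           (\<forall>t\<in>{0..T}. y t = X t x))) \<and>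
                 (\<forall>t\<in>{0..T}. is_pushforward (X t) \<rho>\<^sub>0 (\<rho> t))) \<and>
              (\<forall>t\<in>{0..T}. \<forall>x. norm (omega V1 \<epsilon> \<sigma> (\<rho> t) x) \<le> C1 \<epsilon> \<sigma> * jap x) \<and>
              (\<forall>t\<in>{0..T}. compact (measure_support (\<rho> t)) \<and>
                 measure_support (\<rho> t) \<subseteq> cball 0 (jap R * exp (C1 \<epsilon> \<sigma> * T))))))
     \<and>
     (\<exists>C > 0. \<forall>(\<epsilon>::real) (T::real) (R::real) (\<rho>\<^sub>0 :: 'a measure) \<rho>.
        0 < \<epsilon> \<and> 0 < T \<and> 0 < R \<and>
        \<rho>\<^sub>0 \<in> P2 \<and> measure_support \<rho>\<^sub>0 = cball 0 R \<and>
        jko_solution N1 \<epsilon> 0 T \<rho>\<^sub>0 \<rho> \<longrightarrow>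
        (\<exists>X :: real \<Rightarrow> 'a \<Rightarrow> 'a.
           (\<forall>x. solves_ode_from (\<lambda>t z. - omega N1 \<epsilon> 0 (\<rho> t) z) T x (\<lambda>t. X t x)) \<and>
           (\<forall>t\<in>{0..T}. is_pushforward (X t) \<rho>\<^sub>0 (\<rho> t))) \<and>
        (\<forall>t\<in>{0..T}. measure_support (\<rho> t) \<subseteq> cball 0 (R + C / \<epsilon> * T)))"
proof (intro conjI allI impI, goal_cases)
  case (1 V1)
  then have adm: "admissible_kernel V1" and cs: "compactly_supported V1" by auto
  note V = admissible_kernel_bounds(1,2)[OF adm]
  obtain B where B: "\<And>x. V1 x \<le> B"
    using admissible_kernel_bounds(3)[OF adm] by blast
  obtain r L where r: "0 \<le> r" "\<And>z. r < norm z \<Longrightarrow> grad V1 z = 0"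
    and L: "\<And>x y. \<bar>V1 x - V1 y\<bar> \<le> L * norm (x - y)"
    using compactly_supported_C1_bounds[OF V(1) cs] by blast
  show ?case
  \<comment> \<open>\<open>B\<close>, \<open>r\<close> and \<open>L\<close> were obtained from
    \<open>V1\<close> alone, so one function of \<epsilon> and \<sigma> serves all T, R and initial
    data.\<close>
  proof (rule exI[of _ "growth_const V1 B r"], intro conjI, goal_cases)
    case 1
    show ?case using growth_const_pos[OF r(1)] by blast
  next
    case 2
    show ?case by (rule growth_const_bigtheta[OF r(1)])
  next
    case 3
    show ?case
    proof (intro allI impI, goal_cases)
      case (1 \<epsilon> \<sigma> T R \<rho>\<^sub>0 \<rho>)
      then have par: "0 < \<epsilon>" "0 < \<sigma>" "\<sigma> < 1" "0 < T" and \<rho>\<^sub>0: "\<rho>\<^sub>0 = \<rho> 0"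
        and weak: "weak_measure_solution V1 \<epsilon> \<sigma> T \<rho>" and supp: "measure_support (\<rho> 0) = cball 0 R"
        by (auto simp: jko_solution_def)
      show ?case
        unfolding \<rho>\<^sub>0 by (intro conjI compact_kernel_solution[OF V B L r par weak supp])
    qed
  qed
next
  case 2
  show ?case
  \<comment> \<open>The summand 1 makes the constant positive from nonnegativity of the
    moment.\<close>
  proof (rule exI[of _ "N1_moment TYPE('a) + 1"], intro conjI, goal_cases)
    case 1
    show ?case using N1_moment_nonneg[where 'a='a] by simp
  next
    case 2
    show ?case
    proof (intro allI impI, goal_cases)
      case (1 \<epsilon> T R \<rho>\<^sub>0 \<rho>)
      then have par: "0 < \<epsilon>" "0 < T" and \<rho>\<^sub>0: "\<rho>\<^sub>0 = \<rho> 0"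
        and weak: "weak_measure_solution N1 \<epsilon> 0 T \<rho>" and supp: "measure_support (\<rho> 0) = cball 0 R"
        by (auto simp: jko_solution_def)
      show ?case
        unfolding \<rho>\<^sub>0 by (intro conjI exponential_kernel_solution[OF par weak supp])
    qed
  qed
qed

end
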